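(* Let $n\ge 2$ and let $A_2,\dots,A_n$ be any distinct positive real scalars. Let $\mathcal{D}$ be the right-invariant distribution on $\mathbf{SO}(n)$ consisting of the tangent vectors $\dot g=\Omega g$, $g\in\mathbf{SO}(n)$, where $\Omega\in\mathfrak{so}(n)$ is a skew-symmetric matrix whose only non-zero entries are in the first row and first column, i.e. $\Omega_{kl}=0$ whenever $k,l\ge 2$. Then the sub-Riemannian metric on $\mathbf{SO}(n)$ defined on the distribution $\mathcal{D}$ by the length $$\|\Omega g\|=\sqrt{A_2\Omega_{12}^2+\dots+A_n\Omega_{1n}^2}$$ defines an integrable Hamiltonian system on $T^*\mathbf{SO}(n)$.
   Context: A sub-Riemannian metric on a manifold $Q$ is determined by its cometric: the fibrewise self-adjoint map $\beta\colon T^*Q\to TQ$ of constant rank whose image is the distribution $\mathcal{D}$ and such that the inner product of $\beta(p_1)$ and $\beta(p_2)$ is $\langle p_1,\beta(p_2)\rangle$. The Hamiltonian system defined by the sub-Riemannian metric is the Hamiltonian flow on $T^*Q$ (with its canonical symplectic form) of the function $H(p)=\frac12\langle p,\beta(p)\rangle$. In the case at hand, identify $\mathfrak{so}(n)$ with its dual via the pairing $\langle M,\Omega\rangle=\frac12\operatorname{Tr}(M^T\Omega)=\sum_{k<l}M_{kl}\Omega_{kl}$. For $p\in T_g^*\mathbf{SO}(n)$ let $M=M(p)\in\mathfrak{so}(n)$ be the right translation of $p$ to the identity, i.e. $\langle M,\Omega\rangle=p(\Omega g)$ for all $\Omega\in\mathfrak{so}(n)$. The Hamiltonian is then $H(p)=\frac12\sum_{k=2}^n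 \frac{M_{1k}^2}{A_k}$. A Hamiltonian system on $T^*Q$ is called integrable if it is integrable in the sense of Liouville: the flow admits $\dim Q$ functionally independent integrals of motion (smooth functions on $T^*Q$, constant along the flow, whose differentials are linearly independent on an open dense subset) which mutually commute with respect to the canonical Poisson bracket on $T^*Q$. Here $\dim Q=\dim\mathbf{SO}(n)=n(n-1)/2$. *)

theory Defs
  imports "HOL-Analysis.Analysis"
begin

subsection \<open>Smooth functions\<close>

text \<open>For an open set \<open>U\<close>, \<open>Ck_on k U f\<close> says that all iterated directional derivatives of order
  at most \<open>k\<close> exist and are continuous on \<open>U\<close>.\<close>

fun Ck_on :: "nat \<Rightarrow> 'a set \<Rightarrow> ('a::real_normed_vector \<Rightarrow> 'b::real_normed_vector) \<Rightarrow> bool" where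
  "Ck_on 0 U f \<longleftrightarrow> continuous_on U f"
| "Ck_on (Suc k) U f \<longleftrightarrow> continuous_on U f \<and> (\<forall>x\<in>U. f differentiable (at x)) \<and>
     (\<forall>v. Ck_on k U (\<lambda>x. frechet_derivative f (at x) v))"

text \<open>Smooth functions on an embedded submanifold \<open>S\<close> of a Euclidean space: locally restrictions
  of smooth functions on open sets of the ambient space.\<close>

definition smooth_function :: "'a set \<Rightarrow> ('a::euclidean_space \<Rightarrow> 'b::real_normed_vector) \<Rightarrow> bool" where
  "smooth_function S f \<longleftrightarrow>
     (\<forall>x\<in>S. \<exists>U g. open U \<and> x \<in> U \<and> (\<forall>k. Ck_on k U g) \<and> (\<forall>y\<in>U \<inter> S. f y = g y))"

subsection \<open>Tangent and cotangent spaces of embedded submanifolds\<close>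

text \<open>Tangent vectors are velocities of curves in \<open>S\<close>; differentiability of the curve at the
  time in question suffices.\<close>

definition tangent_space :: "'a set \<Rightarrow> 'a \<Rightarrow> 'a::euclidean_space set" where
  "tangent_space S x =
     {v. \<exists>c. (\<forall>t. c t \<in> S) \<and> c (0::real) = x \<and> (c has_vector_derivative v) (at 0)}"

text \<open>A derivative within \<open>S\<close> is in general not unique as a linear map on the ambient space, but its
  restriction to \<open>tangent_space S x\<close> is, so for a smooth function \<open>f\<close> on \<open>S\<close> and a tangent vector
  \<open>v\<close> the following value is the intrinsic differential \<open>df(v)\<close>. It is only used for such \<open>v\<close>.\<close>

definition differential :: "'a set \<Rightarrow> ('a::euclidean_space \<Rightarrow> real) \<Rightarrow> 'a \<Rightarrow> 'a \<Rightarrow> real" where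
  "differential S f x v = frechet_derivative f (at x within S) v"

text \<open>A covector at \<open>q \<in> Q\<close>, i.e. a linear form on \<open>tangent_space Q q\<close>, is represented by the unique
  tangent vector \<open>p\<close> with pairing \<open>v \<mapsto> p \<bullet> v\<close>, where \<open>\<bullet>\<close> is the inner product of the ambient
  space. Thus the cotangent bundle is an embedded submanifold of the square of that space.\<close>

definition cotangent_bundle :: "'a::euclidean_space set \<Rightarrow> ('a \<times> 'a) set" where
  "cotangent_bundle Q = {(q, p). q \<in> Q \<and> p \<in> tangent_space Q q}"

subsection \<open>Hamiltonian systems on cotangent bundles\<close>

text \<open>In this representation the Liouville form at \<open>(q, p)\<close> is \<open>(v, w) \<mapsto> p \<bullet> v\<close>, i.e. it is the
  restriction of the form \<open>p dq\<close> of the ambient space. Hence the canonical symplectic form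
  \<open>dq \<and> dp\<close> of the cotangent bundle is the restriction of the following form to its tangent
  spaces.\<close>

definition symplectic_form :: "'a::euclidean_space \<times> 'a \<Rightarrow> 'a \<times> 'a \<Rightarrow> real" where
  "symplectic_form x y = fst x \<bullet> snd y - snd x \<bullet> fst y"

definition hamiltonian_vf ::
  "'a set \<Rightarrow> ('a::euclidean_space \<times> 'a \<Rightarrow> real) \<Rightarrow> 'a \<times> 'a \<Rightarrow> 'a \<times> 'a" where
  "hamiltonian_vf Q f z =
     (THE x. x \<in> tangent_space (cotangent_bundle Q) z \<and>
        (\<forall>y\<in>tangent_space (cotangent_bundle Q) z.
           symplectic_form x y = differential (cotangent_bundle Q) f z y))"

definition poisson_bracket ::
  "'a set \<Rightarrow> ('a::euclidean_space \<times> 'a \<Rightarrow> real) \<Rightarrow> ('a \<times> 'a \<Rightarrow> real) \<Rightarrow> 'a \<times> 'a \<Rightarrow> real" where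
  "poisson_bracket Q f g z = symplectic_form (hamiltonian_vf Q f z) (hamiltonian_vf Q g z)"

definition integral_curve ::
  "'a set \<Rightarrow> ('a::euclidean_space \<times> 'a \<Rightarrow> real) \<Rightarrow> real set \<Rightarrow> (real \<Rightarrow> 'a \<times> 'a) \<Rightarrow> bool" where
  "integral_curve Q H I z \<longleftrightarrow> open I \<and> is_interval I \<and>
     (\<forall>t\<in>I. z t \<in> cotangent_bundle Q \<and>
        (z has_vector_derivative hamiltonian_vf Q H (z t)) (at t))"

definition constant_along_flow ::
  "'a set \<Rightarrow> ('a::euclidean_space \<times> 'a \<Rightarrow> real) \<Rightarrow> ('a \<times> 'a \<Rightarrow> real) \<Rightarrow> bool" where
  "constant_along_flow Q H f \<longleftrightarrow>
     (\<forall>I z. integral_curve Q H I z \<longrightarrow> (\<forall>s\<in>I. \<forall>t\<in>I. f (z s) = f (z t)))"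

text \<open>Linear independence of the differentials is independence as linear forms on the tangent space
  of the cotangent bundle.\<close>

definition independent_at ::
  "'a set \<Rightarrow> nat \<Rightarrow> (nat \<Rightarrow> 'a::euclidean_space \<Rightarrow> real) \<Rightarrow> 'a \<Rightarrow> bool" where
  "independent_at S d F z \<longleftrightarrow>
     (\<forall>c. (\<forall>v\<in>tangent_space S z. (\<Sum>i<d. c i * differential S (F i) z v) = 0) \<longrightarrow>
        (\<forall>i<d. c i = 0))"

definition functionally_independent ::
  "'a set \<Rightarrow> nat \<Rightarrow> (nat \<Rightarrow> 'a::euclidean_space \<Rightarrow> real) \<Rightarrow> bool" where
  "functionally_independent S d F \<longleftrightarrow>
     (\<exists>U. openin (top_of_set S) U \<and> S \<subseteq> closure U \<and> (\<forall>z\<in>U. independent_at S d F z))"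

definition liouville_integrable ::
  "'a set \<Rightarrow> nat \<Rightarrow> ('a::euclidean_space \<times> 'a \<Rightarrow> real) \<Rightarrow> bool" where
  "liouville_integrable Q d H \<longleftrightarrow>
     (\<forall>q\<in>Q. dim (tangent_space Q q) = d) \<and>
     (\<exists>F. (\<forall>i<d. smooth_function (cotangent_bundle Q) (F i)) \<and>
          (\<forall>i<d. constant_along_flow Q H (F i)) \<and>
          (\<forall>i<d. \<forall>j<d. \<forall>z\<in>cotangent_bundle Q. poisson_bracket Q (F i) (F j) z = 0) \<and>
          functionally_independent (cotangent_bundle Q) d F)"

subsection \<open>Sub-Riemannian metrics\<close>

text \<open>A sub-Riemannian metric is given by its distribution \<open>D\<close> and by the length \<open>len q v\<close> of vectors
  \<open>v \<in> D q\<close>; the inner product is recovered from the length by polarization.\<close>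

definition length_inner :: "('a \<Rightarrow> 'a \<Rightarrow> real) \<Rightarrow> 'a \<Rightarrow> 'a \<Rightarrow> 'a::euclidean_space \<Rightarrow> real" where
  "length_inner len q v w = ((len q (v + w))\<^sup>2 - (len q v)\<^sup>2 - (len q w)\<^sup>2) / 2"

definition is_cometric ::
  "'a set \<Rightarrow> ('a \<Rightarrow> 'a set) \<Rightarrow> ('a \<Rightarrow> 'a \<Rightarrow> real) \<Rightarrow> ('a \<Rightarrow> 'a \<Rightarrow> 'a::euclidean_space) \<Rightarrow> bool" where
  "is_cometric Q D len \<beta> \<longleftrightarrow>
     smooth_function (cotangent_bundle Q) (\<lambda>(q, p). \<beta> q p) \<and>
     (\<forall>q\<in>Q. \<forall>p1\<in>tangent_space Q q. \<forall>p2\<in>tangent_space Q q. \<forall>a b.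
        \<beta> q (a *\<^sub>R p1 + b *\<^sub>R p2) = a *\<^sub>R \<beta> q p1 + b *\<^sub>R \<beta> q p2) \<and>
     (\<forall>q\<in>Q. \<forall>p1\<in>tangent_space Q q. \<forall>p2\<in>tangent_space Q q. p1 \<bullet> \<beta> q p2 = p2 \<bullet> \<beta> q p1) \<and>
     (\<exists>r. \<forall>q\<in>Q. dim (\<beta> q ` tangent_space Q q) = r) \<and>
     (\<forall>q\<in>Q. \<beta> q ` tangent_space Q q = D q) \<and>
     (\<forall>q\<in>Q. \<forall>p1\<in>tangent_space Q q. \<forall>p2\<in>tangent_space Q q.
        length_inner len q (\<beta> q p1) (\<beta> q p2) = p1 \<bullet> \<beta> q p2)"

text \<open>The cometric is unique on the cotangent bundle. Its existence is part of the definition, so that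
  the quantification over all cometrics is not vacuous.\<close>

definition defines_integrable_system ::
  "'a::euclidean_space set \<Rightarrow> nat \<Rightarrow> ('a \<Rightarrow> 'a set) \<Rightarrow> ('a \<Rightarrow> 'a \<Rightarrow> real) \<Rightarrow> bool" where
  "defines_integrable_system Q d D len \<longleftrightarrow>
     (\<exists>\<beta>. is_cometric Q D len \<beta>) \<and>
     (\<forall>\<beta>. is_cometric Q D len \<beta> \<longrightarrow> liouville_integrable Q d (\<lambda>(q, p). (p \<bullet> \<beta> q p) / 2))"

subsection \<open>The special orthogonal group\<close>

text \<open>Rows and columns are indexed by a finite type \<open>'n\<close>; the parameter \<open>first\<close> below is the index
  called 1 in the usual numbering.\<close>

definition SO :: "(real^'n^'n) set" where
  "SO = {g. orthogonal_matrix g \<and> det g = 1}"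

definition first_row_distribution :: "'n \<Rightarrow> real^'n^'n \<Rightarrow> (real^'n^'n) set" where
  "first_row_distribution first g =
     {\<Omega> ** g | \<Omega>. transpose \<Omega> = - \<Omega> \<and> (\<forall>k l. k \<noteq> first \<and> l \<noteq> first \<longrightarrow> \<Omega> $ k $ l = 0)}"

text \<open>For \<open>v = \<Omega> ** g\<close> with \<open>g\<close> orthogonal, \<open>v ** transpose g\<close> is \<open>\<Omega>\<close>.\<close>

definition first_row_length :: "'n \<Rightarrow> ('n::finite \<Rightarrow> real) \<Rightarrow> real^'n^'n \<Rightarrow> real^'n^'n \<Rightarrow> real" where
  "first_row_length first A g v =
     sqrt (\<Sum>k\<in>UNIV - {first}. A k * ((v ** transpose g) $ first $ k)\<^sup>2)"

end

theory Submission
  imports Defs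
begin

text \<open>In the right trivialization, with \<open>P = p ** transpose q\<close> (half of the momentum of the paper),
  the Hamiltonian belongs to the Manakov family of the diagonal matrix \<open>a\<close> with the distinct entries
  \<open>1\<close> and \<open>1 + A\<^sub>k\<close>: for all real \<open>l\<close>, \<open>s\<close> the functions \<open>det (1 - l a - s P)\<close> are integrals and
  commute with each other. The functions \<open>det (1 - l a - s m)\<close> of the left momentum
  \<open>m = transpose q ** p\<close> also commute with each other, and they commute with every function of \<open>P\<close>.
  Suppose that \<open>N\<close> of the former are independent on the skew matrices, and that the differentials of \<open>N'\<close>
  of the latter are independent on the tangent space of the coadjoint orbit through \<open>m\<close>. Then the
  union of the two families is independent, since functions of \<open>P\<close> do not change under right
  translations.

  It remains to find, by induction in steps of two on the size \<open>k\<close> of the matrices, a point where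
  this holds with \<open>N + N' = n(n-1)/2\<close>. By conjugation invariance, a differential in a direction tangent
  to the orbit is proportional to the derivative of the determinant in a symmetric direction with zero
  diagonal. So one has to count the linearly independent functions of \<open>(l, s)\<close> among the derivatives
  of the determinant in skew, respectively symmetric, directions. Border the matrix by a
  \<open>2 \<times> 2\<close> skew block of size \<open>1/e\<close>. As \<open>e\<close> tends to \<open>0\<close>, the old functions survive up to the factor
  \<open>s\<^sup>2\<close>, and the terms of lowest order in \<open>s\<close> give \<open>k + 1\<close>, respectively \<open>k\<close>, new ones: up to factors,
  the Lagrange basis polynomials in \<open>l\<close> with the nodes \<open>1/a\<^sub>i\<close>.\<close>

subsection \<open>Independent families of functions\<close>

text \<open>Up to a factor, Manakov's Hamiltonians have the gradient entries (b_i - b_j) P_ij / (a_i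
  - a_j). If b has a single nonzero entry, at \<open>first\<close>, only the first row and column
  remain, and the metric prescribes the differences a_k - a_first = A_k. The common shift by 1 is
  free; it keeps all entries nonzero, so that the nodes 1/a_i exist.

  No independent point is written down explicitly. A family depending polynomially on a parameter
  and independent for one value of it is independent off the zero set of a nonzero polynomial. Hence
  the value e = 0, which belongs to no bordered matrix, may serve as a test value, and the
  conditions behind \<open>N\<close> and \<open>N'\<close> may be checked at different matrices.

  Transposing the pencil of a skew matrix turns s into -s. So skew directions see the odd part in s
  of a cofactor and symmetric directions the even part; this decides which bordering directions are
  used in each case.

  A step of two raises the rank of the Lie algebra by one, and \<open>N\<close> and
  \<open>N'\<close> are the largest possible numbers: (dim + rank)/2 commuting functions on the Lie
  algebra, and (dim - rank)/2, half the dimension of a generic orbit.\<close>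

definition indep_funs :: "'k set \<Rightarrow> 'p set \<Rightarrow> ('k \<Rightarrow> 'p \<Rightarrow> real) \<Rightarrow> bool" where
  "indep_funs K L h \<longleftrightarrow> (\<forall>c. (\<forall>x\<in>L. (\<Sum>k\<in>K. c k * h k x) = 0) \<longrightarrow> (\<forall>k\<in>K. c k = 0))"

lemma indep_funsI:
  assumes "\<And>c k. (\<And>x. x \<in> L \<Longrightarrow> (\<Sum>k\<in>K. c k * h k x) = 0) \<Longrightarrow> k \<in> K \<Longrightarrow> c k = 0"
  shows "indep_funs K L h"
  using assms unfolding indep_funs_def by blast

lemma indep_funsD:
  assumes "indep_funs K L h" "\<And>x. x \<in> L \<Longrightarrow> (\<Sum>k\<in>K. c k * h k x) = 0" "k \<in> K"
  shows "c k = 0"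
  using assms unfolding indep_funs_def by blast

lemma indep_funs_cong:
  assumes "\<And>k x. k \<in> K \<Longrightarrow> x \<in> L \<Longrightarrow> h k x = h' k x"
  shows "indep_funs K L h = indep_funs K L h'"
proof -
  have "(\<Sum>k\<in>K. c k * h k x) = (\<Sum>k\<in>K. c k * h' k x)" if "x \<in> L" for c x
    using assms that by (intro sum.cong) auto
  then show ?thesis unfolding indep_funs_def by auto
qed

lemma indep_funs_scale:
  assumes "indep_funs K L (\<lambda>k x. a k * h k x)" "\<And>k. k \<in> K \<Longrightarrow> a k \<noteq> 0"
  shows "indep_funs K L h"
proof (rule indep_funsI)
  fix c k assume c: "\<And>x. x \<in> L \<Longrightarrow> (\<Sum>k\<in>K. c k * h k x) = 0" and k: "k \<in> K"
  have "(\<Sum>k\<in>K. c k / a k * (a k * h k x)) = 0" if "x \<in> L" for x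
  proof -
    have "(\<Sum>k\<in>K. c k / a k * (a k * h k x)) = (\<Sum>k\<in>K. c k * h k x)"
      using assms(2) by (intro sum.cong) auto
    then show ?thesis using c that by simp
  qed
  then have "c k / a k = 0" using indep_funsD[OF assms(1), of "\<lambda>k. c k / a k"] k by blast
  then show "c k = 0" using assms(2)[OF k] by simp
qed

text \<open>One step of Gaussian elimination with the pivot \<open>h k0 x\<close>. Cross
  multiplication in place of division keeps the new functions polynomial in every parameter in which
  the old ones are polynomial.\<close>

lemma indep_funs_insert_iff:
  assumes "finite K" "k0 \<notin> K" "x \<in> L" "h k0 x \<noteq> 0"
  shows "indep_funs (insert k0 K) L h \<longleftrightarrow>
    indep_funs K L (\<lambda>k y. h k0 x * h k y - h k x * h k0 y)"
proof
  assume ind: "indep_funs (insert k0 K) L h"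
  show "indep_funs K L (\<lambda>k y. h k0 x * h k y - h k x * h k0 y)"
  proof (rule indep_funsI)
    fix c k assume c: "\<And>y. y \<in> L \<Longrightarrow> (\<Sum>k\<in>K. c k * (h k0 x * h k y - h k x * h k0 y)) = 0"
      and k: "k \<in> K"
    \<comment> \<open>These are the coefficients obtained by expanding the eliminated combination in
      the original functions.\<close>
    define c' where "c' k = (if k = k0 then - (\<Sum>k\<in>K. c k * h k x) else h k0 x * c k)" for k
    have "(\<Sum>k\<in>insert k0 K. c' k * h k y) = 0" if "y \<in> L" for y
    proof -
      have "(\<Sum>k\<in>insert k0 K. c' k * h k y) = c' k0 * h k0 y + (\<Sum>k\<in>K. c' k * h k y)"
        using assms by simp
      also have "(\<Sum>k\<in>K. c' k * h k y) = (\<Sum>k\<in>K. h k0 x * c k * h k y)"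
        using assms by (intro sum.cong) (auto simp: c'_def)
      also have "c' k0 * h k0 y + \<dots> = (\<Sum>k\<in>K. c k * (h k0 x * h k y - h k x * h k0 y))"
        by (simp add: c'_def sum_distrib_right sum_distrib_left sum_negf[symmetric]
            sum.distrib[symmetric] algebra_simps)
      finally show ?thesis using c that by simp
    qed
    then have "c' k = 0" using indep_funsD[OF ind, of c' k] k by blast
    then show "c k = 0" using assms k by (auto simp: c'_def split: if_splits)
  qed
next
  assume ind: "indep_funs K L (\<lambda>k y. h k0 x * h k y - h k x * h k0 y)"
  show "indep_funs (insert k0 K) L h"
  proof (rule indep_funsI)
    fix c k assume "\<And>y. y \<in> L \<Longrightarrow> (\<Sum>k\<in>insert k0 K. c k * h k y) = 0"
      and k: "k \<in> insert k0 K"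
    then have c: "c k0 * h k0 y + (\<Sum>k\<in>K. c k * h k y) = 0" if "y \<in> L" for y
      using assms that by simp
    have cK: "c k = 0" if "k \<in> K" for k
    proof (rule indep_funsD[OF ind _ that])
      fix y assume y: "y \<in> L"
      have "(\<Sum>k\<in>K. c k * (h k0 x * h k y - h k x * h k0 y)) =
        h k0 x * (\<Sum>k\<in>K. c k * h k y) - (\<Sum>k\<in>K. c k * h k x) * h k0 y"
        by (simp add: sum_distrib_right sum_distrib_left sum_subtractf[symmetric] algebra_simps)
      also have "(\<Sum>k\<in>K. c k * h k y) = - c k0 * h k0 y" using c[OF y] by simp
      also have "(\<Sum>k\<in>K. c k * h k x) = - c k0 * h k0 x" using c[OF assms(3)] by simp
      finally show "(\<Sum>k\<in>K. c k * (h k0 x * h k y - h k x * h k0 y)) = 0" by simp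
    qed
    then show "c k = 0" using c[OF assms(3)] assms k by auto
  qed
qed

lemma indep_funs_nonzero:
  assumes "finite K" "indep_funs K L h" "k0 \<in> K"
  shows "\<exists>x\<in>L. h k0 x \<noteq> 0"
proof (rule ccontr)
  assume neg: "\<not> ?thesis"
  have "(\<Sum>k\<in>K. (if k = k0 then 1 else 0) * h k x) = 0" if "x \<in> L" for x
    using neg that assms by (intro sum.neutral) auto
  then have "(if k0 = k0 then 1 else 0 :: real) = 0"
    using indep_funsD[OF assms(2), of "\<lambda>k. if k = k0 then 1 else 0" k0] assms(3) by blast
  then show False by simp
qed

text \<open>\<open>D\<close> is the product of the pivots of a fraction-free elimination.\<close>

lemma indep_funs_generic:
  fixes H :: "'e::real_normed_vector \<Rightarrow> 'k \<Rightarrow> 'p \<Rightarrow> real"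
  assumes "finite K" "\<And>k x. k \<in> K \<Longrightarrow> x \<in> L \<Longrightarrow> real_polynomial_function (\<lambda>e. H e k x)"
    "indep_funs K L (H e0)"
  shows "\<exists>D. real_polynomial_function D \<and> D e0 \<noteq> 0 \<and> (\<forall>e. D e \<noteq> 0 \<longrightarrow> indep_funs K L (H e))"
  using assms
proof (induction K arbitrary: H rule: finite_induct)
  case empty
  show ?case by (intro exI[of _ "\<lambda>_. 1"]) (auto simp: indep_funs_def)
next
  case (insert k0 K)
  obtain x where x: "x \<in> L" "H e0 k0 x \<noteq> 0"
    using indep_funs_nonzero[OF _ insert.prems(2)] insert.hyps by auto
  define H' where "H' e k y = H e k0 x * H e k y - H e k x * H e k0 y" for e k y
  have "indep_funs K L (H' e0)"
    using insert.prems(2) indep_funs_insert_iff[OF insert.hyps x(1), of "H e0"] x(2)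
    by (simp add: H'_def[abs_def])
  moreover have "real_polynomial_function (\<lambda>e. H' e k y)" if "k \<in> K" "y \<in> L" for k y
    unfolding H'_def using that x insert.prems(1)
    by (intro real_polynomial_function_diff real_polynomial_function.intros(4)) auto
  ultimately obtain D where D: "real_polynomial_function D" "D e0 \<noteq> 0"
    "\<And>e. D e \<noteq> 0 \<Longrightarrow> indep_funs K L (H' e)"
    using insert.IH[of H'] by blast
  have "indep_funs (insert k0 K) L (H e)" if "H e k0 x * D e \<noteq> 0" for e
    using that D(3)[of e] indep_funs_insert_iff[OF insert.hyps x(1), of "H e"]
    by (simp add: H'_def[abs_def])
  moreover have "real_polynomial_function (\<lambda>e. H e k0 x * D e)"
    using D insert.prems(1) x by (intro real_polynomial_function.intros(4)) auto
  ultimately show ?case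
    using x D(2) by (intro exI[of _ "\<lambda>e. H e k0 x * D e"]) auto
qed

text \<open>Row rank equals column rank: \<open>card K\<close> independent functions have a
  nonsingular square matrix of values at \<open>card K\<close> suitable points. In the application
  the points are values of the parameters (l, s), so a count of independent functions of (l, s)
  becomes a choice of integrals.\<close>

lemma indep_funs_points:
  assumes "finite K" "indep_funs K L h"
  shows "\<exists>P\<subseteq>L. finite P \<and> card P = card K \<and> indep_funs P K (\<lambda>x k. h k x)"
  using assms
proof (induction K arbitrary: h rule: finite_induct)
  case empty
  show ?case by (intro exI[of _ "{}"]) (auto simp: indep_funs_def)
next
  case (insert k0 K)
  obtain x where x: "x \<in> L" "h k0 x \<noteq> 0"
    using indep_funs_nonzero[OF _ insert.prems] insert.hyps by auto
  define h' where "h' k y = h k0 x * h k y - h k x * h k0 y" for k y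
  have "indep_funs K L h'"
    using insert.prems indep_funs_insert_iff[OF insert.hyps x(1), of h] x(2)
    by (simp add: h'_def[abs_def])
  then obtain P where P: "P \<subseteq> L" "finite P" "card P = card K" "indep_funs P K (\<lambda>x k. h' k x)"
    using insert.IH[of h'] by blast
  \<comment> \<open>All \<open>h' k\<close> vanish at the pivot point \<open>x\<close>, so
    \<open>x\<close> cannot be among the points already found.\<close>
  have "\<exists>k\<in>K. h' k x \<noteq> 0" if "x \<in> P"
    using indep_funs_nonzero[OF P(2,4) that] .
  then have xP: "x \<notin> P" by (auto simp: h'_def)
  have "indep_funs (insert x P) (insert k0 K) (\<lambda>x k. h k x)"
  proof (rule indep_funsI)
    fix c y assume "\<And>k. k \<in> insert k0 K \<Longrightarrow> (\<Sum>y\<in>insert x P. c y * h k y) = 0"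
      and y: "y \<in> insert x P"
    then have c: "c x * h k x + (\<Sum>y\<in>P. c y * h k y) = 0" if "k \<in> insert k0 K" for k
      using that xP P(2) by simp
    have cP: "c y = 0" if "y \<in> P" for y
    proof (rule indep_funsD[OF P(4) _ that])
      fix k assume k: "k \<in> K"
      have "(\<Sum>y\<in>P. c y * h' k y) =
        h k0 x * (\<Sum>y\<in>P. c y * h k y) - h k x * (\<Sum>y\<in>P. c y * h k0 y)"
        by (simp add: h'_def sum_distrib_left sum_subtractf[symmetric] algebra_simps)
      also have "(\<Sum>y\<in>P. c y * h k y) = - c x * h k x" using c[of k] k by simp
      also have "(\<Sum>y\<in>P. c y * h k0 y) = - c x * h k0 x" using c[of k0] by simp
      finally show "(\<Sum>y\<in>P. c y * h' k y) = 0" by simp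
    qed
    then show "c y = 0" using c[of k0] x y by auto
  qed
  then show ?case using P xP x insert.hyps by (intro exI[of _ "insert x P"]) auto
qed

subsection \<open>Polynomial functions\<close>

lemma finite_zeros_real_polynomial_function:
  fixes f :: "real \<Rightarrow> real"
  assumes "real_polynomial_function f" "f t0 \<noteq> 0"
  shows "finite {t. f t = 0}"
proof -
  obtain a n where f: "f = (\<lambda>x. \<Sum>i\<le>n. a i * x ^ i)"
    using assms(1) real_polynomial_function_imp_sum by blast
  show ?thesis
    unfolding f polyfun_finite_roots
  proof (rule ccontr)
    assume "\<not> (\<exists>k\<le>n. a k \<noteq> 0)"
    then have "f t0 = 0" by (simp add: f)
    with assms(2) show False by simp
  qed
qed

text \<open>On the line through \<open>x\<close> and \<open>u\<close> the function is a polynomial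
  in one variable that is nonzero at parameter 1; it has finitely many zeros, so some arbitrarily
  small parameter avoids them.\<close>

lemma real_polynomial_function_nonzero_near:
  fixes f :: "'a::real_normed_vector \<Rightarrow> real"
  assumes "real_polynomial_function f" "f u \<noteq> 0" "subspace V" "u \<in> V" "x \<in> V" "e > 0"
  shows "\<exists>y\<in>V. dist y x < e \<and> f y \<noteq> 0"
proof -
  let ?l = "\<lambda>t::real. x + t *\<^sub>R (u - x)"
  have "polynomial_function ?l"
    by (intro polynomial_function_add polynomial_function_const polynomial_function_bounded_linear
        bounded_linear_scaleR_left)
  then have "real_polynomial_function (f \<circ> ?l)"
    using assms(1) by (rule real_polynomial_function_compose)
  moreover have "(f \<circ> ?l) 1 \<noteq> 0" using assms(2) by simp
  ultimately have fin: "finite {t. (f \<circ> ?l) t = 0}" by (rule finite_zeros_real_polynomial_function)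
  define d where "d = e / (norm (u - x) + 1)"
  have d: "d > 0" using assms(6) by (simp add: d_def add_nonneg_pos)
  have "infinite {0<..<d}" using d by (simp add: infinite_Ioo)
  then obtain t where t: "t \<in> {0<..<d}" "(f \<circ> ?l) t \<noteq> 0"
    using fin by (metis (mono_tags, lifting) mem_Collect_eq rev_finite_subset subsetI)
  have "dist (?l t) x = t * norm (u - x)" using t by (simp add: dist_norm)
  also have "\<dots> \<le> d * norm (u - x)" using t by (intro mult_right_mono) auto
  also have "\<dots> < d * (norm (u - x) + 1)" using d by simp
  also have "\<dots> = e" by (simp add: d_def add_nonneg_eq_0_iff)
  finally have "dist (?l t) x < e" .
  moreover have "?l t \<in> V" using assms(3-5) by (intro subspace_add subspace_mul subspace_diff)
  ultimately show ?thesis using t(2) by (intro bexI[of _ "?l t"]) auto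
qed

text \<open>The two functions come with different witnesses. A point with \<open>f\<close> nonzero
  is found near \<open>x\<close>, then moved so little to make \<open>g\<close> nonzero that
  continuity keeps \<open>f\<close> nonzero.\<close>

lemma real_polynomial_function_nonzero_near2:
  fixes f :: "'a::real_normed_vector \<Rightarrow> real"
  assumes f: "real_polynomial_function f" "f u \<noteq> 0" "u \<in> V"
    and g: "real_polynomial_function g" "g w \<noteq> 0" "w \<in> V"
    and V: "subspace V" "x \<in> V" "e > 0"
  shows "\<exists>y\<in>V. dist y x < e \<and> f y \<noteq> 0 \<and> g y \<noteq> 0"
proof -
  obtain y where y: "y \<in> V" "dist y x < e / 2" "f y \<noteq> 0"
    using real_polynomial_function_nonzero_near[OF f(1,2) V(1) f(3) V(2), of "e / 2"] V(3) by auto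
  have "isCont f y" using f(1) continuous_real_polymonial_function by blast
  then obtain d where d: "d > 0" "\<And>z. dist z y < d \<Longrightarrow> dist (f z) (f y) < \<bar>f y\<bar>"
    using y(3) unfolding continuous_at_eps_delta by (metis zero_less_abs_iff)
  obtain z where z: "z \<in> V" "dist z y < min d (e / 2)" "g z \<noteq> 0"
    using real_polynomial_function_nonzero_near[OF g(1,2) V(1) g(3) y(1), of "min d (e / 2)"] V(3) d
    by auto
  have "f z \<noteq> 0" using d(2)[of z] z by (auto simp: dist_real_def)
  moreover have "dist z x < e"
    using dist_triangle[of z x y] y z by auto
  ultimately show ?thesis using z by blast
qed

text \<open>Directional derivatives are polynomial again, which is what lets the induction on the
  order in \<open>Ck_on\<close> close.\<close>

lemma polynomial_function_has_derivative:
  fixes f :: "'a::euclidean_space \<Rightarrow> real"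
  assumes "real_polynomial_function f"
  shows "\<exists>f'. (\<forall>x. (f has_derivative f' x) (at x)) \<and> (\<forall>v. real_polynomial_function (\<lambda>x. f' x v))"
  using assms
proof induction
  case (linear f)
  then show ?case
    by (intro exI[of _ "\<lambda>_. f"]) (auto simp: bounded_linear_imp_has_derivative)
next
  case (const c)
  show ?case by (intro exI[of _ "\<lambda>_ _. 0"]) auto
next
  case (add f g)
  then obtain f' g' where "\<forall>x. (f has_derivative f' x) (at x)" "\<forall>v. real_polynomial_function (\<lambda>x. f' x v)"
    "\<forall>x. (g has_derivative g' x) (at x)" "\<forall>v. real_polynomial_function (\<lambda>x. g' x v)"
    by blast
  then show ?case
    by (intro exI[of _ "\<lambda>x v. f' x v + g' x v"])
      (auto intro!: has_derivative_add real_polynomial_function.intros(3))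
next
  case (mult f g)
  then obtain f' g' where "\<forall>x. (f has_derivative f' x) (at x)" "\<forall>v. real_polynomial_function (\<lambda>x. f' x v)"
    "\<forall>x. (g has_derivative g' x) (at x)" "\<forall>v. real_polynomial_function (\<lambda>x. g' x v)"
    by blast
  then show ?case using mult.hyps
    by (intro exI[of _ "\<lambda>x v. f x * g' x v + f' x v * g x"])
      (auto intro!: has_derivative_mult real_polynomial_function.intros(3) real_polynomial_function.intros(4))
qed

lemma Ck_on_sum:
  assumes "finite B" "\<And>b. b \<in> B \<Longrightarrow> Ck_on k UNIV (f b)"
  shows "Ck_on k UNIV (\<lambda>x. \<Sum>b\<in>B. f b x)"
  using assms(2)
proof (induction k arbitrary: f)
  case 0
  then show ?case by (auto intro!: continuous_on_sum)
next
  case (Suc k)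
  have "((\<lambda>x. \<Sum>b\<in>B. f b x) has_derivative (\<lambda>v. \<Sum>b\<in>B. frechet_derivative (f b) (at x) v)) (at x)"
    for x
    using Suc.prems by (intro has_derivative_sum) (auto simp: frechet_derivative_works)
  then have "frechet_derivative (\<lambda>x. \<Sum>b\<in>B. f b x) (at x) = (\<lambda>v. \<Sum>b\<in>B. frechet_derivative (f b) (at x) v)"
    "(\<lambda>x. \<Sum>b\<in>B. f b x) differentiable (at x)" for x
    by (auto simp: frechet_derivative_at[symmetric] differentiable_def)
  then show ?case using Suc by (auto intro!: continuous_on_sum)
qed

lemma Ck_on_scaleR_const:
  assumes "real_polynomial_function f"
  shows "Ck_on k UNIV (\<lambda>x::'a::euclidean_space. f x *\<^sub>R b)"
  using assms
proof (induction k arbitrary: f)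
  case 0
  then show ?case
    by (auto intro!: continuous_intros continuous_on_polymonial_function simp: real_polynomial_function_eq)
next
  case (Suc k)
  obtain f' where f': "\<And>x. (f has_derivative f' x) (at x)" "\<And>v. real_polynomial_function (\<lambda>x. f' x v)"
    using polynomial_function_has_derivative[OF Suc.prems] by blast
  have d: "((\<lambda>x. f x *\<^sub>R b) has_derivative (\<lambda>v. f' x v *\<^sub>R b)) (at x)" for x
    by (intro has_derivative_scaleR_left f')
  have "frechet_derivative (\<lambda>x. f x *\<^sub>R b) (at x) = (\<lambda>v. f' x v *\<^sub>R b)" for x
    using frechet_derivative_at[OF d] by simp
  moreover have "(\<lambda>x. f x *\<^sub>R b) differentiable (at x)" for x
    using d unfolding differentiable_def by blast
  moreover have "continuous_on UNIV (\<lambda>x. f x *\<^sub>R b)"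
    using Suc.prems
    by (auto intro!: continuous_intros continuous_on_polymonial_function simp: real_polynomial_function_eq)
  ultimately show ?case using Suc.IH[OF f'(2)] by simp
qed

lemma smooth_function_polynomial:
  fixes f :: "'a::euclidean_space \<Rightarrow> 'b::euclidean_space"
  assumes "polynomial_function f"
  shows "smooth_function S f"
proof -
  have "Ck_on k UNIV (\<lambda>x. \<Sum>b\<in>Basis. (f x \<bullet> b) *\<^sub>R b)" for k
    using assms by (intro Ck_on_sum Ck_on_scaleR_const)
      (auto simp: polynomial_function_iff_Basis_inner)
  then have "Ck_on k UNIV f" for k by (simp add: euclidean_representation)
  then show ?thesis unfolding smooth_function_def by blast
qed

subsection \<open>Determinants and adjugates\<close>

definition row_upd :: "real^'n^'n \<Rightarrow> 'n \<Rightarrow> real^'n \<Rightarrow> real^'n^'n" where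
  "row_upd B k v = (\<chi> i. if i = k then v else B $ i)"

text \<open>Replacing the whole row by a unit vector yields the minor together with its sign, and no
  rows or columns are deleted, so the index type stays the same.\<close>

definition cof :: "real^'n^'n \<Rightarrow> 'n \<Rightarrow> 'n \<Rightarrow> real" where
  "cof B k l = det (row_upd B k (axis l 1))"

definition adjugate :: "real^'n^'n \<Rightarrow> real^'n^'n" where
  "adjugate B = (\<chi> i j. cof B j i)"

text \<open>Jacobi's formula: the trace of \<open>adjugate B ** X\<close>, which is the derivative
  of \<open>det\<close> at \<open>B\<close> in the direction \<open>X\<close>.\<close>

definition ddet :: "real^'n^'n \<Rightarrow> real^'n^'n \<Rightarrow> real" where
  "ddet B X = (\<Sum>k\<in>UNIV. \<Sum>l\<in>UNIV. X $ k $ l * cof B k l)"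

lemma scalar_mult_scaleR: "c *s v = c *\<^sub>R v" for v :: "real^'n"
  by (simp add: vec_eq_iff)

lemma row_upd_nth: "row_upd B k v $ i = (if i = k then v else B $ i)"
  by (simp add: row_upd_def)

lemma row_upd_self [simp]: "row_upd B k (B $ k) = B"
  by (simp add: row_upd_def vec_eq_iff)

lemma row_upd_twice [simp]: "row_upd (row_upd B k v) k w = row_upd B k w"
  by (simp add: row_upd_def vec_eq_iff)

lemma row_upd_commute: "j \<noteq> k \<Longrightarrow> row_upd (row_upd B j v) k w = row_upd (row_upd B k w) j v"
  by (simp add: row_upd_def vec_eq_iff)

lemma det_row_upd_add: "det (row_upd B k (v + w)) = det (row_upd B k v) + det (row_upd B k w)"
  unfolding row_upd_def by (rule det_row_add)

lemma det_row_upd_scale: "det (row_upd B k (c *\<^sub>R v)) = c * det (row_upd B k v)"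
  using det_row_mul[of k c "\<lambda>_. v" "\<lambda>i. B $ i"]
  unfolding row_upd_def scalar_mult_scaleR .

lemma row_upd_shadow:
  "j \<noteq> k \<Longrightarrow> row_upd (row_upd (row_upd B j v) k w) j u = row_upd (row_upd B j u) k w"
  by (simp add: row_upd_def vec_eq_iff)

lemma det_row_upd_scale2:
  "j \<noteq> k \<Longrightarrow> det (row_upd (row_upd B j (c *\<^sub>R v)) k w) = c * det (row_upd (row_upd B j v) k w)"
  by (simp add: row_upd_commute[of j k] det_row_upd_scale)

lemma det_row_upd_scale3:
  assumes "i \<noteq> j" "i \<noteq> k"
  shows "det (row_upd (row_upd (row_upd B i (c *\<^sub>R v)) j w) k u) =
    c * det (row_upd (row_upd (row_upd B i v) j w) k u)"
  using assms by (simp add: row_upd_commute[of i j] row_upd_commute[of i k] det_row_upd_scale)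

lemma det_row_upd_0 [simp]: "det (row_upd B k 0) = 0"
  unfolding row_upd_def by (rule det_row_0)

lemma det_row_upd_sum:
  "finite S \<Longrightarrow> det (row_upd B k (\<Sum>l\<in>S. f l)) = (\<Sum>l\<in>S. det (row_upd B k (f l)))"
  by (induction S rule: finite_induct) (auto simp: det_row_upd_add)

lemma det_equal_rows: "j \<noteq> k \<Longrightarrow> B $ j = B $ k \<Longrightarrow> det B = 0" for B :: "real^'n^'n"
  by (rule det_identical_rows[of j k]) (auto simp: row_def vec_eq_iff)

lemma det_row_upd_swap:
  assumes "j \<noteq> k"
  shows "det (row_upd (row_upd B j v) k w) = - det (row_upd (row_upd B j w) k v)"
proof -
  let ?d = "\<lambda>v w. det (row_upd (row_upd B j v) k w)"
  have z: "?d v v = 0" for v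
    using assms by (intro det_equal_rows[of j k]) (auto simp: row_upd_nth)
  have l: "?d (v + v') w = ?d v w + ?d v' w" for v v' w
    using assms by (simp add: row_upd_commute[of j k] det_row_upd_add)
  have "0 = ?d (v + w) (v + w)" using z by simp
  also have "\<dots> = ?d v w + ?d w v" by (simp only: l det_row_upd_add z)
  finally show ?thesis by simp
qed

lemma vec_expand: "v = (\<Sum>l\<in>UNIV. v $ l *\<^sub>R axis l 1)" for v :: "real^'n"
  by (simp add: vec_eq_iff axis_def if_distrib sum.delta cong: if_cong)

lemma det_row_upd_expand: "det (row_upd B k v) = (\<Sum>l\<in>UNIV. v $ l * cof B k l)"
proof -
  have "det (row_upd B k v) = det (row_upd B k (\<Sum>l\<in>UNIV. v $ l *\<^sub>R axis l 1))"
    using vec_expand[of v] by simp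
  also have "\<dots> = (\<Sum>l\<in>UNIV. v $ l * cof B k l)"
    by (subst det_row_upd_sum) (auto simp: det_row_upd_scale cof_def)
  finally show ?thesis .
qed

lemma ddet_rows: "ddet B X = (\<Sum>k\<in>UNIV. det (row_upd B k (X $ k)))"
  by (simp add: ddet_def det_row_upd_expand)

lemma det_zero_row': "A $ p = 0 \<Longrightarrow> det A = 0" for A :: "real^'n^'n"
  by (metis det_row_upd_0 row_upd_self)

lemma det_zero_col': "(\<And>i. A $ i $ q = 0) \<Longrightarrow> det A = 0" for A :: "real^'n^'n"
proof -
  assume "\<And>i. A $ i $ q = 0"
  then have "transpose A $ q = 0" by (simp add: transpose_def vec_eq_iff)
  then show ?thesis using det_zero_row'[of "transpose A" q] by simp
qed

text \<open>Column \<open>q\<close> is the unit vector of index \<open>p\<close> plus a remainder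
  \<open>w\<close>. With \<open>w\<close> alone in that column, row \<open>p\<close> becomes zero
  and the determinant vanishes.\<close>

lemma det_unit_row_aux:
  fixes A A' :: "real^'n^'n"
  assumes "A $ p = axis q 1" "A' $ p = axis q 1" "\<And>i j. i \<noteq> p \<Longrightarrow> j \<noteq> q \<Longrightarrow> A' $ i $ j = A $ i $ j"
    "\<And>i. i \<noteq> p \<Longrightarrow> A' $ i $ q = 0"
  shows "det A' = det A"
proof -
  define w where "w = (\<chi> i. if i = p then 0 else A $ i $ q)"
  have "transpose A $ q = axis p 1 + w"
    using assms by (auto simp: transpose_def w_def axis_def vec_eq_iff)
  then have "det A = det (row_upd (transpose A) q (axis p 1 + w))"
    by (metis det_transpose row_upd_self)
  also have "\<dots> = det (row_upd (transpose A) q (axis p 1)) + det (row_upd (transpose A) q w)"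
    by (rule det_row_upd_add)
  also have "row_upd (transpose A) q (axis p 1) = transpose A'"
  proof -
    have "row_upd (transpose A) q (axis p 1) $ j $ i = transpose A' $ j $ i" for i j
      using assms(1,2,4) assms(3)[of i j]
      by (cases "i = p"; cases "j = q") (auto simp: row_upd_def transpose_def axis_def)
    then show ?thesis by (simp add: vec_eq_iff)
  qed
  also have "det (row_upd (transpose A) q w) = 0"
    using assms by (intro det_zero_col'[of _ p]) (auto simp: row_upd_def transpose_def w_def axis_def)
  finally show ?thesis by simp
qed

text \<open>A unit row makes the rest of its column irrelevant: both determinants equal the one of
  \<open>A0\<close>, where that rest is cleared. This plays the role of Laplace expansion when
  blocks are compared below.\<close>

lemma det_unit_row:
  fixes A A' :: "real^'n^'n"
  assumes "A $ p = axis q 1" "A' $ p = axis q 1" "\<And>i j. i \<noteq> p \<Longrightarrow> j \<noteq> q \<Longrightarrow> A' $ i $ j = A $ i $ j"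
  shows "det A' = det A"
proof -
  define A0 where "A0 = (\<chi> i j. if i \<noteq> p \<and> j = q then 0 else A $ i $ j)"
  have "det A0 = det A" using assms
    by (intro det_unit_row_aux[of A p q]) (auto simp: A0_def axis_def vec_eq_iff)
  moreover have "det A0 = det A'" using assms
    by (intro det_unit_row_aux[of A' p q]) (auto simp: A0_def axis_def vec_eq_iff)
  ultimately show ?thesis by simp
qed

text \<open>The cofactor does not change when the column is replaced by a unit vector along with the
  row; the resulting matrix \<open>A\<close> has a form that is stable under transposition.\<close>

lemma cof_transpose: "cof (transpose B) k l = cof B l k"
proof -
  define A where "A = (\<chi> i j. if i = l then (if j = k then 1 else 0) else if j = k then 0 else B $ i $ j)"
  have "cof B l k = det A" unfolding cof_def
    by (rule det_unit_row[of _ l k]) (auto simp: A_def row_upd_def axis_def vec_eq_iff)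
  moreover have "cof (transpose B) k l = det (transpose A)" unfolding cof_def
    by (rule det_unit_row[of _ k l]) (auto simp: A_def row_upd_def axis_def vec_eq_iff transpose_def)
  ultimately show ?thesis by simp
qed

lemma adjugate_transpose: "adjugate (transpose B) = transpose (adjugate B)"
  by (simp add: adjugate_def transpose_def[of "vec_lambda _"] cof_transpose)

lemma adjugate_right: "B ** adjugate B = det B *\<^sub>R mat 1"
proof -
  have "(\<Sum>k\<in>UNIV. B $ i $ k * cof B j k) = (if i = j then det B else 0)" for i j
  proof -
    have "(\<Sum>k\<in>UNIV. B $ i $ k * cof B j k) = det (row_upd B j (B $ i))"
      by (simp add: det_row_upd_expand)
    also have "\<dots> = (if i = j then det B else 0)"
      using det_equal_rows[of i j "row_upd B j (B $ i)"] by (auto simp: row_upd_nth)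
    finally show ?thesis .
  qed
  then show ?thesis by (simp add: vec_eq_iff matrix_matrix_mult_def adjugate_def mat_def)
qed

lemma adjugate_left: "adjugate B ** B = det B *\<^sub>R mat 1"
proof -
  have "transpose (adjugate B ** B) = transpose B ** adjugate (transpose B)"
    by (simp add: matrix_transpose_mul adjugate_transpose)
  also have "\<dots> = det B *\<^sub>R mat 1" by (simp add: adjugate_right)
  finally have "transpose (transpose (adjugate B ** B)) = transpose (det B *\<^sub>R mat 1)" by simp
  then show ?thesis by (simp add: transpose_scalar)
qed

lemma linear_ddet: "linear (ddet B)"
  by (rule linearI) (simp_all add: ddet_def algebra_simps sum.distrib sum_distrib_left)

lemma ddet_inner: "ddet B X = X \<bullet> transpose (adjugate B)"
  by (simp add: ddet_def inner_vec_def adjugate_def transpose_def)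

text \<open>In the Leibniz formula, the terms in which the factor from row \<open>k\<close> is
  differentiated add up to the determinant with row \<open>k\<close> replaced by that row of the
  direction.\<close>

lemma has_derivative_det: "(det has_derivative ddet B) (at B)"
proof -
  let ?P = "{p. p permutes (UNIV :: 'a set)}"
  have e: "((\<lambda>A::real^'a^'a. A $ i $ j) has_derivative (\<lambda>A. A $ i $ j)) (at B)" for i j
    by (intro bounded_linear_imp_has_derivative) (intro bounded_linear_compose[OF bounded_linear_vec_nth] bounded_linear_vec_nth)
  have "((\<lambda>A. \<Sum>p\<in>?P. of_int (sign p) * (\<Prod>i\<in>UNIV. A $ i $ p i)) has_derivative
    (\<lambda>X. \<Sum>p\<in>?P. of_int (sign p) * (\<Sum>k\<in>UNIV. X $ k $ p k * (\<Prod>i\<in>UNIV - {k}. B $ i $ p i)))) (at B)"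
    by (intro has_derivative_sum has_derivative_mult_right has_derivative_prod e)
  moreover have "(\<Sum>p\<in>?P. of_int (sign p) * (\<Sum>k\<in>UNIV. X $ k $ p k * (\<Prod>i\<in>UNIV - {k}. B $ i $ p i)))
    = ddet B X" for X
  proof -
    have "det (row_upd B k (X $ k)) =
      (\<Sum>p\<in>?P. of_int (sign p) * (X $ k $ p k * (\<Prod>i\<in>UNIV - {k}. B $ i $ p i)))" for k
    proof -
      have "(\<Prod>i\<in>UNIV. row_upd B k (X $ k) $ i $ p i) = X $ k $ p k * (\<Prod>i\<in>UNIV - {k}. B $ i $ p i)" for p
        by (subst prod.remove[of _ k]) (auto simp: row_upd_nth intro!: prod.cong)
      then show ?thesis by (simp add: det_def)
    qed
    then have "ddet B X = (\<Sum>k\<in>UNIV. \<Sum>p\<in>?P. of_int (sign p) * (X $ k $ p k * (\<Prod>i\<in>UNIV - {k}. B $ i $ p i)))"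
      by (simp add: ddet_rows)
    also have "\<dots> = (\<Sum>p\<in>?P. \<Sum>k\<in>UNIV. of_int (sign p) * (X $ k $ p k * (\<Prod>i\<in>UNIV - {k}. B $ i $ p i)))"
      by (rule sum.swap)
    finally show ?thesis by (simp add: sum_distrib_left)
  qed
  ultimately show ?thesis by (simp add: det_def[abs_def])
qed

lemma real_polynomial_function_det:
  assumes "\<And>i j. real_polynomial_function (\<lambda>e. F e $ i $ j)"
  shows "real_polynomial_function (\<lambda>e. det (F e :: real^'n^'n))"
  unfolding det_def
  by (intro real_polynomial_function_sum real_polynomial_function.intros(4)
      real_polynomial_function_prod assms) (auto intro: real_polynomial_function.intros(2) simp: finite_permutations)

lemma real_polynomial_function_cof:
  assumes "\<And>i j. real_polynomial_function (\<lambda>e. F e $ i $ j)"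
  shows "real_polynomial_function (\<lambda>e. cof (F e :: real^'n^'n) k l)"
  unfolding cof_def
proof (rule real_polynomial_function_det)
  show "real_polynomial_function (\<lambda>e. row_upd (F e) k (axis l 1) $ i $ j)" for i j
    by (cases "i = k") (auto simp: row_upd_nth assms intro: real_polynomial_function.intros(2))
qed

subsection \<open>The pencil and its bordering\<close>

text \<open>Outside \<open>S\<close> the pencil of a matrix supported on \<open>S\<close> is the identity, so that its determinant is
  the one of the block indexed by \<open>S\<close>.\<close>

definition pencil :: "('n \<Rightarrow> real) \<Rightarrow> 'n set \<Rightarrow> real \<times> real \<Rightarrow> real^'n^'n \<Rightarrow> real^'n^'n" where
  "pencil a S z M = (\<chi> i j. (if i = j then (if i \<in> S then 1 - fst z * a i else 1) else 0) - snd z * M $ i $ j)"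

definition supported :: "'n set \<Rightarrow> real^'n^'n \<Rightarrow> bool" where
  "supported S M \<longleftrightarrow> (\<forall>i j. i \<notin> S \<or> j \<notin> S \<longrightarrow> M $ i $ j = 0)"

definition skew :: "(real^'n^'n) set" where
  "skew = {M. transpose M = - M}"

definition hollow_sym :: "(real^'n^'n) set" where
  "hollow_sym = {M. transpose M = M \<and> (\<forall>i. M $ i $ i = 0)}"

lemma skew_iff: "M \<in> skew \<longleftrightarrow> (\<forall>i j. M $ i $ j = - M $ j $ i)"
  by (simp only: skew_def mem_Collect_eq transpose_def vec_eq_iff vec_lambda_beta
      vector_uminus_component) blast

lemma skew_nth: "M \<in> skew \<Longrightarrow> M $ i $ j = - M $ j $ i"
  unfolding skew_iff by blast

lemma skew_diag: "M \<in> skew \<Longrightarrow> M $ i $ i = 0"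
  using skew_nth[of M i i] by simp

lemma hollow_sym_iff: "M \<in> hollow_sym \<longleftrightarrow> (\<forall>i j. M $ i $ j = M $ j $ i) \<and> (\<forall>i. M $ i $ i = 0)"
  by (simp only: hollow_sym_def mem_Collect_eq transpose_def vec_eq_iff vec_lambda_beta) blast

lemma hollow_sym_nth: "M \<in> hollow_sym \<Longrightarrow> M $ i $ j = M $ j $ i"
  unfolding hollow_sym_iff by blast

text \<open>Consequently the cofactor at (k, j) is the cofactor at (j, k) with s negated. The
  difference of the two, met in skew directions, is twice an odd part in s; their sum, met in
  symmetric directions, is twice an even part.\<close>

lemma pencil_transpose:
  assumes "M \<in> skew"
  shows "transpose (pencil a S (l, s) M) = pencil a S (l, - s) M"
proof -
  have "transpose (pencil a S (l, s) M) $ i $ j = pencil a S (l, - s) M $ i $ j" for i j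
    using skew_nth[OF assms, of i j] by (simp add: pencil_def transpose_def)
  then show ?thesis by (simp add: vec_eq_iff)
qed

lemma cof_pencil_swap: "M \<in> skew \<Longrightarrow> cof (pencil a S (l, s) M) j k = cof (pencil a S (l, - s) M) k j"
  by (metis cof_transpose pencil_transpose)

text \<open>For s = 0 the pencil is diagonal, so its cofactors off the diagonal vanish. This is what
  makes the old functions negligible against the new ones as s tends to 0.\<close>

lemma ddet_pencil_at_0:
  assumes "\<And>i. X $ i $ i = 0"
  shows "ddet (pencil a S (l, 0) M) X = 0"
proof -
  have "cof (pencil a S (l, 0) M) i j = 0" if "i \<noteq> j" for i j
    unfolding cof_def using that
    by (intro det_zero_col'[of _ i]) (auto simp: row_upd_def pencil_def axis_def)
  then have "X $ i $ j * cof (pencil a S (l, 0) M) i j = 0" for i j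
    using assms by (cases "i = j") auto
  then show ?thesis unfolding ddet_def by (intro sum.neutral ballI)
qed

lemma real_polynomial_function_pencil:
  "real_polynomial_function (\<lambda>s. pencil a S (l, s) M $ i $ j)"
  unfolding pencil_def
  by (simp only: vec_lambda_beta snd_conv fst_conv)
    (intro real_polynomial_function_diff[OF real_polynomial_function.intros(2)
      real_polynomial_function.intros(1)[OF bounded_linear_mult_left]])

lemma real_polynomial_function_cof_pencil:
  "real_polynomial_function (\<lambda>s. cof (pencil a S (l, s) M) i j)"
  by (intro real_polynomial_function_cof real_polynomial_function_pencil)

lemma real_polynomial_function_ddet_pencil:
  "real_polynomial_function (\<lambda>s. ddet (pencil a S (l, s) M) X)"
  unfolding ddet_def by (intro real_polynomial_function_sum real_polynomial_function.intros(4)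
      real_polynomial_function_cof_pencil) (auto intro: real_polynomial_function.intros(2))

locale border =
  fixes a :: "'n::finite \<Rightarrow> real" and S :: "'n set" and p q :: 'n and M :: "real^'n^'n"
  assumes pq: "p \<notin> S" "q \<notin> S" "p \<noteq> q" and M: "M \<in> skew" "supported S M"
begin

text \<open>Apart from the entry \<open>x\<close> coupling \<open>p\<close> and \<open>q\<close>,
  only \<open>p\<close> is coupled to \<open>S\<close>, by entries of absolute value 1;
  \<open>q\<close> is not coupled to \<open>S\<close>. The coupling of \<open>p\<close> makes the
  new cofactors at lowest order sums over a whole column of old cofactors, see
  \<open>gam\<close>.\<close>

definition bord :: "real \<Rightarrow> real^'n^'n" where
  "bord x = (\<chi> i j. if i = p \<and> j = q then x else if i = q \<and> j = p then - x
     else if i = p \<and> j \<in> S then 1 else if j = p \<and> i \<in> S then - 1 else M $ i $ j)"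

abbreviation S' where "S' \<equiv> insert p (insert q S)"

lemma bord_skew: "bord x \<in> skew"
proof -
  have "bord x $ i $ j = - bord x $ j $ i" for i j
    using pq skew_nth[OF M(1), of i j] by (auto simp: bord_def)
  then show ?thesis unfolding skew_iff by blast
qed

lemma bord_supported: "supported S' (bord x)"
  using pq M(2) by (auto simp: bord_def supported_def)

definition G where "G z = pencil a S' z (bord 0)"

text \<open>With \<open>x = 1 / e\<close>, rows \<open>p\<close> and \<open>q\<close> of the
  bordered pencil have a pole at \<open>e = 0\<close>; \<open>rp\<close> and \<open>rq\<close> are
  these rows multiplied by \<open>e\<close>.\<close>

definition rp :: "real \<Rightarrow> real \<times> real \<Rightarrow> real^'n" where
  "rp e z = (\<chi> j. if j = p then e * (1 - fst z * a p) else if j = q then - snd z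
     else if j \<in> S then - e * snd z else 0)"

definition rq :: "real \<Rightarrow> real \<times> real \<Rightarrow> real^'n" where
  "rq e z = (\<chi> j. if j = p then snd z else if j = q then e * (1 - fst z * a q) else 0)"

definition cpq where "cpq e z = det (row_upd (row_upd (G z) p (axis q 1)) q (rq e z))"
definition cpl where "cpl z l = det (row_upd (row_upd (G z) p (axis l 1)) q ((1 - fst z * a q) *\<^sub>R axis q 1))"
definition cql where "cql e z l = det (row_upd (row_upd (G z) p (rp e z)) q (axis l 1))"
definition ckl where
  "ckl e z k l = det (row_upd (row_upd (row_upd (G z) p (rp e z)) q (rq e z)) k (axis l 1))"

text \<open>A determinant bordered by a column of ones and a unit row: for \<open>l\<close> in
  \<open>S\<close> it is minus the sum of \<open>cof (pencil a S z M) i l\<close> over all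
  \<open>i\<close> in \<open>S\<close>.\<close>

definition gam where
  "gam z l = det (\<chi> i j. if i = p then axis l 1 $ j else if i = q then axis q 1 $ j
     else if j = p then (if i \<in> S then 1 else 0) else pencil a S z M $ i $ j)"

lemma pencil_bord:
  assumes "e \<noteq> 0"
  shows "pencil a S' z (bord (1 / e)) = row_upd (row_upd (G z) p ((1/e) *\<^sub>R rp e z)) q ((1/e) *\<^sub>R rq e z)"
  using assms pq M(2)
  by (auto simp: pencil_def bord_def row_upd_def G_def rp_def rq_def vec_eq_iff supported_def)

lemma cof_pq:
  assumes "e \<noteq> 0"
  shows "e * cof (pencil a S' z (bord (1 / e))) p q = cpq e z"
  using assms unfolding cof_def pencil_bord[OF assms] cpq_def row_upd_shadow[OF pq(3)]
  by (simp add: det_row_upd_scale)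

text \<open>The part of row \<open>q\<close> with the pole is a multiple of the unit vector of index
  \<open>p\<close>. With row \<open>p\<close> replaced as well, it leaves column \<open>q\<close>
  zero, so its contribution vanishes and the cofactor does not depend on \<open>e\<close>.\<close>

lemma cof_pl:
  assumes "e \<noteq> 0" "l \<in> S"
  shows "cof (pencil a S' z (bord (1 / e))) p l = cpl z l"
proof -
  have 1: "(1/e) *\<^sub>R rq e z = (snd z / e) *\<^sub>R axis p 1 + (1 - fst z * a q) *\<^sub>R axis q 1"
    using assms pq by (auto simp: rq_def axis_def vec_eq_iff)
  have "det (row_upd (row_upd (G z) p (axis l 1)) q (axis p 1)) = 0"
    using pq assms(2) M(2)
    by (intro det_zero_col'[of _ q]) (auto simp: row_upd_def G_def pencil_def bord_def axis_def supported_def)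
  then have "det (row_upd (row_upd (G z) p (axis l 1)) q ((1/e) *\<^sub>R rq e z)) = cpl z l"
    unfolding 1 det_row_upd_add cpl_def by (simp add: det_row_upd_scale)
  then show ?thesis
    unfolding cof_def pencil_bord[OF assms(1)] row_upd_shadow[OF pq(3)] .
qed

lemma cof_ql:
  assumes "e \<noteq> 0"
  shows "e * cof (pencil a S' z (bord (1 / e))) q l = cql e z l"
  using assms pq unfolding cof_def pencil_bord[OF assms] cql_def
  by (simp add: det_row_upd_scale2)

lemma cof_kl:
  assumes "e \<noteq> 0" "k \<in> S"
  shows "e ^ 2 * cof (pencil a S' z (bord (1 / e))) k l = ckl e z k l"
proof -
  have "k \<noteq> p" "k \<noteq> q" using assms pq by auto
  then show ?thesis
    using assms(1) pq unfolding cof_def pencil_bord[OF assms(1)] ckl_def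
    by (simp add: det_row_upd_scale3 det_row_upd_scale2 power2_eq_square)
qed

text \<open>In the limit the two scaled rows form a \<open>2 \<times> 2\<close> skew block with
  entries -s and s, decoupled from \<open>S\<close>. Its determinant s^2 is the factor with which
  the old cofactors survive.\<close>

lemma rp_0: "rp 0 z = (- snd z) *\<^sub>R axis q 1"
  using pq by (auto simp: rp_def axis_def vec_eq_iff)

lemma rq_0: "rq 0 z = snd z *\<^sub>R axis p 1"
  using pq by (auto simp: rq_def axis_def vec_eq_iff)

lemma cpq_0: "cpq 0 z = - snd z * det (pencil a S z M)"
proof -
  have "det (row_upd (row_upd (G z) p (axis p 1)) q (axis q 1)) = det (pencil a S z M)"
    using pq M(2)
    by (intro det_unit_row[of _ p p])
      (auto simp: row_upd_def G_def pencil_def bord_def axis_def supported_def vec_eq_iff)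
  then show ?thesis
    using pq unfolding cpq_def rq_0 det_row_upd_scale
    by (subst det_row_upd_swap) auto
qed

lemma gam_scaled:
  assumes "l \<in> S"
  shows "det (row_upd (row_upd (G z) p (axis l 1)) q (axis q 1)) = snd z * gam z l"
proof -
  define N where "N = (\<chi> i j. if i = p then axis l 1 $ j else if i = q then axis q 1 $ j
     else if j = p then (if i \<in> S then 1 else 0) else pencil a S z M $ i $ j)"
  have pl: "p \<noteq> l" using assms pq by auto
  have "transpose (row_upd (row_upd (G z) p (axis l 1)) q (axis q 1)) =
    row_upd (transpose N) p (snd z *\<^sub>R (transpose N $ p))"
    using pq pl M(2)
    by (auto simp: row_upd_def G_def pencil_def bord_def axis_def supported_def vec_eq_iff N_def transpose_def)
  then have "det (row_upd (row_upd (G z) p (axis l 1)) q (axis q 1)) = snd z * det N"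
    by (metis det_transpose det_row_upd_scale row_upd_self)
  then show ?thesis by (simp add: gam_def N_def)
qed

lemma cpl_eq: "l \<in> S \<Longrightarrow> cpl z l = (1 - fst z * a q) * snd z * gam z l"
  by (simp add: cpl_def det_row_upd_scale gam_scaled)

lemma cql_0:
  assumes "l \<in> S"
  shows "cql 0 z l = snd z ^ 2 * gam z l"
proof -
  have "cql 0 z l = - snd z * det (row_upd (row_upd (G z) p (axis q 1)) q (axis l 1))"
    using pq(3) unfolding cql_def rp_0 by (simp add: det_row_upd_scale2 del: scaleR_minus_left)
  also have "det (row_upd (row_upd (G z) p (axis q 1)) q (axis l 1)) = - (snd z * gam z l)"
    using gam_scaled[OF assms, of z] det_row_upd_swap[OF pq(3)] by metis
  finally show ?thesis by (simp add: power2_eq_square)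
qed

lemma ckl_0:
  assumes "k \<in> S"
  shows "ckl 0 z k l = snd z ^ 2 * cof (pencil a S z M) k l"
proof -
  have k: "k \<noteq> p" "k \<noteq> q" using assms pq by auto
  have "ckl 0 z k l = - (snd z ^ 2) * det (row_upd (row_upd (row_upd (G z) p (axis q 1)) q (axis p 1)) k (axis l 1))"
    using k pq(3) unfolding ckl_def rp_0 rq_0
    by (simp add: det_row_upd_scale3[of p q k] det_row_upd_scale2[of q k] power2_eq_square
      del: scaleR_minus_left)
  also have "row_upd (row_upd (row_upd (G z) p (axis q 1)) q (axis p 1)) k (axis l 1) =
    row_upd (row_upd (row_upd (G z) k (axis l 1)) p (axis q 1)) q (axis p 1)"
    using k by (auto simp: row_upd_def vec_eq_iff)
  also have "- (snd z ^ 2) * det \<dots> = snd z ^ 2 * det (row_upd (row_upd (row_upd (G z) k (axis l 1)) p (axis p 1)) q (axis q 1))"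
    by (subst det_row_upd_swap[OF pq(3)]) simp
  also have "det (row_upd (row_upd (row_upd (G z) k (axis l 1)) p (axis p 1)) q (axis q 1)) =
    cof (pencil a S z M) k l"
  proof (cases "l = p")
    case True
    have "det (row_upd (row_upd (row_upd (G z) k (axis l 1)) p (axis p 1)) q (axis q 1)) = 0"
      using k pq True by (intro det_equal_rows[of k p]) (auto simp: row_upd_nth)
    moreover have "cof (pencil a S z M) k l = 0" unfolding cof_def
      using k pq True M(2) by (intro det_equal_rows[of k p])
        (auto simp: row_upd_nth pencil_def supported_def vec_eq_iff axis_def)
    ultimately show ?thesis by simp
  next
    case False
    then show ?thesis unfolding cof_def
      using pq k M(2)
      by (intro det_unit_row[of _ p p])
        (auto simp: row_upd_def G_def pencil_def bord_def axis_def supported_def vec_eq_iff)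
  qed
  finally show ?thesis .
qed

text \<open>For s = 0 the block of \<open>S\<close> is diagonal. Row \<open>l\<close> is the unit
  vector of index \<open>p\<close> plus a multiple of row \<open>p\<close>; the multiple contributes
  nothing, and exchanging the two rows gives the sign and a diagonal determinant. The products are
  unnormalized Lagrange polynomials in t.\<close>

lemma gam_0:
  assumes "l \<in> S"
  shows "gam (t, 0) l = - (\<Prod>i\<in>S - {l}. 1 - t * a i)"
proof -
  define N where "N = (\<chi> i j. if i = p then axis l 1 $ j else if i = q then axis q 1 $ j
     else if j = p then (if i \<in> S then 1 else 0) else pencil a S (t, 0) M $ i $ j)"
  have pl: "p \<noteq> l" "q \<noteq> l" using assms pq by auto
  have "N $ l = axis p 1 + (1 - t * a l) *\<^sub>R axis l 1"
    using pl assms by (auto simp: N_def pencil_def axis_def vec_eq_iff)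
  then have "det N = det (row_upd N l (axis p 1 + (1 - t * a l) *\<^sub>R axis l 1))"
    by (metis row_upd_self)
  also have "\<dots> = det (row_upd N l (axis p 1)) + (1 - t * a l) * det (row_upd N l (axis l 1))"
    by (simp only: det_row_upd_add det_row_upd_scale)
  also have "det (row_upd N l (axis l 1)) = 0"
    using pl by (intro det_equal_rows[of p l]) (auto simp: row_upd_nth N_def axis_def vec_eq_iff)
  also have "row_upd N l (axis p 1) = row_upd (row_upd N p (axis l 1)) l (axis p 1)"
    by (auto simp: row_upd_def N_def vec_eq_iff)
  also have "det \<dots> = - det (row_upd (row_upd N p (axis p 1)) l (axis l 1))"
    by (rule det_row_upd_swap[OF pl(1)])
  also have "det (row_upd (row_upd N p (axis p 1)) l (axis l 1)) =
    det (\<chi> i j. if i = j then (if i \<in> S - {l} then 1 - t * a i else 1) else (0::real))"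
    using pq pl by (intro det_unit_row[of _ p p]) (auto simp: row_upd_def N_def axis_def vec_eq_iff pencil_def)
  also have "\<dots> = (\<Prod>i\<in>UNIV. if i \<in> S - {l} then 1 - t * a i else 1)"
    by (subst det_diagonal) auto
  also have "\<dots> = (\<Prod>i\<in>S - {l}. 1 - t * a i)"
    by (subst prod.inter_restrict[symmetric]) auto
  finally show ?thesis by (simp add: gam_def N_def)
qed

lemma det_pencil_0: "det (pencil a S (t, 0) M) = (\<Prod>i\<in>S. 1 - t * a i)"
proof -
  have "det (pencil a S (t, 0) M) = (\<Prod>i\<in>UNIV. if i \<in> S then 1 - t * a i else 1)"
    by (subst det_diagonal) (auto simp: pencil_def cong: if_cong)
  also have "\<dots> = (\<Prod>i\<in>S. 1 - t * a i)"
    by (subst prod.inter_restrict[symmetric]) auto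
  finally show ?thesis .
qed

lemma isCont_gam: "isCont (\<lambda>s. gam (t, s) l) s"
proof -
  have "real_polynomial_function (\<lambda>s. gam (t, s) l)"
    unfolding gam_def
  proof (intro real_polynomial_function_det)
    fix i j
    show "real_polynomial_function (\<lambda>s. (\<chi> i j. if i = p then axis l 1 $ j else if i = q then axis q 1 $ j
      else if j = p then (if i \<in> S then 1 else 0) else pencil a S (t, s) M $ i $ j) $ i $ j)"
      by (cases "i = p"; cases "i = q"; cases "j = p"; cases "i \<in> S")
        (auto intro: real_polynomial_function_pencil real_polynomial_function.intros(2))
  qed
  then show ?thesis by (rule continuous_real_polymonial_function)
qed

lemma isCont_det_pencil: "isCont (\<lambda>s. det (pencil a S (t, s) M)) s"
proof -
  have "real_polynomial_function (\<lambda>s. det (pencil a S (t, s) M))"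
    by (intro real_polynomial_function_det real_polynomial_function_pencil)
  then show ?thesis by (rule continuous_real_polymonial_function)
qed

lemma real_polynomial_function_rp: "real_polynomial_function (\<lambda>e. rp e z $ j)"
  using pq by (cases "j = p"; cases "j = q"; cases "j \<in> S")
    (auto simp: rp_def intro!: real_polynomial_function.intros(2)
      real_polynomial_function.intros(1)[OF bounded_linear_mult_left]
      real_polynomial_function_minus[OF real_polynomial_function.intros(1)[OF bounded_linear_mult_left]])

lemma real_polynomial_function_rq: "real_polynomial_function (\<lambda>e. rq e z $ j)"
  using pq by (cases "j = p"; cases "j = q")
    (auto simp: rq_def intro!: real_polynomial_function.intros(2)
      real_polynomial_function.intros(1)[OF bounded_linear_mult_left])

lemma real_polynomial_function_border:
  "real_polynomial_function (\<lambda>e. cpq e z)" "real_polynomial_function (\<lambda>e. cql e z l)"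
  "real_polynomial_function (\<lambda>e. ckl e z k l)"
proof -
  have upd: "real_polynomial_function (\<lambda>e. row_upd (F e) k (v e) $ i $ j)"
    if "\<And>i j. real_polynomial_function (\<lambda>e. F e $ i $ j)" "\<And>j. real_polynomial_function (\<lambda>e. v e $ j)"
    for F :: "real \<Rightarrow> real^'n^'n" and v k i j
    using that by (cases "i = k") (auto simp: row_upd_nth)
  show "real_polynomial_function (\<lambda>e. cpq e z)" "real_polynomial_function (\<lambda>e. cql e z l)"
    "real_polynomial_function (\<lambda>e. ckl e z k l)"
    unfolding cpq_def cql_def ckl_def
    by (intro real_polynomial_function_det upd real_polynomial_function_rp real_polynomial_function_rq
       real_polynomial_function.intros(2))+
qed

end

subsection \<open>Matrix algebra\<close>

lemma matrix_mul_bilinear: "bounded_bilinear ((**) :: real^'n^'n \<Rightarrow> real^'n^'n \<Rightarrow> real^'n^'n)"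
  unfolding bilinear_conv_bounded_bilinear[symmetric] bilinear_def
  by (intro conjI allI linearI)
    (simp_all add: vec_eq_iff matrix_matrix_mult_def algebra_simps sum.distrib sum_distrib_left)

interpretation mm: bounded_bilinear "(**) :: real^'n^'n \<Rightarrow> real^'n^'n \<Rightarrow> real^'n^'n"
  by (rule matrix_mul_bilinear)

lemma transpose_add: "transpose (A + B) = transpose A + transpose (B :: real^'n^'m)"
  by (simp add: transpose_def vec_eq_iff)

lemma transpose_diff: "transpose (A - B) = transpose A - transpose (B :: real^'n^'m)"
  by (simp add: transpose_def vec_eq_iff)

lemma inner_matrix_sum: "A \<bullet> B = (\<Sum>i\<in>UNIV. \<Sum>j\<in>UNIV. A $ i $ j * B $ i $ j)" for A B :: "real^'n^'m"
  by (simp add: inner_vec_def)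

lemma inner_transpose: "transpose A \<bullet> B = A \<bullet> transpose B" for A B :: "real^'n^'n"
  unfolding inner_matrix_sum by (subst sum.swap) (simp add: transpose_def)

lemma inner_mul_left: "(A ** B) \<bullet> C = B \<bullet> (transpose A ** C)" for A B C :: "real^'n^'n"
proof -
  have "(A ** B) \<bullet> C = (\<Sum>i\<in>UNIV. \<Sum>j\<in>UNIV. \<Sum>k\<in>UNIV. A $ i $ k * B $ k $ j * C $ i $ j)"
    by (simp add: inner_matrix_sum matrix_matrix_mult_def sum_distrib_right)
  also have "\<dots> = (\<Sum>i\<in>UNIV. \<Sum>k\<in>UNIV. \<Sum>j\<in>UNIV. A $ i $ k * B $ k $ j * C $ i $ j)"
    by (rule sum.cong[OF refl], rule sum.swap)
  also have "\<dots> = (\<Sum>k\<in>UNIV. \<Sum>i\<in>UNIV. \<Sum>j\<in>UNIV. A $ i $ k * B $ k $ j * C $ i $ j)"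
    by (rule sum.swap)
  also have "\<dots> = (\<Sum>k\<in>UNIV. \<Sum>j\<in>UNIV. \<Sum>i\<in>UNIV. A $ i $ k * B $ k $ j * C $ i $ j)"
    by (rule sum.cong[OF refl], rule sum.swap)
  also have "\<dots> = B \<bullet> (transpose A ** C)"
    by (simp add: inner_matrix_sum matrix_matrix_mult_def sum_distrib_left transpose_def algebra_simps)
  finally show ?thesis .
qed

lemma inner_mul_right: "(A ** B) \<bullet> C = A \<bullet> (C ** transpose B)" for A B C :: "real^'n^'n"
proof -
  have "(A ** B) \<bullet> C = transpose (A ** B) \<bullet> transpose C" by (simp add: inner_transpose)
  also have "\<dots> = transpose A \<bullet> (B ** transpose C)" by (simp add: matrix_transpose_mul inner_mul_left)
  also have "\<dots> = A \<bullet> (C ** transpose B)" by (simp add: inner_transpose matrix_transpose_mul)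
  finally show ?thesis .
qed

definition cm :: "real^'n^'n \<Rightarrow> real^'n^'n \<Rightarrow> real^'n^'n" where
  "cm A B = A ** B - B ** A"

lemma cm_bilinear: "bounded_bilinear cm"
  unfolding bilinear_conv_bounded_bilinear[symmetric] bilinear_def
  by (intro conjI allI linearI)
    (simp_all add: cm_def mm.add_left mm.add_right mm.scaleR_left mm.scaleR_right algebra_simps)

interpretation cm: bounded_bilinear cm
  by (rule cm_bilinear)

lemma cm_commute: "cm A B = - cm B A"
  by (simp add: cm_def)

lemma subspace_skew: "subspace skew"
  by (simp add: subspace_def skew_def transpose_add transpose_scalar)
    (simp add: transpose_def vec_eq_iff)

lemma cm_skew: "A \<in> skew \<Longrightarrow> B \<in> skew \<Longrightarrow> cm A B \<in> skew"
  by (simp add: skew_def cm_def transpose_diff matrix_transpose_mul mm.minus_left mm.minus_right)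

lemma inner_cm_skew: "A \<in> skew \<Longrightarrow> cm A B \<bullet> C = - (B \<bullet> cm A C)"
  unfolding cm_def inner_diff_left inner_mul_left[of A B] inner_mul_right[of B A]
  by (simp add: skew_def mm.minus_left mm.minus_right inner_diff_right)

lemma inner_cm_sym: "transpose A = A \<Longrightarrow> cm A B \<bullet> C = B \<bullet> cm A C"
  unfolding cm_def inner_diff_left inner_mul_left[of A B] inner_mul_right[of B A]
  by (simp add: inner_diff_right)

definition diag :: "('n \<Rightarrow> real) \<Rightarrow> real^'n^'n" where
  "diag a = (\<chi> i j. if i = j then a i else 0)"

lemma diag_mul_nth: "(diag a ** X) $ i $ j = a i * X $ i $ j"
  by (simp add: matrix_matrix_mult_def diag_def if_distrib if_distribR cong: if_cong)

lemma mul_diag_nth: "(X ** diag a) $ i $ j = X $ i $ j * a j"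
  by (simp add: matrix_matrix_mult_def diag_def if_distrib if_distribR cong: if_cong)

lemma cm_diag_nth: "cm (diag a) X $ i $ j = (a i - a j) * X $ i $ j"
  by (simp add: cm_def diag_mul_nth mul_diag_nth algebra_simps)

lemma transpose_diag: "transpose (diag a) = diag a"
  by (auto simp: diag_def transpose_def vec_eq_iff)

lemma pencil_UNIV: "pencil a UNIV z M = mat 1 - (fst z *\<^sub>R diag a + snd z *\<^sub>R M)"
  by (auto simp: pencil_def diag_def mat_def vec_eq_iff)

lemma cm_pencil_adjugate:
  "cm (fst z *\<^sub>R diag a + snd z *\<^sub>R M) (adjugate (pencil a UNIV z M)) = 0"
proof -
  let ?N = "fst z *\<^sub>R diag a + snd z *\<^sub>R M" and ?B = "pencil a UNIV z M"
  have "cm ?B (adjugate ?B) = 0" by (simp add: cm_def adjugate_left adjugate_right)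
  moreover have "cm ?B X = - cm ?N X" for X
    unfolding pencil_UNIV cm.diff_left by (simp add: cm_def)
  ultimately show ?thesis by simp
qed

text \<open>Conjugation invariance of \<open>det\<close>, differentiated in the direction of the conjugation by
  \<open>exp (t Y)\<close>.\<close>

lemma ddet_orbit:
  "snd z * ddet (pencil a UNIV z M) (cm Y M) = fst z * ddet (pencil a UNIV z M) (cm (diag a) Y)"
proof -
  let ?N = "fst z *\<^sub>R diag a + snd z *\<^sub>R M" and ?C = "adjugate (pencil a UNIV z M)"
  have NC: "?N ** ?C = ?C ** ?N" using cm_pencil_adjugate[of z a M] by (simp add: cm_def)
  have "cm Y ?N \<bullet> transpose ?C = Y \<bullet> (transpose ?C ** transpose ?N) - Y \<bullet> (transpose ?N ** transpose ?C)"
    unfolding cm_def inner_diff_left inner_mul_left[of ?N] inner_mul_right[of Y] ..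
  also have "\<dots> = 0" by (simp only: matrix_transpose_mul[symmetric] NC)
  finally have "fst z * (cm Y (diag a) \<bullet> transpose ?C) + snd z * (cm Y M \<bullet> transpose ?C) = 0"
    by (simp add: cm.add_right cm.scaleR_right inner_add_left)
  then show ?thesis unfolding ddet_inner cm_commute[of "diag a"] by simp
qed

subsection \<open>Completeness of the family of determinants\<close>

lemma indep_funs_image:
  assumes "inj_on f K"
  shows "indep_funs (f ` K) L h \<longleftrightarrow> indep_funs K L (\<lambda>k. h (f k))"
proof
  assume *: "indep_funs (f ` K) L h"
  show "indep_funs K L (\<lambda>k. h (f k))"
  proof (rule indep_funsI)
    fix c k assume c: "\<And>x. x \<in> L \<Longrightarrow> (\<Sum>k\<in>K. c k * h (f k) x) = 0" and k: "k \<in> K"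
    have "(\<Sum>y\<in>f ` K. c (the_inv_into K f y) * h y x) = (\<Sum>k\<in>K. c k * h (f k) x)" for x
      using assms by (simp add: sum.reindex the_inv_into_f_f)
    then have "c (the_inv_into K f (f k)) = 0"
      using c k by (intro indep_funsD[OF *, of "\<lambda>y. c (the_inv_into K f y)"]) auto
    then show "c k = 0" using assms k by (simp add: the_inv_into_f_f)
  qed
next
  assume *: "indep_funs K L (\<lambda>k. h (f k))"
  show "indep_funs (f ` K) L h"
  proof (rule indep_funsI)
    fix c y assume c: "\<And>x. x \<in> L \<Longrightarrow> (\<Sum>y\<in>f ` K. c y * h y x) = 0" and y: "y \<in> f ` K"
    then obtain k where k: "k \<in> K" "y = f k" by blast
    have "(\<Sum>k\<in>K. c (f k) * h (f k) x) = 0" if "x \<in> L" for x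
      using c[OF that] assms by (simp add: sum.reindex)
    then show "c y = 0" using indep_funsD[OF *, of "\<lambda>k. c (f k)" k] k by simp
  qed
qed

definition regular :: "(real \<times> real) set" where
  "regular = {z. fst z \<noteq> 0 \<and> snd z \<noteq> 0}"

text \<open>Two successive limits: first \<open>e \<rightarrow> 0\<close>, then \<open>s \<rightarrow> 0\<close>, where only the functions
  indexed by \<open>T\<close> survive.\<close>

lemma border_limit:
  fixes H :: "real \<Rightarrow> 'x + 'k \<Rightarrow> real \<times> real \<Rightarrow> real"
  assumes fin: "finite X" "finite T"
    and poly: "\<And>k z. k \<in> X <+> T \<Longrightarrow> real_polynomial_function (\<lambda>e. H e k z)"
    and H0X: "\<And>k l s. k \<in> X \<Longrightarrow> H 0 (Inl k) (l, s) = s ^ 2 * h k (l, s)"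
    and H0T: "\<And>k l s. k \<in> T \<Longrightarrow> H 0 (Inr k) (l, s) = s ^ i * g k (l, s)" and i: "i \<le> 2"
    and hX: "indep_funs X regular h" "\<And>k l. k \<in> X \<Longrightarrow> isCont (\<lambda>s. h k (l, s)) 0"
      "\<And>k l. k \<in> X \<Longrightarrow> h k (l, 0) = 0"
    and gT: "indep_funs T (UNIV - {0}) (\<lambda>k l. g k (l, 0))" "\<And>k l. k \<in> T \<Longrightarrow> isCont (\<lambda>s. g k (l, s)) 0"
  shows "\<exists>e. e \<noteq> 0 \<and> indep_funs (X <+> T) regular (H e)"
proof -
  have ind: "indep_funs (X <+> T) regular (H 0)"
  proof (rule indep_funsI)
    fix c k assume *: "\<And>z. z \<in> regular \<Longrightarrow> (\<Sum>k\<in>X <+> T. c k * H 0 k z) = 0" and k: "k \<in> X <+> T"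
    have c: "(\<Sum>k\<in>X. c (Inl k) * (s ^ 2 * h k (l, s))) + (\<Sum>k\<in>T. c (Inr k) * (s ^ i * g k (l, s))) = 0"
      if "l \<noteq> 0" "s \<noteq> 0" for l s
      using *[of "(l, s)"] that fin by (simp add: regular_def sum.Plus H0X H0T)
    have cT: "c (Inr k) = 0" if "k \<in> T" for k
    proof (rule indep_funsD[OF gT(1) _ that])
      fix l :: real assume l: "l \<in> UNIV - {0}"
      \<comment> \<open>The relation divided by s^i, which makes sense at s = 0 too. There the old
        functions contribute nothing even for \<open>i = 2\<close>, since \<open>h\<close> vanishes
        at s = 0.\<close>
      define u where "u s = (\<Sum>k\<in>X. c (Inl k) * (s ^ (2 - i) * h k (l, s))) + (\<Sum>k\<in>T. c (Inr k) * g k (l, s))" for s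
      have "isCont u 0" unfolding u_def
        by (intro continuous_intros hX(2) gT(2)) auto
      then have "u \<midarrow>0\<rightarrow> u 0" by (simp add: isCont_def)
      moreover have "u s = 0" if s: "s \<noteq> 0" for s
      proof -
        have "s ^ 2 = s ^ i * s ^ (2 - i)" using i by (simp flip: power_add)
        then have "s ^ i * u s = 0"
          using c[of l s] l s by (simp add: u_def sum_distrib_left distrib_left mult_ac)
        then show ?thesis using s by simp
      qed
      then have "\<forall>\<^sub>F s in at 0. u s = 0" by (auto simp: eventually_at intro: exI[of _ 1])
      then have "u \<midarrow>0\<rightarrow> 0" by (rule tendsto_eventually)
      ultimately have "u 0 = 0" using tendsto_unique[OF at_neq_bot] by blast
      then show "(\<Sum>k\<in>T. c (Inr k) * g k (l, 0)) = 0" by (simp add: u_def hX(3))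
    qed
    have cX: "c (Inl k) = 0" if "k \<in> X" for k
    proof (rule indep_funsD[OF hX(1) _ that])
      fix z assume z: "z \<in> regular"
      then have "(snd z) ^ 2 * (\<Sum>k\<in>X. c (Inl k) * h k z) = 0"
        using c[of "fst z" "snd z"] cT by (simp add: regular_def sum_distrib_left mult_ac)
      then show "(\<Sum>k\<in>X. c (Inl k) * h k z) = 0" using z by (simp add: regular_def)
    qed
    show "c k = 0" using k cT cX by auto
  qed
  \<comment> \<open>Independence at \<open>e = 0\<close>, where no bordered matrix exists, fails for
    only finitely many \<open>e\<close> nearby or elsewhere, so some nonzero \<open>e\<close>
    inherits it.\<close>
  obtain D where D: "real_polynomial_function D" "D 0 \<noteq> 0"
    "\<And>e. D e \<noteq> 0 \<Longrightarrow> indep_funs (X <+> T) regular (H e)"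
    using indep_funs_generic[of "X <+> T" regular H 0] fin poly ind by auto
  have "finite (insert 0 {e. D e = 0})"
    using finite_zeros_real_polynomial_function[OF D(1,2)] by simp
  then obtain e where "e \<notin> insert 0 {e. D e = 0}"
    using ex_new_if_finite infinite_UNIV_char_0 by blast
  then show ?thesis using D(3) by auto
qed

section \<open>Elementary directions and the induction on the size\<close>

definition skew_elem :: "'n \<Rightarrow> 'n \<Rightarrow> real^'n^'n" where
  "skew_elem p q = (\<chi> i j. if i = p \<and> j = q then 1 else if i = q \<and> j = p then - 1 else 0)"

definition sym_elem :: "'n \<Rightarrow> 'n \<Rightarrow> real^'n^'n" where
  "sym_elem p q = (\<chi> i j. if i = p \<and> j = q \<or> i = q \<and> j = p then 1 else 0)"

lemma not_supportedI: "i \<notin> S \<Longrightarrow> M $ i $ j \<noteq> 0 \<Longrightarrow> \<not> supported S M"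
  by (auto simp: supported_def)

lemma skew_elem_skew: "p \<noteq> q \<Longrightarrow> skew_elem p q \<in> skew"
  unfolding skew_iff by (auto simp: skew_elem_def)

lemma ddet_sum2:
  assumes "p \<noteq> q" "\<And>i j. (i, j) \<noteq> (p, q) \<Longrightarrow> (i, j) \<noteq> (q, p) \<Longrightarrow> X $ i $ j = 0"
  shows "ddet B X = X $ p $ q * cof B p q + X $ q $ p * cof B q p"
proof -
  have "ddet B X = (\<Sum>(i, j)\<in>UNIV \<times> UNIV. X $ i $ j * cof B i j)"
    by (simp add: ddet_def sum.cartesian_product)
  also have "\<dots> = (\<Sum>(i, j)\<in>{(p, q), (q, p)}. X $ i $ j * cof B i j)"
  proof (intro sum.mono_neutral_right ballI)
    show "(case x of (i, j) \<Rightarrow> X $ i $ j * cof B i j) = 0" if "x \<in> UNIV \<times> UNIV - {(p, q), (q, p)}" for x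
      using assms(2)[of "fst x" "snd x"] that by (cases x) auto
  qed auto
  also have "\<dots> = X $ p $ q * cof B p q + X $ q $ p * cof B q p" using assms(1) by simp
  finally show ?thesis .
qed

lemma ddet_skew_elem: "p \<noteq> q \<Longrightarrow> ddet B (skew_elem p q) = cof B p q - cof B q p"
  by (subst ddet_sum2[of p q]) (auto simp: skew_elem_def)

lemma ddet_sym_elem: "p \<noteq> q \<Longrightarrow> ddet B (sym_elem p q) = cof B p q + cof B q p"
  by (subst ddet_sum2[of p q]) (auto simp: sym_elem_def)

lemma ddet_supported:
  assumes "supported S X"
  shows "ddet B X = (\<Sum>i\<in>S. \<Sum>j\<in>S. X $ i $ j * cof B i j)"
proof -
  have "ddet B X = (\<Sum>i\<in>S. \<Sum>j\<in>UNIV. X $ i $ j * cof B i j)"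
    unfolding ddet_def using assms
    by (intro sum.mono_neutral_right) (auto simp: supported_def intro!: sum.neutral)
  also have "\<dots> = (\<Sum>i\<in>S. \<Sum>j\<in>S. X $ i $ j * cof B i j)"
    using assms by (intro sum.cong refl sum.mono_neutral_right) (auto simp: supported_def)
  finally show ?thesis .
qed

lemma isCont_ddet_pencil: "isCont (\<lambda>s. ddet (pencil a S (l, s) M) X) s"
  using real_polynomial_function_ddet_pencil by (rule continuous_real_polymonial_function)

text \<open>The matrix \<open>M\<close> is chosen separately for each \<open>V\<close>: the skew and
  the symmetric count need not be attained at the same matrix, because each turns into a generic
  condition in \<open>generic_independence\<close>.\<close>

definition indep_dirs :: "('n::finite \<Rightarrow> real) \<Rightarrow> (real^'n^'n) set \<Rightarrow> 'n set \<Rightarrow> nat \<Rightarrow> bool" where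
  "indep_dirs a V S N \<longleftrightarrow> (\<exists>M\<in>skew. supported S M \<and> (\<exists>X\<subseteq>V. finite X \<and> card X = N \<and>
     (\<forall>x\<in>X. supported S x) \<and> indep_funs X regular (\<lambda>x z. ddet (pencil a S z M) x)))"

text \<open>Common frame of both counts. \<open>al k\<close> is the order of the pole in
  \<open>e\<close> that is cleared for the new direction \<open>dir k\<close>, and \<open>i\<close>
  is the power of s split off from all new functions at \<open>e = 0\<close>. That no
  \<open>dir k\<close> is supported on \<open>S\<close> keeps the new directions apart from the old
  ones.\<close>

lemma (in border) indep_dirs_step:
  assumes X: "finite X" "X \<subseteq> V" "\<And>x. x \<in> X \<Longrightarrow> supported S x"
      "indep_funs X regular (\<lambda>x z. ddet (pencil a S z M) x)"
    and T: "finite T" "\<And>k. k \<in> T \<Longrightarrow> dir k \<in> V" "\<And>k. k \<in> T \<Longrightarrow> supported S' (dir k)"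
      "inj_on dir T" "\<And>k. k \<in> T \<Longrightarrow> \<not> supported S (dir k)"
    and V: "\<And>x i. x \<in> V \<Longrightarrow> x $ i $ i = 0"
    and H: "\<And>k z. k \<in> T \<Longrightarrow> real_polynomial_function (\<lambda>e. Ht e k z)"
      "\<And>k e z. k \<in> T \<Longrightarrow> e \<noteq> 0 \<Longrightarrow> Ht e k z = e ^ al k * ddet (pencil a S' z (bord (1 / e))) (dir k)"
      "\<And>k l s. k \<in> T \<Longrightarrow> Ht 0 k (l, s) = s ^ i * g k (l, s)" "i \<le> 2"
    and g: "indep_funs T (UNIV - {0}) (\<lambda>k l. g k (l, 0))" "\<And>k l. k \<in> T \<Longrightarrow> isCont (\<lambda>s. g k (l, s)) 0"
  shows "indep_dirs a V S' (card X + card T)"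
proof -
  define H where "H e k z = (case k of Inl x \<Rightarrow> (\<Sum>i\<in>S. \<Sum>j\<in>S. x $ i $ j * ckl e z i j) | Inr k \<Rightarrow> Ht e k z)"
    for e k z
  define al' where "al' = case_sum (\<lambda>_ :: real^'n^'n. 2) al"
  define dir' where "dir' = case_sum (\<lambda>x. x) dir"
  have "\<exists>e. e \<noteq> 0 \<and> indep_funs (X <+> T) regular (H e)"
  proof (rule border_limit[where h = "\<lambda>x z. ddet (pencil a S z M) x" and g = g and i = i])
    show "real_polynomial_function (\<lambda>e. H e k z)" if "k \<in> X <+> T" for k z
      using that H(1)[of _ z] by (cases k) (auto simp: H_def intro!: real_polynomial_function_sum
        real_polynomial_function.intros(4) real_polynomial_function.intros(2) real_polynomial_function_border)
    show "H 0 (Inl k) (l, s) = s\<^sup>2 * ddet (pencil a S (l, s) M) k" if "k \<in> X" for k l s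
      unfolding ddet_supported[OF X(3)[OF that]]
      by (simp add: H_def ckl_0 sum_distrib_left mult_ac)
    show "H 0 (Inr k) (l, s) = s ^ i * g k (l, s)" if "k \<in> T" for k l s
      using H(3) that by (simp add: H_def)
    show "ddet (pencil a S (l, 0) M) x = 0" if "x \<in> X" for x l
      using that X(2) V by (intro ddet_pencil_at_0) blast
  qed (use X T V H g in \<open>auto intro: isCont_ddet_pencil\<close>)
  then obtain e where e: "e \<noteq> 0" "indep_funs (X <+> T) regular (H e)" by blast
  have "H e k z = e ^ al' k * ddet (pencil a S' z (bord (1 / e))) (dir' k)" if k: "k \<in> X <+> T" for k z
  proof (cases k)
    case (Inl x)
    then have x: "supported S x" "supported S' x" using X(3) k by (auto simp: supported_def)
    have "ddet (pencil a S' z (bord (1 / e))) x =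
      (\<Sum>i\<in>S. \<Sum>j\<in>S. x $ i $ j * cof (pencil a S' z (bord (1 / e))) i j)"
      by (rule ddet_supported[OF x(1)])
    then show ?thesis
      by (simp add: Inl H_def al'_def dir'_def sum_distrib_left mult_ac flip: cof_kl[OF e(1)])
  next
    case (Inr t)
    then show ?thesis using k H(2)[of t e z] e(1) by (auto simp: H_def al'_def dir'_def)
  qed
  then have "indep_funs (X <+> T) regular (\<lambda>k z. e ^ al' k * ddet (pencil a S' z (bord (1 / e))) (dir' k))"
    using e(2) by (subst indep_funs_cong[symmetric, of _ _ "H e"]) auto
  then have "indep_funs (X <+> T) regular (\<lambda>k z. ddet (pencil a S' z (bord (1 / e))) (dir' k))"
    by (rule indep_funs_scale) (use e(1) in auto)
  moreover have inj: "inj_on dir' (X <+> T)"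
  proof (rule inj_onI)
    fix k k' assume *: "k \<in> X <+> T" "k' \<in> X <+> T" "dir' k = dir' k'"
    have sep: "x \<noteq> dir t" if "x \<in> X" "t \<in> T" for x t
      using X(3)[OF that(1)] T(5)[OF that(2)] by blast
    show "k = k'"
      using * sep inj_onD[OF T(4)] by (cases k; cases k') (auto simp: dir'_def dest!: sep)
  qed
  ultimately have "indep_funs (dir' ` (X <+> T)) regular (\<lambda>x z. ddet (pencil a S' z (bord (1 / e))) x)"
    by (simp add: indep_funs_image)
  moreover have "card (dir' ` (X <+> T)) = card X + card T"
    using inj X(1) T(1) by (simp add: card_image card_Plus)
  moreover have "dir' ` (X <+> T) \<subseteq> V" using X(2) T(2) by (auto simp: dir'_def)
  moreover have "supported S' x" if "x \<in> dir' ` (X <+> T)" for x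
    using that X(3) T(3) by (auto simp: dir'_def supported_def)
  ultimately show ?thesis
    unfolding indep_dirs_def using X(1) T(1) bord_skew bord_supported
    by (intro bexI[of _ "bord (1 / e)"] conjI exI[of _ "dir' ` (X <+> T)"]) auto
qed

lemma hollow_sym_diag: "M \<in> hollow_sym \<Longrightarrow> M $ i $ i = 0"
  unfolding hollow_sym_iff by blast

text \<open>At the node t = 1/a_l the full product and all Lagrange products except the one of index
  \<open>l\<close> vanish. The function \<open>b\<close> carries the common factor 1 - t a_q of the
  skew case, and \<open>d\<close> the coefficient of the direction between \<open>p\<close> and
  \<open>q\<close>.\<close>

lemma (in border) gam_indep:
  assumes "inj a" "\<And>i. a i \<noteq> 0" "\<And>t. t \<noteq> 0 \<Longrightarrow> (\<Sum>l\<in>S. c l * (\<Prod>i\<in>S - {l}. 1 - t * a i)) * b t + d * (\<Prod>i\<in>S. 1 - t * a i) = 0"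
    "\<And>i. i \<in> S \<Longrightarrow> b (1 / a i) \<noteq> 0" "l \<in> S"
  shows "c l = 0"
proof -
  let ?t = "1 / a l"
  have t: "?t \<noteq> 0" "1 - ?t * a l = 0" using assms(2)[of l] by auto
  have P0: "(\<Prod>i\<in>S. 1 - ?t * a i) = 0" using t(2) assms(5) by (intro prod_zero) auto
  have Sl: "(\<Sum>l\<in>S. c l * (\<Prod>i\<in>S - {l}. 1 - ?t * a i)) = c l * (\<Prod>i\<in>S - {l}. 1 - ?t * a i)"
  proof (subst sum.remove[OF _ assms(5)])
    have "(\<Prod>i\<in>S - {k}. 1 - ?t * a i) = 0" if "k \<in> S - {l}" for k
      using t(2) assms(5) that by (intro prod_zero) auto
    then have "(\<Sum>k\<in>S - {l}. c k * (\<Prod>i\<in>S - {k}. 1 - ?t * a i)) = 0" by (intro sum.neutral) auto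
    then show "c l * (\<Prod>i\<in>S - {l}. 1 - ?t * a i) + (\<Sum>k\<in>S - {l}. c k * (\<Prod>i\<in>S - {k}. 1 - ?t * a i)) =
      c l * (\<Prod>i\<in>S - {l}. 1 - ?t * a i)" by simp
  qed simp
  have eq: "c l * (\<Prod>i\<in>S - {l}. 1 - ?t * a i) * b ?t = 0"
    using assms(3)[OF t(1)] unfolding P0 Sl by simp
  have "1 - ?t * a i \<noteq> 0" if "i \<in> S - {l}" for i
    using that assms(1,2) by (auto simp: inj_def field_simps)
  then have "(\<Prod>i\<in>S - {l}. 1 - ?t * a i) \<noteq> 0" unfolding prod_zero_iff[OF finite] by blast
  then show ?thesis using eq assms(4)[OF assms(5)] unfolding mult_eq_0_iff by blast
qed

text \<open>New directions couple \<open>p\<close> with \<open>q\<close> and with each element of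
  \<open>S\<close>. Their functions are odd in s and start with s^1 at \<open>e = 0\<close>.
  Coupling \<open>q\<close> with \<open>S\<close> would be worse: there the odd part starts only
  with s^3, since \<open>cql\<close> is s^2 times \<open>gam\<close>. The nodes 1/a_i with
  \<open>i\<close> in \<open>S\<close>, together with 1/a_q, separate the \<open>card S + 1\<close>
  functions.\<close>

lemma (in border) indep_dirs_skew_step:
  assumes a: "inj a" "\<And>i. a i \<noteq> 0"
    and X: "finite X" "X \<subseteq> skew" "\<And>x. x \<in> X \<Longrightarrow> supported S x"
      "indep_funs X regular (\<lambda>x z. ddet (pencil a S z M) x)"
  shows "indep_dirs a skew S' (card X + (card S + 1))"
proof -
  define T where "T = insert None (Some ` S)"
  define dir where "dir k = (case k of None \<Rightarrow> skew_elem p q | Some l \<Rightarrow> skew_elem p l)" for k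
  define al where "al k = (case k of None \<Rightarrow> 1 | Some l \<Rightarrow> (0 :: nat))" for k :: "'n option"
  define Ht where "Ht e k z = (case k of None \<Rightarrow> cpq e z - cpq e (fst z, - snd z) |
    Some l \<Rightarrow> cpl z l - cpl (fst z, - snd z) l)" for e k z
  define g where "g k z = (case k of
    None \<Rightarrow> - (det (pencil a S z M) + det (pencil a S (fst z, - snd z) M)) |
    Some l \<Rightarrow> (1 - fst z * a q) * (gam z l + gam (fst z, - snd z) l))" for k z
  have "indep_dirs a skew S' (card X + card T)"
  proof (rule indep_dirs_step[where dir = dir and Ht = Ht and al = al and g = g and i = 1])
    show "dir k \<in> skew" if "k \<in> T" for k
      using that pq by (auto simp: T_def dir_def intro!: skew_elem_skew)
    show "supported S' (dir k)" if "k \<in> T" for k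
      using that by (auto simp: T_def dir_def supported_def skew_elem_def)
    show "\<not> supported S (dir k)" if "k \<in> T" for k
    proof (cases k)
      case None
      then show ?thesis using pq by (intro not_supportedI[of p _ _ q]) (auto simp: dir_def skew_elem_def)
    next
      case (Some l)
      then show ?thesis using pq by (intro not_supportedI[of p _ _ l]) (auto simp: dir_def skew_elem_def)
    qed
    have pl: "p \<noteq> l" "q \<noteq> l" if "l \<in> S" for l using that pq by auto
    have e1: "skew_elem p l $ p $ m = (if m = l then 1 else 0)" if "p \<noteq> l" for l m
      using that by (auto simp: skew_elem_def)
    have e2: "l = m" if "p \<noteq> l" "p \<noteq> m" "skew_elem p l = skew_elem p m" for l m
      using e1[of l l] e1[of m l] that by (auto split: if_splits)
    show "inj_on dir T"
      using e2 pl pq by (auto simp: inj_on_def T_def dir_def)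
    show "real_polynomial_function (\<lambda>e. Ht e k z)" for k z
      by (cases k) (auto simp: Ht_def intro!: real_polynomial_function_diff real_polynomial_function_border
          real_polynomial_function.intros(2))
    show "Ht e k z = e ^ al k * ddet (pencil a S' z (bord (1 / e))) (dir k)" if "k \<in> T" "e \<noteq> 0" for k e z
    proof (cases k)
      case None
      then show ?thesis
        using cof_pq[OF that(2), of z] cof_pq[OF that(2), of "(fst z, - snd z)"]
          cof_pencil_swap[OF bord_skew, of a S' "fst z" "snd z" "1/e" q p] pq
        by (simp add: Ht_def al_def dir_def ddet_skew_elem algebra_simps)
    next
      case (Some l)
      then have l: "l \<in> S" using that by (auto simp: T_def)
      then show ?thesis
        using cof_pl[OF that(2) l, of z] cof_pl[OF that(2) l, of "(fst z, - snd z)"]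
          cof_pencil_swap[OF bord_skew, of a S' "fst z" "snd z" "1/e" l p] pl[OF l] Some
        by (simp add: Ht_def al_def dir_def ddet_skew_elem algebra_simps)
    qed
    show "Ht 0 k (l, s) = s ^ 1 * g k (l, s)" if "k \<in> T" for k l s
      using that by (auto simp: T_def Ht_def g_def cpq_0 cpl_eq algebra_simps)
    show "isCont (\<lambda>s. g k (l, s)) 0" for k l
      by (cases k) (auto simp: g_def intro!: continuous_intros isCont_gam isCont_det_pencil
        isCont_o2[OF _ isCont_gam] isCont_o2[OF _ isCont_det_pencil])
    show "indep_funs T (UNIV - {0}) (\<lambda>k l. g k (l, 0))"
    proof (rule indep_funsI)
      fix c k assume *: "\<And>t. t \<in> UNIV - {0} \<Longrightarrow> (\<Sum>k\<in>T. c k * g k (t, 0)) = 0" and k: "k \<in> T"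
      have c: "(\<Sum>l\<in>S. c (Some l) * (\<Prod>i\<in>S - {l}. 1 - t * a i)) * (1 - t * a q) +
        c None * (\<Prod>i\<in>S. 1 - t * a i) = 0" if "t \<noteq> 0" for t
      proof -
        have that': "t \<in> UNIV - {0}" using that by simp
        have "(\<Sum>k\<in>T. c k * g k (t, 0)) = c None * g None (t, 0) + (\<Sum>l\<in>S. c (Some l) * g (Some l) (t, 0))"
          unfolding T_def by (subst sum.insert) (auto simp: sum.reindex)
        also have "(\<Sum>l\<in>S. c (Some l) * g (Some l) (t, 0)) =
          (\<Sum>l\<in>S. - 2 * (c (Some l) * (\<Prod>i\<in>S - {l}. 1 - t * a i) * (1 - t * a q)))"
          by (intro sum.cong refl) (simp add: g_def gam_0 algebra_simps)
        also have "\<dots> = - 2 * ((\<Sum>l\<in>S. c (Some l) * (\<Prod>i\<in>S - {l}. 1 - t * a i)) * (1 - t * a q))"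
          by (simp add: sum_distrib_left sum_distrib_right)
        also have "c None * g None (t, 0) = - 2 * (c None * (\<Prod>i\<in>S. 1 - t * a i))"
          by (simp add: g_def det_pencil_0)
        finally show ?thesis using *[OF that'] by linarith
      qed
      have "c (Some l) = 0" if "l \<in> S" for l
      proof (rule gam_indep[where c = "\<lambda>l. c (Some l)" and b = "\<lambda>t. 1 - t * a q" and d = "c None", OF a c _ that])
        show "1 - 1 / a i * a q \<noteq> 0" if "i \<in> S" for i
          using that pq a by (auto simp: inj_def field_simps)
      qed
      moreover have "c None = 0"
      proof -
        \<comment> \<open>At t = 1/a_q the terms of the directions coupling \<open>p\<close> with
          \<open>S\<close> disappear, since they carry the factor 1 - t a_q.\<close>
        have eq: "c None * (\<Prod>i\<in>S. 1 - (1 / a q) * a i) = 0" using c[of "1 / a q"] a(2)[of q] by simp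
        have "1 - (1 / a q) * a i \<noteq> 0" if "i \<in> S" for i
          using that pq a by (auto simp: inj_def field_simps)
        then have "(\<Prod>i\<in>S. 1 - (1 / a q) * a i) \<noteq> 0" unfolding prod_zero_iff[OF finite] by blast
        then show ?thesis using eq unfolding mult_eq_0_iff by blast
      qed
      ultimately show "c k = 0" using k by (auto simp: T_def)
    qed
  qed (use X in \<open>auto simp: T_def skew_diag\<close>)
  moreover have "card T = card S + 1" by (simp add: T_def card_image)
  ultimately show ?thesis by simp
qed

text \<open>For symmetric directions the parity is reversed, so \<open>q\<close> is coupled with
  \<open>S\<close>: at \<open>e = 0\<close> the cofactor is s^2 times \<open>gam\<close>, whose even
  part survives at s = 0. Coupling \<open>p\<close> with \<open>S\<close> would leave only the odd
  part of \<open>gam\<close>, which vanishes there.\<close>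

lemma (in border) indep_dirs_sym_step:
  assumes a: "inj a" "\<And>i. a i \<noteq> 0"
    and X: "finite X" "X \<subseteq> hollow_sym" "\<And>x. x \<in> X \<Longrightarrow> supported S x"
      "indep_funs X regular (\<lambda>x z. ddet (pencil a S z M) x)"
  shows "indep_dirs a hollow_sym S' (card X + card S)"
proof -
  define Ht where "Ht e l z = cql e z l + cql e (fst z, - snd z) l" for e l z
  define g where "g l z = gam z l + gam (fst z, - snd z) l" for l z
  show ?thesis
  proof (rule indep_dirs_step[where dir = "sym_elem q" and Ht = Ht and al = "\<lambda>_. 1" and g = g and i = 2])
    have pl: "p \<noteq> l" "q \<noteq> l" if "l \<in> S" for l using that pq by auto
    show "sym_elem q l \<in> hollow_sym" if "l \<in> S" for l
      using pl[OF that] unfolding hollow_sym_iff by (auto simp: sym_elem_def)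
    show "supported S' (sym_elem q l)" if "l \<in> S" for l
      using that by (auto simp: supported_def sym_elem_def)
    show "\<not> supported S (sym_elem q l)" if "l \<in> S" for l
      using pq by (intro not_supportedI[of q _ _ l]) (auto simp: sym_elem_def)
    have e1: "sym_elem q l $ q $ m = (if m = l then 1 else 0)" if "q \<noteq> l" for l m
      using that by (auto simp: sym_elem_def)
    have e2: "l = m" if "q \<noteq> l" "q \<noteq> m" "sym_elem q l = sym_elem q m" for l m
      using e1[of l l] e1[of m l] that by (auto split: if_splits)
    show "inj_on (sym_elem q) S"
      using e2 pl by (auto simp: inj_on_def)
    show "real_polynomial_function (\<lambda>e. Ht e k z)" for k z
      by (auto simp: Ht_def intro!: real_polynomial_function.intros(3) real_polynomial_function_border)
    show "Ht e l z = e ^ 1 * ddet (pencil a S' z (bord (1 / e))) (sym_elem q l)" if "l \<in> S" "e \<noteq> 0" for l e z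
        using cof_ql[OF that(2), of z l] cof_ql[OF that(2), of "(fst z, - snd z)" l]
          cof_pencil_swap[OF bord_skew, of a S' "fst z" "snd z" "1/e" l q] pl[OF that(1)]
        by (simp add: Ht_def ddet_sym_elem algebra_simps)
    show "Ht 0 k (l, s) = s ^ 2 * g k (l, s)" if "k \<in> S" for k l s
      using that by (auto simp: Ht_def g_def cql_0 algebra_simps)
    show "isCont (\<lambda>s. g k (l, s)) 0" for k l
      by (auto simp: g_def intro!: continuous_intros isCont_gam isCont_o2[OF _ isCont_gam])
    show "indep_funs S (UNIV - {0}) (\<lambda>k l. g k (l, 0))"
    proof (rule indep_funsI)
      fix c l assume *: "\<And>t. t \<in> UNIV - {0} \<Longrightarrow> (\<Sum>k\<in>S. c k * g k (t, 0)) = 0" and l: "l \<in> S"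
      have c: "(\<Sum>l\<in>S. c l * (\<Prod>i\<in>S - {l}. 1 - t * a i)) * 1 + 0 * (\<Prod>i\<in>S. 1 - t * a i) = 0"
        if "t \<noteq> 0" for t
      proof -
        have that': "t \<in> UNIV - {0}" using that by simp
        have "(\<Sum>k\<in>S. c k * g k (t, 0)) = (\<Sum>l\<in>S. - 2 * (c l * (\<Prod>i\<in>S - {l}. 1 - t * a i)))"
          by (intro sum.cong refl) (simp add: g_def gam_0 algebra_simps)
        also have "\<dots> = - 2 * (\<Sum>l\<in>S. c l * (\<Prod>i\<in>S - {l}. 1 - t * a i))"
          by (simp add: sum_distrib_left)
        finally show ?thesis using *[OF that'] by linarith
      qed
      show "c l = 0"
        by (rule gam_indep[where c = c and b = "\<lambda>_. 1" and d = 0, OF a c _ l]) simp_all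
    qed
  qed (use X in \<open>auto intro: hollow_sym_diag\<close>)
qed

text \<open>Passing from k to k + 2 indices adds k + 1 skew and k symmetric directions, and 2k + 1
  is exactly the growth of k(k-1)/2. Both counts start from 0 for at most one index.\<close>

lemma indep_dirs_exist:
  fixes a :: "'n::finite \<Rightarrow> real"
  assumes a: "inj a" "\<And>i. a i \<noteq> 0"
  shows "\<exists>N N'. N + N' = card S * (card S - 1) div 2 \<and> indep_dirs a skew S N \<and> indep_dirs a hollow_sym S N'"
proof (induction "card S" arbitrary: S rule: less_induct)
  case less
  show ?case
  proof (cases "card S < 2")
    case True
    then have "card S * (card S - 1) div 2 = 0" by (cases "card S") auto
    moreover have "indep_dirs a V S 0" for V
      unfolding indep_dirs_def
      by (intro bexI[of _ 0] conjI exI[of _ "{}"])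
        (auto simp: supported_def indep_funs_def subspace_0[OF subspace_skew])
    ultimately show ?thesis by (intro exI[of _ 0]) auto
  next
    case False
    then obtain p where p: "p \<in> S" by fastforce
    have "card (S - {p}) \<ge> 1" using False p by simp
    then have "S - {p} \<noteq> {}" by (metis card.empty not_one_le_zero)
    then obtain q where q: "q \<in> S - {p}" by blast
    define R where "R = S - {p, q}"
    have S: "S = insert p (insert q R)" "p \<notin> R" "q \<notin> R" "p \<noteq> q" using p q by (auto simp: R_def)
    then have card: "card S = card R + 2" by simp
    obtain N N' where N: "N + N' = card R * (card R - 1) div 2" "indep_dirs a skew R N" "indep_dirs a hollow_sym R N'"
      using less[of R] card by auto
    have "indep_dirs a skew S (N + (card R + 1))"
    proof -
      obtain M X where MX: "M \<in> skew" "supported R M" "X \<subseteq> skew" "finite X" "card X = N"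
        "\<forall>x\<in>X. supported R x" "indep_funs X regular (\<lambda>x z. ddet (pencil a R z M) x)"
        using N(2) unfolding indep_dirs_def by blast
      interpret border a R p q M by standard (use S MX in auto)
      show ?thesis using indep_dirs_skew_step[OF a MX(4,3) _ MX(7)] MX(5,6) S(1) by simp
    qed
    moreover have "indep_dirs a hollow_sym S (N' + card R)"
    proof -
      obtain M X where MX: "M \<in> skew" "supported R M" "X \<subseteq> hollow_sym" "finite X" "card X = N'"
        "\<forall>x\<in>X. supported R x" "indep_funs X regular (\<lambda>x z. ddet (pencil a R z M) x)"
        using N(3) unfolding indep_dirs_def by blast
      interpret border a R p q M by standard (use S MX in auto)
      show ?thesis using indep_dirs_sym_step[OF a MX(4,3) _ MX(7)] MX(5,6) S(1) by simp
    qed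
    moreover have "(N + (card R + 1)) + (N' + card R) = card S * (card S - 1) div 2"
    proof -
      have "card S * (card S - 1) = card R * (card R - 1) + 2 * (2 * card R + 1)"
        unfolding card by (cases "card R") (auto simp: algebra_simps)
      then show ?thesis using N(1) by simp
    qed
    ultimately show ?thesis by blast
  qed
qed

section \<open>From particular matrices to generic ones\<close>

lemma real_polynomial_function_entry: "real_polynomial_function (\<lambda>M::real^'n^'m. M $ i $ j)"
  by (intro real_polynomial_function.intros(1) bounded_linear_compose[OF bounded_linear_vec_nth]
      bounded_linear_vec_nth)

lemma real_polynomial_function_pencil_matrix:
  "real_polynomial_function (\<lambda>M. pencil a S z M $ i $ j)"
  unfolding pencil_def vec_lambda_beta
  by (intro real_polynomial_function_diff real_polynomial_function.intros(4)
      real_polynomial_function_entry real_polynomial_function.intros(2))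

lemma real_polynomial_function_ddet:
  assumes "\<And>i j. real_polynomial_function (\<lambda>M. F M $ i $ j)"
  shows "real_polynomial_function (\<lambda>M. ddet (pencil a S z M) (F M))"
  unfolding ddet_def
  by (intro real_polynomial_function_sum real_polynomial_function.intros(4) assms
      real_polynomial_function_cof real_polynomial_function_pencil_matrix) auto

lemma indep_funs_mono: "indep_funs K L h \<Longrightarrow> L \<subseteq> L' \<Longrightarrow> indep_funs K L' h"
  unfolding indep_funs_def by (meson subsetD)

text \<open>\<open>indep_funs_points\<close> converts independent derivatives into parameter values
  whose differentials are independent at one matrix, and \<open>indep_funs_generic\<close> spreads
  this to all matrices off the zero set of a polynomial. Membership in \<open>regular\<close> allows
  dividing by l and s.\<close>

lemma generic_independence:
  fixes a :: "'n::finite \<Rightarrow> real"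
  assumes a: "inj a" "\<And>i. a i \<noteq> 0"
  obtains P P' D D' where "finite P" "finite P'" "P \<subseteq> regular" "P' \<subseteq> regular"
    "card P + card P' = CARD('n) * (CARD('n) - 1) div 2"
    "real_polynomial_function D" "real_polynomial_function D'"
    "\<exists>M\<in>skew. D M \<noteq> 0" "\<exists>M\<in>skew. D' M \<noteq> 0"
    "\<And>M. D M \<noteq> 0 \<Longrightarrow> indep_funs P skew (\<lambda>z X. ddet (pencil a UNIV z M) X)"
    "\<And>M. D' M \<noteq> 0 \<Longrightarrow> indep_funs P' skew (\<lambda>z Y. ddet (pencil a UNIV z M) (cm Y M))"
proof -
  obtain N N' where N: "N + N' = CARD('n) * (CARD('n) - 1) div 2"
    "indep_dirs a skew UNIV N" "indep_dirs a hollow_sym UNIV N'"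
    using indep_dirs_exist[OF a, of UNIV] by auto
  obtain M X where M: "M \<in> skew" "X \<subseteq> skew" "finite X" "card X = N"
    "indep_funs X regular (\<lambda>x z. ddet (pencil a UNIV z M) x)"
    using N(2) unfolding indep_dirs_def by blast
  obtain P where P: "P \<subseteq> regular" "finite P" "card P = N"
    "indep_funs P X (\<lambda>z x. ddet (pencil a UNIV z M) x)"
    using indep_funs_points[OF M(3,5)] M(4) by blast
  have rp: "real_polynomial_function (\<lambda>M. ddet (pencil a UNIV z M) X)" for z X
    by (intro real_polynomial_function_ddet real_polynomial_function.intros(2))
  have "indep_funs P skew (\<lambda>z x. ddet (pencil a UNIV z M) x)"
    using indep_funs_mono[OF P(4) M(2)] .
  then obtain D where D: "real_polynomial_function D" "D M \<noteq> 0"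
    "\<And>M. D M \<noteq> 0 \<Longrightarrow> indep_funs P skew (\<lambda>z X. ddet (pencil a UNIV z M) X)"
    using indep_funs_generic[OF P(2), of skew "\<lambda>M z X. ddet (pencil a UNIV z M) X" M] rp by blast
  obtain M' X' where M': "M' \<in> skew" "X' \<subseteq> hollow_sym" "finite X'" "card X' = N'"
    "indep_funs X' regular (\<lambda>x z. ddet (pencil a UNIV z M') x)"
    using N(3) unfolding indep_dirs_def by blast
  obtain P' where P': "P' \<subseteq> regular" "finite P'" "card P' = N'"
    "indep_funs P' X' (\<lambda>z x. ddet (pencil a UNIV z M') x)"
    using indep_funs_points[OF M'(3,5)] M'(4) by blast
  have "indep_funs P' skew (\<lambda>z Y. ddet (pencil a UNIV z M') (cm Y M'))"
  proof (rule indep_funsI)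
    fix c z assume *: "\<And>Y. Y \<in> skew \<Longrightarrow> (\<Sum>z\<in>P'. c z * ddet (pencil a UNIV z M') (cm Y M')) = 0"
      and z: "z \<in> P'"
    have reg: "fst z \<noteq> 0" "snd z \<noteq> 0" if "z \<in> P'" for z
      using that P'(1) by (auto simp: regular_def)
    \<comment> \<open>The factor l/s is the one in \<open>ddet_orbit\<close> between the orbit
      direction and the symmetric direction; it is nonzero, so it can be absorbed into the
      coefficients.\<close>
    have "c z * (fst z / snd z) = 0"
    proof (rule indep_funsD[OF P'(4) _ z, of "\<lambda>z. c z * (fst z / snd z)"])
      fix x assume "x \<in> X'"
      then have x: "x \<in> hollow_sym" using M'(2) by auto
      \<comment> \<open>This solves \<open>cm (diag a) Y = x\<close>, since the entries of
        \<open>a\<close> are distinct and \<open>x\<close> has zero diagonal. Dividing symmetric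
        entries by antisymmetric differences makes \<open>Y\<close> skew.\<close>
      define Y where "Y = (\<chi> i j. x $ i $ j / (a i - a j))"
      have Y: "cm (diag a) Y = x"
      proof -
        have "cm (diag a) Y $ i $ j = x $ i $ j" for i j
          using a(1) hollow_sym_diag[OF x] by (cases "i = j") (auto simp: cm_diag_nth Y_def inj_def)
        then show ?thesis by (simp add: vec_eq_iff)
      qed
      have "Y $ i $ j = - Y $ j $ i" for i j
        unfolding Y_def vec_lambda_beta hollow_sym_nth[OF x, of j i]
        by (metis minus_diff_eq minus_divide_right)
      then have "Y \<in> skew" unfolding skew_iff by blast
      from *[OF this] have "(\<Sum>z\<in>P'. c z * ddet (pencil a UNIV z M') (cm Y M')) = 0" .
      moreover have "ddet (pencil a UNIV z M') (cm Y M') = fst z / snd z * ddet (pencil a UNIV z M') x"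
        if "z \<in> P'" for z
        using ddet_orbit[of z a M' Y] reg[OF that] by (simp add: Y field_simps)
      ultimately show "(\<Sum>z\<in>P'. c z * (fst z / snd z) * ddet (pencil a UNIV z M') x) = 0"
        by (simp add: mult.assoc)
    qed
    then show "c z = 0" using reg[OF z] by simp
  qed
  moreover have "real_polynomial_function (\<lambda>M. ddet (pencil a UNIV z M) (cm Y M))" for z Y
    unfolding cm_def
    by (intro real_polynomial_function_ddet)
      (auto simp: matrix_matrix_mult_def intro!: real_polynomial_function_sum real_polynomial_function_diff
        real_polynomial_function.intros(4) real_polynomial_function.intros(2) real_polynomial_function_entry)
  ultimately obtain D' where D': "real_polynomial_function D'" "D' M' \<noteq> 0"
    "\<And>M. D' M \<noteq> 0 \<Longrightarrow> indep_funs P' skew (\<lambda>z Y. ddet (pencil a UNIV z M) (cm Y M))"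
    using indep_funs_generic[OF P'(2), of skew "\<lambda>M z Y. ddet (pencil a UNIV z M) (cm Y M)" M'] by blast
  show thesis
    using that[of P P' D D'] P P' D D' N(1) M(1) M'(1) by auto
qed

subsection \<open>Commuting integrals on the skew matrices\<close>

text \<open>The gradient, within the skew matrices, of the determinant of the pencil as a function
  of \<open>M\<close>: the skew part of the ambient gradient, which is -s times the transposed
  adjugate.\<close>

definition grad :: "('n::finite \<Rightarrow> real) \<Rightarrow> real \<times> real \<Rightarrow> real^'n^'n \<Rightarrow> real^'n^'n" where
  "grad a z M = (snd z / 2) *\<^sub>R (adjugate (pencil a UNIV z M) - transpose (adjugate (pencil a UNIV z M)))"

lemma grad_skew: "grad a z M \<in> skew"
  by (simp add: grad_def skew_def transpose_scalar transpose_diff algebra_simps)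

lemma inner_grad:
  assumes "R \<in> skew"
  shows "grad a z M \<bullet> R = - snd z * ddet (pencil a UNIV z M) R"
proof -
  let ?C = "adjugate (pencil a UNIV z M)"
  have "?C \<bullet> R = - (transpose ?C \<bullet> R)"
    using assms inner_transpose[of ?C R] by (simp add: skew_def)
  then show ?thesis
    by (simp add: grad_def ddet_inner inner_diff_left inner_commute[of R] algebra_simps)
qed

text \<open>The adjugate commutes with l a + s M. Its transpose is the adjugate for -s, hence
  commutes with l a - s M. Sum and difference of the two identities relate the skew and the
  symmetric part of the adjugate.\<close>

lemma lax_relations:
  fixes a :: "'n::finite \<Rightarrow> real" and z :: "real \<times> real"
  assumes "M \<in> skew"
  defines "C \<equiv> adjugate (pencil a UNIV z M)"
  shows "snd z *\<^sub>R cm M (C - transpose C) = - fst z *\<^sub>R cm (diag a) (C + transpose C)"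
    and "snd z *\<^sub>R cm M (C + transpose C) = - fst z *\<^sub>R cm (diag a) (C - transpose C)"
proof -
  have "adjugate (pencil a UNIV (fst z, - snd z) M) = transpose C"
    unfolding C_def adjugate_transpose[symmetric] using pencil_transpose[OF assms(1), of a UNIV "fst z" "snd z"] by simp
  then have 1: "cm (fst z *\<^sub>R diag a + (- snd z) *\<^sub>R M) (transpose C) = 0"
    using cm_pencil_adjugate[of "(fst z, - snd z)" a M] by simp
  have 2: "cm (fst z *\<^sub>R diag a + snd z *\<^sub>R M) C = 0"
    unfolding C_def by (rule cm_pencil_adjugate)
  have u: "snd z *\<^sub>R cm M C = - (fst z *\<^sub>R cm (diag a) C)"
    using 2 unfolding cm.add_left cm.scaleR_left by (simp add: eq_neg_iff_add_eq_0 add.commute)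
  have u': "snd z *\<^sub>R cm M (transpose C) = fst z *\<^sub>R cm (diag a) (transpose C)"
    using 1 unfolding cm.add_left cm.scaleR_left by simp
  show "snd z *\<^sub>R cm M (C - transpose C) = - fst z *\<^sub>R cm (diag a) (C + transpose C)"
    "snd z *\<^sub>R cm M (C + transpose C) = - fst z *\<^sub>R cm (diag a) (C - transpose C)"
    by (simp_all add: cm.add_right cm.diff_right scaleR_diff_right scaleR_add_right u u')
qed

text \<open>Using the Lax relations alternately for the two parameter pairs leads from the pairing
  of the skew parts to that of the symmetric parts and back. Each half of the way replaces the
  factor s l' by - l s', which gives the squares.\<close>

lemma grad_commute_generic:
  fixes a :: "'n::finite \<Rightarrow> real" and l s l' s' :: real
  assumes M: "M \<in> skew"
  defines "C \<equiv> adjugate (pencil a UNIV (l, s) M)" and "C' \<equiv> adjugate (pencil a UNIV (l', s') M)"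
  shows "(s * l')\<^sup>2 * (cm M (C - transpose C) \<bullet> (C' - transpose C')) =
    (l * s')\<^sup>2 * (cm M (C - transpose C) \<bullet> (C' - transpose C'))"
proof -
  define K L K' L' where "K = C - transpose C" and "L = C + transpose C"
    and "K' = C' - transpose C'" and "L' = C' + transpose C'"
  note r = lax_relations[OF M, of "(l, s)" a, folded C_def K_def L_def, simplified]
  note r' = lax_relations[OF M, of "(l', s')" a, folded C'_def K'_def L'_def, simplified]
  have "s * (cm M K \<bullet> K') = - l * (L \<bullet> cm (diag a) K')"
  proof -
    have "s * (cm M K \<bullet> K') = (s *\<^sub>R cm M K) \<bullet> K'" by simp
    also have "\<dots> = - l * (L \<bullet> cm (diag a) K')" unfolding r(1) by (simp add: inner_cm_sym transpose_diag)
    finally show ?thesis .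
  qed
  moreover have "l' * (L \<bullet> cm (diag a) K') = s' * (cm M L \<bullet> L')"
  proof -
    have "l' * (L \<bullet> cm (diag a) K') = - (L \<bullet> (- (l' *\<^sub>R cm (diag a) K')))" by simp
    also have "\<dots> = - (L \<bullet> (s' *\<^sub>R cm M L'))" unfolding r'(2) ..
    also have "\<dots> = s' * (cm M L \<bullet> L')" by (simp add: inner_cm_skew[OF M])
    finally show ?thesis .
  qed
  moreover have "s * (cm M L \<bullet> L') = - l * (K \<bullet> cm (diag a) L')"
  proof -
    have "s * (cm M L \<bullet> L') = (s *\<^sub>R cm M L) \<bullet> L'" by simp
    also have "\<dots> = - l * (K \<bullet> cm (diag a) L')" unfolding r(2) by (simp add: inner_cm_sym transpose_diag)
    finally show ?thesis .
  qed
  moreover have "l' * (K \<bullet> cm (diag a) L') = s' * (cm M K \<bullet> K')"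
  proof -
    have "l' * (K \<bullet> cm (diag a) L') = - (K \<bullet> (- (l' *\<^sub>R cm (diag a) L')))" by simp
    also have "\<dots> = - (K \<bullet> (s' *\<^sub>R cm M K'))" unfolding r'(1) ..
    also have "\<dots> = s' * (cm M K \<bullet> K')" by (simp add: inner_cm_skew[OF M])
    finally show ?thesis .
  qed
  ultimately have "(s * l')\<^sup>2 * (cm M K \<bullet> K') = (l * s')\<^sup>2 * (cm M K \<bullet> K')" by algebra
  then show ?thesis by (simp only: K_def K'_def)
qed

text \<open>The generic identity says nothing if (s l')^2 = (l s')^2. For fixed s' the bracket is a
  polynomial in l' that vanishes off at most two values, hence everywhere.\<close>

lemma grad_commute:
  assumes M: "M \<in> skew" and z: "z \<in> regular"
  shows "cm M (grad a z M) \<bullet> grad a z' M = 0"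
proof -
  obtain l s l' s' where zz: "z = (l, s)" "z' = (l', s')" by (cases z; cases z') auto
  have s: "s \<noteq> 0" using z by (simp add: zz regular_def)
  define C where "C = adjugate (pencil a UNIV z M)"
  define f where "f t = cm M (C - transpose C) \<bullet>
    (adjugate (pencil a UNIV (t, s') M) - transpose (adjugate (pencil a UNIV (t, s') M)))" for t
  have "real_polynomial_function (\<lambda>t. pencil a UNIV (t, s') M $ i $ j)" for i j
    unfolding pencil_def vec_lambda_beta fst_conv snd_conv
    by (cases "i = j") (auto intro!: real_polynomial_function_diff real_polynomial_function.intros(2)
        real_polynomial_function.intros(1)[OF bounded_linear_mult_left])
  then have rp: "real_polynomial_function f"
    unfolding f_def inner_matrix_sum
    by (intro real_polynomial_function_sum real_polynomial_function.intros(4) real_polynomial_function.intros(2))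
      (auto simp: adjugate_def transpose_def intro!: real_polynomial_function_diff real_polynomial_function_cof)
  have fz: "f t = 0" if "(s * t)\<^sup>2 \<noteq> (l * s')\<^sup>2" for t
    using grad_commute_generic[OF M, of s t a l s'] that by (auto simp: f_def C_def zz)
  have "f l' = 0"
  proof (rule ccontr)
    assume "f l' \<noteq> 0"
    then have "finite {t. f t = 0}" using rp finite_zeros_real_polynomial_function by blast
    moreover have "UNIV \<subseteq> {t. f t = 0} \<union> {l * s' / s, - (l * s' / s)}"
    proof
      fix t :: real
      have "t \<in> {l * s' / s, - (l * s' / s)}" if "(s * t)\<^sup>2 = (l * s')\<^sup>2"
        using that s unfolding power2_eq_iff by (auto simp: field_simps)
      then show "t \<in> {t. f t = 0} \<union> {l * s' / s, - (l * s' / s)}" using fz by auto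
    qed
    ultimately show False
      using infinite_UNIV_char_0[where 'a = real] finite_subset by blast
  qed
  then show ?thesis by (simp add: grad_def f_def C_def zz cm.scaleR_right)
qed

text \<open>With \<open>P = p ** transpose q\<close>, half of the momentum \<open>M\<close> of the paper, the Hamiltonian is
  \<open>2 * (\<Sum>k. (P\<^sub>1\<^sub>k)\<^sup>2 / A\<^sub>k)\<close>; this is its gradient.\<close>

definition energy_grad :: "'n::finite \<Rightarrow> ('n \<Rightarrow> real) \<Rightarrow> real^'n^'n \<Rightarrow> real^'n^'n" where
  "energy_grad f A P = (\<chi> i j. if i = f \<and> j \<noteq> f then 2 * P $ f $ j / A j
     else if j = f \<and> i \<noteq> f then 2 * P $ i $ f / A i else 0)"

text \<open>Only the differences -A_k between the entry at \<open>f\<close> and the others matter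
  for \<open>cm_energy_grad\<close>. The shift by 1 keeps all entries nonzero when the
  \<open>A k\<close> are positive, as the nodes 1/a_i require.\<close>

definition spectrum_shift :: "'n \<Rightarrow> ('n \<Rightarrow> real) \<Rightarrow> 'n \<Rightarrow> real" where
  "spectrum_shift f A k = (if k = f then 1 else 1 + A k)"

lemma energy_grad_skew:
  assumes "P \<in> skew"
  shows "energy_grad f A P \<in> skew"
proof -
  have "energy_grad f A P $ i $ j = - energy_grad f A P $ j $ i" for i j
    using skew_nth[OF assms, of i f] skew_nth[OF assms, of f j]
    by (cases "i = f"; cases "j = f") (simp_all add: energy_grad_def)
  then show ?thesis unfolding skew_iff by blast
qed

lemma inner_energy_grad:
  assumes P: "P \<in> skew" and R: "R \<in> skew"
  shows "energy_grad f A P \<bullet> R = 4 * (\<Sum>k\<in>UNIV - {f}. P $ f $ k * R $ f $ k / A k)"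
proof -
  let ?W = "energy_grad f A P"
  have row: "(\<Sum>j\<in>UNIV. ?W $ i $ j * R $ i $ j) = 2 * P $ f $ i * R $ f $ i / A i" if "i \<noteq> f" for i
  proof -
    have "(\<Sum>j\<in>UNIV. ?W $ i $ j * R $ i $ j) = ?W $ i $ f * R $ i $ f + (\<Sum>j\<in>UNIV - {f}. ?W $ i $ j * R $ i $ j)"
      by (simp add: sum.remove)
    also have "(\<Sum>j\<in>UNIV - {f}. ?W $ i $ j * R $ i $ j) = 0"
      using that by (intro sum.neutral) (auto simp: energy_grad_def)
    also have "?W $ i $ f = 2 * P $ i $ f / A i" using that by (simp add: energy_grad_def)
    finally show ?thesis unfolding skew_nth[OF P, of i f] skew_nth[OF R, of i f] by simp
  qed
  have first: "(\<Sum>j\<in>UNIV. ?W $ f $ j * R $ f $ j) = (\<Sum>k\<in>UNIV - {f}. 2 * P $ f $ k * R $ f $ k / A k)"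
    by (subst sum.remove[of _ f]) (auto simp: energy_grad_def intro!: sum.cong)
  have "?W \<bullet> R = (\<Sum>j\<in>UNIV. ?W $ f $ j * R $ f $ j) + (\<Sum>i\<in>UNIV - {f}. \<Sum>j\<in>UNIV. ?W $ i $ j * R $ i $ j)"
    unfolding inner_matrix_sum by (subst sum.remove[of _ f]) auto
  also have "(\<Sum>i\<in>UNIV - {f}. \<Sum>j\<in>UNIV. ?W $ i $ j * R $ i $ j) =
    (\<Sum>k\<in>UNIV - {f}. 2 * P $ f $ k * R $ f $ k / A k)"
    by (intro sum.cong refl row) auto
  finally show ?thesis unfolding first
    by (simp add: sum_distrib_left sum.distrib[symmetric])
qed

text \<open>Manakov's condition with the degenerate second matrix b whose only nonzero entry is at
  (f, f): the differences -A_k cancel the denominators in the gradient, and between two indices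
  other than \<open>f\<close> both sides are zero.\<close>

lemma cm_energy_grad:
  assumes "P \<in> skew" "\<And>k. k \<noteq> f \<Longrightarrow> A k \<noteq> 0"
  shows "cm (diag (spectrum_shift f A)) (energy_grad f A P) =
    - 2 *\<^sub>R cm (diag (\<lambda>k. if k = f then 1 else 0)) P"
proof -
  have "cm (diag (spectrum_shift f A)) (energy_grad f A P) $ i $ j =
    (- 2 *\<^sub>R cm (diag (\<lambda>k. if k = f then 1 else 0)) P) $ i $ j" for i j
    using assms(2)[of i] assms(2)[of j]
    by (cases "i = f"; cases "j = f") (simp_all add: cm_diag_nth energy_grad_def spectrum_shift_def)
  then show ?thesis by (simp add: vec_eq_iff)
qed

text \<open>Two Lax relations and \<open>cm_energy_grad\<close> reduce the bracket to a multiple of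
  the pairing of the skew part of the adjugate with \<open>cm (diag a) b\<close>, and diagonal
  matrices commute.\<close>

lemma grad_energy_commute:
  assumes P: "P \<in> skew" and A: "\<And>k. k \<noteq> f \<Longrightarrow> A k \<noteq> 0" and z: "z \<in> regular"
  shows "cm P (grad (spectrum_shift f A) z P) \<bullet> energy_grad f A P = 0"
proof -
  let ?a = "spectrum_shift f A"
  define C where "C = adjugate (pencil ?a UNIV z P)"
  define K L where "K = C - transpose C" and "L = C + transpose C"
  define b where "b = diag (\<lambda>k. if k = f then 1 else 0 :: real)"
  note r = lax_relations[OF P, of z ?a, folded C_def K_def L_def]
  have s: "snd z \<noteq> 0" using z by (simp add: regular_def)
  have "snd z * (cm P K \<bullet> energy_grad f A P) = (snd z *\<^sub>R cm P K) \<bullet> energy_grad f A P" by simp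
  also have "\<dots> = - fst z * (L \<bullet> cm (diag ?a) (energy_grad f A P))"
    unfolding r(1) by (simp add: inner_cm_sym transpose_diag)
  also have "\<dots> = 2 * fst z * (L \<bullet> cm b P)"
    by (subst cm_energy_grad[OF P A]) (simp_all add: b_def)
  also have "L \<bullet> cm b P = cm P L \<bullet> b"
    unfolding inner_cm_skew[OF P] cm_commute[of b P] by simp
  finally have "snd z * (snd z * (cm P K \<bullet> energy_grad f A P)) = 2 * fst z * ((snd z *\<^sub>R cm P L) \<bullet> b)"
    by (simp add: algebra_simps)
  also have "(snd z *\<^sub>R cm P L) \<bullet> b = - fst z * (K \<bullet> cm (diag ?a) b)"
    unfolding r(2) by (simp add: inner_cm_sym transpose_diag)
  also have "cm (diag ?a) b = 0"
    by (simp add: vec_eq_iff cm_diag_nth b_def) (simp add: diag_def)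
  finally have "cm P K \<bullet> energy_grad f A P = 0" using s by simp
  then show ?thesis by (simp add: grad_def K_def C_def cm.scaleR_right)
qed

subsection \<open>Tangent spaces of the special orthogonal group and its cotangent bundle\<close>

lemma SO_D:
  assumes "q \<in> SO"
  shows "transpose q ** q = mat 1" "q ** transpose q = mat 1" "det q = 1"
  using assms by (auto simp: SO_def orthogonal_matrix_def)

lemma SO_cancel:
  fixes q X :: "real^'n^'n"
  assumes "q \<in> SO"
  shows "X ** q ** transpose q = X" "X ** transpose q ** q = X"
  using SO_D[OF assms] by (simp_all add: matrix_mul_assoc[symmetric])

lemma SO_mult: "q \<in> SO \<Longrightarrow> r \<in> SO \<Longrightarrow> q ** r \<in> SO"
  by (simp add: SO_def orthogonal_matrix_mul det_mul)

lemma inner_mul_SO: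
  fixes q X Y :: "real^'n^'n"
  assumes "q \<in> SO"
  shows "(X ** q) \<bullet> (Y ** q) = X \<bullet> Y"
  by (simp add: inner_mul_right[of X q] SO_cancel[OF assms])

lemma bounded_linear_transpose: "bounded_linear (transpose :: real^'n^'n \<Rightarrow> real^'n^'n)"
  unfolding linear_conv_bounded_linear[symmetric]
  by (intro linearI) (simp_all add: transpose_add transpose_scalar)

lemma inner_skew_vector: "X \<in> skew \<Longrightarrow> x \<bullet> (X *v x) = 0"
proof -
  assume X: "X \<in> skew"
  have "x \<bullet> (X *v x) = (transpose X *v x) \<bullet> x" by (simp add: dot_lmul_matrix)
  also have "transpose X = - X" using X by (simp add: skew_def)
  also have "(- X) *v x = - (X *v x)" by (simp add: matrix_vector_mult_def vec_eq_iff sum_negf)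
  also have "- (X *v x) \<bullet> x = - (x \<bullet> (X *v x))" by (simp add: inner_commute)
  finally show ?thesis by simp
qed

section \<open>Curves in the special orthogonal group\<close>

lemma cayley_exists:
  assumes X: "X \<in> skew"
  shows "\<exists>R\<in>SO. (mat 1 - X) ** R = mat 1 + X"
proof -
  let ?A = "mat 1 - X" and ?A' = "mat 1 + X"
  have tA: "transpose ?A = ?A'" using X by (simp add: skew_def transpose_diff)
  \<comment> \<open>A skew matrix has no real eigenvalue other than 0, so 1 - X is invertible for
    every skew \<open>X\<close>, without any bound on its size.\<close>
  have "x = 0" if "?A *v x = 0" for x
  proof -
    have "x = X *v x" using that by (simp add: matrix_vector_mult_diff_rdistrib)
    then have "x \<bullet> x = x \<bullet> (X *v x)" by simp
    also have "\<dots> = 0" by (rule inner_skew_vector[OF X])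
    finally show ?thesis by simp
  qed
  then have "\<exists>B. B ** ?A = mat 1" by (simp add: matrix_left_invertible_ker)
  then obtain B where B: "B ** ?A = mat 1" by blast
  then have B': "?A ** B = mat 1" by (simp add: matrix_left_right_inverse)
  have comm: "?A' ** ?A = ?A ** ?A'" by (simp add: mm.add_left mm.diff_right mm.diff_left mm.add_right)
  define R where "R = B ** ?A'"
  have AR: "?A ** R = ?A'" by (simp add: R_def matrix_mul_assoc B')
  have RA: "R ** ?A = ?A'"
    by (metis R_def B comm matrix_mul_assoc matrix_mul_lid)
  have "?A' ** transpose R = ?A"
    using arg_cong[OF RA, of transpose] tA
    by (metis matrix_transpose_mul transpose_transpose)
  then have "?A ** (R ** transpose R) = ?A" by (simp add: matrix_mul_assoc AR)
  then have RR: "R ** transpose R = mat 1"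
    by (metis B matrix_mul_assoc matrix_mul_lid)
  have "det ?A * det R = det ?A" using arg_cong[OF AR, of det] tA
    by (metis det_mul det_transpose)
  moreover have "det ?A \<noteq> 0"
    using arg_cong[OF B, of det] by (auto simp: det_mul)
  ultimately have "det R = 1" by simp
  then have "R \<in> SO"
    using RR matrix_left_right_inverse[of R "transpose R"] by (simp add: SO_def orthogonal_matrix_def)
  then show ?thesis using AR by blast
qed

lemma SO_norm: "R \<in> SO \<Longrightarrow> norm R = norm (mat 1 :: real^'n^'n)" for R :: "real^'n^'n"
proof -
  assume "R \<in> SO"
  then have "R \<bullet> R = (mat 1 :: real^'n^'n) \<bullet> mat 1"
    using inner_mul_SO[of R "mat 1" "mat 1"] by simp
  then show ?thesis by (simp add: norm_eq_sqrt_inner)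
qed

text \<open>The Cayley curve is defined for all times, as \<open>tangent_space\<close> demands.
  Inserting c - 1 = (t/2) X (c + 1) into itself and using that orthogonal matrices have constant
  norm bounds the error of the linear approximation by a multiple of t^2, so no inverse has to be
  differentiated.\<close>

lemma SO_curve:
  fixes X :: "real^'n^'n"
  assumes X: "X \<in> skew"
  obtains c where "\<And>t. c t \<in> SO" "c 0 = mat 1" "(c has_vector_derivative X) (at 0)"
proof -
  have "\<exists>R\<in>SO. (mat 1 - (t / 2) *\<^sub>R X) ** R = mat 1 + (t / 2) *\<^sub>R X" for t
    using X by (intro cayley_exists subspace_mul[OF subspace_skew])
  then obtain c where c: "\<And>t. c t \<in> SO" "\<And>t. (mat 1 - (t / 2) *\<^sub>R X) ** c t = mat 1 + (t / 2) *\<^sub>R X"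
    by metis
  have eq: "c t - mat 1 = (t / 2) *\<^sub>R (X ** (c t + mat 1))" for t
    using c(2)[of t] by (simp add: mm.diff_left mm.add_right mm.scaleR_left algebra_simps)
  have c0: "c 0 = mat 1" using eq[of 0] by simp
  have "\<exists>K>0. \<forall>(A::real^'n^'n) (B::real^'n^'n). norm (A ** B) \<le> norm A * norm B * K"
    by (rule mm.pos_bounded)
  then obtain K where K: "K > 0" "\<And>(A::real^'n^'n) (B::real^'n^'n). norm (A ** B) \<le> norm A * norm B * K"
    by metis
  define N where "N = norm (mat 1 :: real^'n^'n)"
  define C where "C = norm X * (norm X * (2 * N) * K) * K"
  have b1: "norm (X ** (c t + mat 1)) \<le> norm X * (2 * N) * K" for t
  proof -
    have "norm (c t + mat 1) \<le> 2 * N"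
      using norm_triangle_ineq[of "c t" "mat 1"] SO_norm[OF c(1)[of t]] by (simp add: N_def)
    then have "norm X * norm (c t + mat 1) * K \<le> norm X * (2 * N) * K"
      using K(1) by (intro mult_right_mono mult_left_mono) auto
    then show ?thesis using K(2)[of X "c t + mat 1"] by linarith
  qed
  have b2: "norm (c t - c 0 - t *\<^sub>R X) \<le> C * t\<^sup>2" for t
  proof -
    have "c t - c 0 - t *\<^sub>R X = (t / 2) *\<^sub>R (X ** (c t - mat 1))"
    proof -
      have tX: "t *\<^sub>R X = (t / 2) *\<^sub>R X + (t / 2) *\<^sub>R X" by (simp flip: scaleR_left_distrib)
      have "c t - c 0 - t *\<^sub>R X = (t / 2) *\<^sub>R (X ** (c t + mat 1)) - (t / 2) *\<^sub>R (X ** (mat 1 + mat 1))"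
        unfolding c0 eq[of t] tX mm.add_right[of X "mat 1" "mat 1"] scaleR_add_right by simp
      also have "\<dots> = (t / 2) *\<^sub>R (X ** ((c t + mat 1) - (mat 1 + mat 1)))"
        by (simp only: mm.diff_right scaleR_diff_right)
      finally show ?thesis by simp
    qed
    also have "\<dots> = (t / 2) *\<^sub>R (X ** ((t / 2) *\<^sub>R (X ** (c t + mat 1))))" using eq[of t] by simp
    also have "norm \<dots> = (t / 2)\<^sup>2 * norm (X ** (X ** (c t + mat 1)))"
      by (simp add: mm.scaleR_right power2_eq_square)
    also have "\<dots> \<le> t\<^sup>2 * C"
    proof (intro mult_mono)
      have "norm (X ** (X ** (c t + mat 1))) \<le> norm X * norm (X ** (c t + mat 1)) * K" by (rule K(2))
      also have "\<dots> \<le> C" unfolding C_def using b1[of t] K(1) by (intro mult_right_mono mult_left_mono) auto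
      finally show "norm (X ** (X ** (c t + mat 1))) \<le> C" .
    qed (auto simp: power2_eq_square)
    finally show ?thesis by (simp add: mult.commute)
  qed
  have "(c has_vector_derivative X) (at 0)"
    unfolding has_vector_derivative_def has_derivative_at
  proof (intro conjI bounded_linear_scaleR_left)
    show "(\<lambda>h. norm (c (0 + h) - c 0 - h *\<^sub>R X) / norm h) \<midarrow>0\<rightarrow> 0"
    proof (rule Lim_null_comparison)
      show "\<forall>\<^sub>F h in at 0. norm (norm (c (0 + h) - c 0 - h *\<^sub>R X) / norm h) \<le> C * \<bar>h\<bar>"
      proof (rule always_eventually, rule allI)
        fix h :: real
        show "norm (norm (c (0 + h) - c 0 - h *\<^sub>R X) / norm h) \<le> C * \<bar>h\<bar>"
          using b2[of h] by (cases "h = 0") (auto simp: divide_le_eq power2_eq_square mult.assoc abs_mult_self_eq)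
      qed
      show "(\<lambda>h. C * \<bar>h\<bar>) \<midarrow>0\<rightarrow> 0" by (auto intro!: tendsto_eq_intros)
    qed
  qed
  then show thesis using that c(1) c0 by blast
qed

lemma skew_derivative:
  assumes "(f has_vector_derivative v) (at (t::real))" "\<And>t. f t \<in> skew"
  shows "v \<in> skew"
proof -
  have "((\<lambda>t. transpose (f t)) has_vector_derivative transpose v) (at t)"
    using bounded_linear.has_vector_derivative[OF bounded_linear_transpose assms(1)] .
  moreover have "(\<lambda>t. transpose (f t)) = (\<lambda>t. - f t)" using assms(2) by (auto simp: skew_def)
  moreover have "((\<lambda>t. - f t) has_vector_derivative - v) (at t)"
    using assms(1) by (rule has_vector_derivative_minus)
  ultimately show ?thesis
    unfolding skew_def using vector_derivative_unique_at by fastforce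
qed

lemma tangent_space_SO:
  assumes q: "q \<in> SO"
  shows "tangent_space SO q = {X ** q | X. X \<in> skew}"
proof (intro equalityI subsetI)
  fix v assume "v \<in> tangent_space SO q"
  then obtain c where c: "\<And>t::real. c t \<in> SO" "c 0 = q" "(c has_vector_derivative v) (at 0)"
    unfolding tangent_space_def by blast
  have "((\<lambda>t. c t ** transpose (c t)) has_vector_derivative
    (c 0 ** transpose v + v ** transpose (c 0))) (at 0)"
    by (intro mm.has_vector_derivative c(3)
        bounded_linear.has_vector_derivative[OF bounded_linear_transpose])
  moreover have "(\<lambda>t. c t ** transpose (c t)) = (\<lambda>t. mat 1)" using SO_D(2)[OF c(1)] by auto
  ultimately have "q ** transpose v + v ** transpose q = 0"
    using vector_derivative_unique_at[OF _ has_vector_derivative_const] c(2) by fastforce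
  then have "v ** transpose q \<in> skew"
    by (simp add: skew_def matrix_transpose_mul eq_neg_iff_add_eq_0)
  moreover have "v = v ** transpose q ** q" using SO_cancel[OF q] by simp
  ultimately show "v \<in> {X ** q | X. X \<in> skew}" by blast
next
  fix v assume "v \<in> {X ** q | X. X \<in> skew}"
  then obtain X where X: "X \<in> skew" "v = X ** q" by blast
  obtain c where c: "\<And>t. c t \<in> SO" "c 0 = mat 1" "(c has_vector_derivative X) (at 0)"
    using SO_curve[OF X(1)] by blast
  have "((\<lambda>t. c t ** q) has_vector_derivative v) (at 0)"
    unfolding X(2) using bounded_linear.has_vector_derivative[OF mm.bounded_linear_left c(3)] .
  then show "v \<in> tangent_space SO q"
    unfolding tangent_space_def using c q by (auto intro!: exI[of _ "\<lambda>t. c t ** q"] SO_mult)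
qed

section \<open>The cotangent bundle in the right trivialization\<close>

lemma cotangent_bundle_SO:
  "cotangent_bundle SO = {(q, P ** q) | q P. q \<in> SO \<and> P \<in> skew}"
  unfolding cotangent_bundle_def using tangent_space_SO by auto

abbreviation TSO :: "((real^'n^'n) \<times> (real^'n^'n)) set" where
  "TSO \<equiv> cotangent_bundle SO"

text \<open>The product rule for p = P q. Conversely, p times the transpose of q stays skew along a
  curve in the bundle, so its velocity \<open>R\<close> is skew.\<close>

lemma tangent_space_TSO:
  assumes q: "q \<in> SO" and P: "P \<in> skew"
  shows "tangent_space TSO (q, P ** q) =
    {(X ** q, R ** q + P ** X ** q) | X R. X \<in> skew \<and> R \<in> skew}" (is "?L = ?R")
proof (intro equalityI subsetI)
  fix y assume "y \<in> ?L"
  then obtain c where c: "\<And>t::real. c t \<in> TSO" "c 0 = (q, P ** q)" "(c has_vector_derivative y) (at 0)"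
    unfolding tangent_space_def by blast
  obtain v w where y: "y = (v, w)" by (cases y)
  have v: "((\<lambda>t. fst (c t)) has_vector_derivative v) (at 0)"
    using bounded_linear.has_vector_derivative[OF bounded_linear_fst c(3)] y by simp
  have w: "((\<lambda>t. snd (c t)) has_vector_derivative w) (at 0)"
    using bounded_linear.has_vector_derivative[OF bounded_linear_snd c(3)] y by simp
  have "fst (c t) \<in> SO" for t
    using c(1)[of t] by (auto simp: cotangent_bundle_def)
  then have "v \<in> tangent_space SO q"
    unfolding tangent_space_def using c(2) v by (intro CollectI exI[of _ "\<lambda>t. fst (c t)"]) simp
  then obtain X where X: "X \<in> skew" "v = X ** q" unfolding tangent_space_SO[OF q] by blast
  have "((\<lambda>t. snd (c t) ** transpose (fst (c t))) has_vector_derivative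
    (snd (c 0) ** transpose v + w ** transpose (fst (c 0)))) (at 0)"
    by (intro mm.has_vector_derivative w bounded_linear.has_vector_derivative[OF bounded_linear_transpose] v)
  moreover have "snd (c t) ** transpose (fst (c t)) \<in> skew" for t
    using c(1)[of t] unfolding cotangent_bundle_SO by (auto simp: SO_cancel)
  ultimately have Z: "snd (c 0) ** transpose v + w ** transpose (fst (c 0)) \<in> skew"
    by (rule skew_derivative)
  define R where "R = snd (c 0) ** transpose v + w ** transpose (fst (c 0))"
  have "R = P ** q ** (transpose q ** transpose X) + w ** transpose q"
    by (simp add: R_def c(2) X(2) matrix_transpose_mul)
  also have "P ** q ** (transpose q ** transpose X) = - (P ** X)"
    using X(1) SO_cancel[OF q] by (simp add: matrix_mul_assoc skew_def mm.minus_right)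
  finally have "R ** q + P ** X ** q = w"
    using SO_cancel[OF q] by (simp add: mm.add_left mm.minus_left mm.diff_left)
  then show "y \<in> ?R" using X Z y unfolding R_def[symmetric] by blast
next
  fix y assume "y \<in> ?R"
  then obtain X R where X: "X \<in> skew" "R \<in> skew" "y = (X ** q, R ** q + P ** X ** q)" by blast
  obtain c where c: "\<And>t. c t \<in> SO" "c 0 = mat 1" "(c has_vector_derivative X) (at 0)"
    using SO_curve[OF X(1)] by blast
  have 1: "((\<lambda>t. c t ** q) has_vector_derivative X ** q) (at 0)"
    using bounded_linear.has_vector_derivative[OF mm.bounded_linear_left c(3)] .
  have "((\<lambda>t. P + t *\<^sub>R R) has_vector_derivative R) (at 0)"
    by (auto intro!: derivative_eq_intros)
  from mm.has_vector_derivative[OF this 1]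
  have 2: "((\<lambda>t. (P + t *\<^sub>R R) ** (c t ** q)) has_vector_derivative R ** q + P ** X ** q) (at 0)"
    by (simp add: c(2) matrix_mul_assoc add.commute)
  have "((\<lambda>t. (c t ** q, (P + t *\<^sub>R R) ** (c t ** q))) has_vector_derivative y) (at 0)"
    unfolding X(3) using 1 2 by (rule has_vector_derivative_Pair)
  moreover have "(c t ** q, (P + t *\<^sub>R R) ** (c t ** q)) \<in> TSO" for t
    unfolding cotangent_bundle_SO using c(1) q P X(2) SO_mult
      subspace_add[OF subspace_skew P subspace_mul[OF subspace_skew X(2)]] by blast
  ultimately show "y \<in> ?L"
    unfolding tangent_space_def using c(2)
    by (auto intro!: exI[of _ "\<lambda>t. (c t ** q, (P + t *\<^sub>R R) ** (c t ** q))"])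
qed

text \<open>By the chain rule along a curve in \<open>S\<close> with velocity \<open>v\<close>,
  every derivative within \<open>S\<close> takes the same value at \<open>v\<close>; this applies in
  particular to the one selected by \<open>frechet_derivative\<close>.\<close>

lemma differential_eq:
  assumes "(f has_derivative f') (at x within S)" "v \<in> tangent_space S x"
  shows "differential S f x v = f' v"
proof -
  obtain c where c: "\<And>t::real. c t \<in> S" "c 0 = x" "(c has_vector_derivative v) (at 0)"
    using assms(2) unfolding tangent_space_def by blast
  have d: "((\<lambda>t. f (c t)) has_vector_derivative g v) (at 0)" if "(f has_derivative g) (at x within S)" for g
  proof -
    have g: "bounded_linear g" using that by (rule has_derivative_bounded_linear)
    have "(f has_derivative g) (at (c 0) within range c)"
      using has_derivative_subset[OF that, of "range c"] c(1,2) by auto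
    with c(3) have "((\<lambda>t. f (c t)) has_derivative (\<lambda>t. g (t *\<^sub>R v))) (at 0)"
      unfolding has_vector_derivative_def by (rule has_derivative_in_compose)
    then show ?thesis
      unfolding has_vector_derivative_def by (simp add: linear_simps(5)[OF g])
  qed
  have "f differentiable (at x within S)" using assms(1) by (auto simp: differentiable_def)
  then have "(f has_derivative frechet_derivative f (at x within S)) (at x within S)"
    by (simp add: frechet_derivative_works)
  from d[OF this] d[OF assms(1)] show ?thesis
    unfolding differential_def by (rule vector_derivative_unique_at)
qed

subsection \<open>Hamiltonian vector fields in the right trivialization\<close>

text \<open>At \<open>(q, P ** q)\<close> a tangent vector of the cotangent bundle is given by the pair of skew
  matrices \<open>X\<close>, \<open>R\<close> with \<open>dq = X ** q\<close> and \<open>dP = R\<close>. The pair \<open>u\<close>, \<open>v\<close> represents the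
  differential of \<open>f\<close> as \<open>u \<bullet> X + v \<bullet> R\<close>.\<close>

definition has_dual_differential ::
  "((real^'n^'n) \<times> (real^'n^'n) \<Rightarrow> real) \<Rightarrow> real^'n^'n \<Rightarrow> real^'n^'n \<Rightarrow> real^'n^'n \<Rightarrow> real^'n^'n \<Rightarrow> bool" where
  "has_dual_differential f q P u v \<longleftrightarrow> u \<in> skew \<and> v \<in> skew \<and>
     (\<exists>f'. (f has_derivative f') (at (q, P ** q) within TSO) \<and>
       (\<forall>X\<in>skew. \<forall>R\<in>skew. f' (X ** q, R ** q + P ** X ** q) = u \<bullet> X + v \<bullet> R))"

lemma differential_dual:
  assumes "has_dual_differential f q P u v" "q \<in> SO" "P \<in> skew" "X \<in> skew" "R \<in> skew"
  shows "differential TSO f (q, P ** q) (X ** q, R ** q + P ** X ** q) = u \<bullet> X + v \<bullet> R"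
proof -
  obtain f' where "(f has_derivative f') (at (q, P ** q) within TSO)"
    "f' (X ** q, R ** q + P ** X ** q) = u \<bullet> X + v \<bullet> R"
    using assms unfolding has_dual_differential_def by blast
  moreover have "(X ** q, R ** q + P ** X ** q) \<in> tangent_space TSO (q, P ** q)"
    unfolding tangent_space_TSO[OF assms(2,3)] using assms by blast
  ultimately show ?thesis using differential_eq by metis
qed

text \<open>The mixed terms with \<open>P ** X\<close> and \<open>P ** Y\<close> combine into a
  commutator because \<open>P\<close>, \<open>X\<close> and \<open>Y\<close> are skew. It is the
  Kirillov-Kostant part of the canonical form.\<close>

lemma symplectic_form_TSO:
  assumes "q \<in> SO" "P \<in> skew" "X \<in> skew" "Y \<in> skew"
  shows "symplectic_form (X ** q, R ** q + P ** X ** q) (Y ** q, S ** q + P ** Y ** q) =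
    X \<bullet> S - (R + cm P X) \<bullet> Y"
proof -
  have "symplectic_form (X ** q, R ** q + P ** X ** q) (Y ** q, S ** q + P ** Y ** q) =
    X \<bullet> (S + P ** Y) - (R + P ** X) \<bullet> Y"
    unfolding symplectic_form_def fst_conv snd_conv mm.add_left[symmetric] inner_mul_SO[OF assms(1)] ..
  moreover have "X \<bullet> (P ** Y) = - ((P ** X) \<bullet> Y)"
    using assms(2) by (simp add: inner_mul_left[of P X] skew_def mm.minus_left)
  moreover have "(X ** P) \<bullet> Y = - ((P ** X) \<bullet> Y)"
  proof -
    have "(X ** P) \<bullet> Y = transpose (X ** P) \<bullet> transpose Y" by (simp add: inner_transpose)
    then show ?thesis using assms by (simp add: matrix_transpose_mul skew_def mm.minus_left mm.minus_right)
  qed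
  ultimately show ?thesis by (simp add: cm_def inner_add_left inner_add_right inner_diff_left)
qed

text \<open>Uniqueness is nondegeneracy of the form: the test vectors with components (0, X - v) and
  (S - R, 0) force both components. For \<open>u = 0\<close> the second component is the Lie-Poisson
  equation dP = -[P, v].\<close>

lemma hamiltonian_vf_dual:
  assumes f: "has_dual_differential f q P u v" and q: "q \<in> SO" and P: "P \<in> skew"
  shows "hamiltonian_vf SO f (q, P ** q) = (v ** q, (- u - cm P v) ** q + P ** v ** q)"
    (is "_ = ?x")
proof -
  have uv: "u \<in> skew" "v \<in> skew" using f by (auto simp: has_dual_differential_def)
  let ?R = "- u - cm P v"
  have R: "?R \<in> skew"
    using uv P by (intro subspace_diff[OF subspace_skew] subspace_neg[OF subspace_skew] cm_skew)
  let ?T = "tangent_space TSO (q, P ** q)"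
  note T = tangent_space_TSO[OF q P]
  show ?thesis unfolding hamiltonian_vf_def
  proof (rule the_equality)
    have "symplectic_form ?x y = differential TSO f (q, P ** q) y" if yT: "y \<in> ?T" for y
    proof -
      obtain Y S where Y: "Y \<in> skew" "S \<in> skew" "y = (Y ** q, S ** q + P ** Y ** q)"
        using yT unfolding T by blast
      show ?thesis
        unfolding Y(3) symplectic_form_TSO[OF q P uv(2) Y(1)] differential_dual[OF f q P Y(1,2)] by simp
    qed
    then show "?x \<in> ?T \<and> (\<forall>y\<in>?T. symplectic_form ?x y = differential TSO f (q, P ** q) y)"
      unfolding T using uv R by blast
  next
    fix x assume x: "x \<in> ?T \<and> (\<forall>y\<in>?T. symplectic_form x y = differential TSO f (q, P ** q) y)"
    then obtain X S where X: "X \<in> skew" "S \<in> skew" "x = (X ** q, S ** q + P ** X ** q)"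
      unfolding T by blast
    have eq: "X \<bullet> B - (S + cm P X) \<bullet> A = u \<bullet> A + v \<bullet> B" if "A \<in> skew" "B \<in> skew" for A B
    proof -
      have "(A ** q, B ** q + P ** A ** q) \<in> ?T" unfolding T using that by blast
      then have "symplectic_form x (A ** q, B ** q + P ** A ** q) =
        differential TSO f (q, P ** q) (A ** q, B ** q + P ** A ** q)" using x by blast
      then show ?thesis
        unfolding X(3) symplectic_form_TSO[OF q P X(1) that(1)] differential_dual[OF f q P that] .
    qed
    have "(X - v) \<bullet> (X - v) = 0"
      using eq[OF subspace_0[OF subspace_skew] subspace_diff[OF subspace_skew X(1) uv(2)]]
      by (simp add: inner_diff_left)
    then have Xv: "X = v" by simp
    have "(S - ?R) \<bullet> (S - ?R) = 0"
      using eq[OF subspace_diff[OF subspace_skew X(2) R] subspace_0[OF subspace_skew]]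
      unfolding Xv by (simp add: inner_diff_left inner_add_left)
    then have "S = ?R" by simp
    then show "x = ?x" using X(3) Xv by simp
  qed
qed

lemma poisson_bracket_dual:
  assumes f: "has_dual_differential f q P u v" and g: "has_dual_differential g q P u' v'"
    and q: "q \<in> SO" and P: "P \<in> skew"
  shows "poisson_bracket SO f g (q, P ** q) = u \<bullet> v' + v \<bullet> (- u' - cm P v')"
proof -
  have uv: "v \<in> skew" "v' \<in> skew" using f g by (auto simp: has_dual_differential_def)
  have "(v \<bullet> cm P v') = - (cm P v \<bullet> v')" using inner_cm_skew[OF P] by simp
  then show ?thesis
    unfolding poisson_bracket_def hamiltonian_vf_dual[OF f q P] hamiltonian_vf_dual[OF g q P]
      symplectic_form_TSO[OF q P uv]
    by (simp add: inner_diff_right inner_diff_left)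
qed

text \<open>The hypothesis is the differential of \<open>f\<close> applied to the Hamiltonian vector
  field of \<open>H\<close>. A derivative within the bundle suffices, since integral curves stay in
  it.\<close>

lemma constant_along_flowI:
  assumes "\<And>q P. q \<in> SO \<Longrightarrow> P \<in> skew \<Longrightarrow> \<exists>u v u' v'. has_dual_differential f q P u v \<and>
    has_dual_differential H q P u' v' \<and> u \<bullet> v' + v \<bullet> (- u' - cm P v') = 0"
  shows "constant_along_flow SO H f"
  unfolding constant_along_flow_def
proof (intro allI impI ballI)
  fix I z s t assume ic: "integral_curve SO H I z" and st: "s \<in> I" "t \<in> I"
  have "((\<lambda>t. f (z t)) has_derivative (\<lambda>h. 0)) (at t within I)" if t: "t \<in> I" for t
  proof -
    have "z t \<in> TSO" using ic t by (auto simp: integral_curve_def)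
    then obtain q P where qP: "q \<in> SO" "P \<in> skew" "z t = (q, P ** q)"
      unfolding cotangent_bundle_SO by blast
    obtain u v u' v' where d: "has_dual_differential f q P u v" "has_dual_differential H q P u' v'"
      "u \<bullet> v' + v \<bullet> (- u' - cm P v') = 0" using assms[OF qP(1,2)] by blast
    have uv: "u' \<in> skew" "v' \<in> skew" using d by (auto simp: has_dual_differential_def)
    have R: "- u' - cm P v' \<in> skew"
      using uv qP by (intro subspace_diff[OF subspace_skew] subspace_neg[OF subspace_skew] cm_skew)
    obtain f' where f': "(f has_derivative f') (at (z t) within TSO)"
      "\<forall>X\<in>skew. \<forall>R\<in>skew. f' (X ** q, R ** q + P ** X ** q) = u \<bullet> X + v \<bullet> R"
      using d(1) qP(3) unfolding has_dual_differential_def by auto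
    have 0: "f' (hamiltonian_vf SO H (z t)) = 0"
      unfolding qP(3) hamiltonian_vf_dual[OF d(2) qP(1,2)] using f'(2) uv R d(3) by auto
    have "(z has_derivative (\<lambda>h. h *\<^sub>R hamiltonian_vf SO H (z t))) (at t within I)"
      using ic t unfolding integral_curve_def has_vector_derivative_def
      by (blast intro: has_derivative_at_withinI)
    moreover have "(f has_derivative f') (at (z t) within z ` I)"
      using ic by (intro has_derivative_subset[OF f'(1)]) (auto simp: integral_curve_def)
    ultimately have "((\<lambda>t. f (z t)) has_derivative (\<lambda>h. f' (h *\<^sub>R hamiltonian_vf SO H (z t)))) (at t within I)"
      by (rule has_derivative_in_compose)
    moreover have "f' (h *\<^sub>R hamiltonian_vf SO H (z t)) = 0" for h
      using linear_simps(5)[OF has_derivative_bounded_linear[OF f'(1)]] 0 by simp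
    ultimately show ?thesis by simp
  qed
  moreover have "convex I" using ic by (auto simp: integral_curve_def is_interval_convex)
  ultimately have "\<exists>c. \<forall>x\<in>I. f (z x) = c" by (intro has_derivative_zero_constant)
  then show "f (z s) = f (z t)" using st by auto
qed

subsection \<open>The integrals\<close>

lemma conj_skew: "X \<in> skew \<Longrightarrow> transpose A ** X ** A \<in> skew"
  for A X :: "real^'n^'n"
  by (simp add: skew_def matrix_transpose_mul matrix_mul_assoc mm.minus_left mm.minus_right)

lemma conj_skew': "X \<in> skew \<Longrightarrow> A ** X ** transpose A \<in> skew"
  for A X :: "real^'n^'n"
  using conj_skew[of X "transpose A"] by simp

lemma inner_conj: "(A ** X ** transpose A) \<bullet> Y = X \<bullet> (transpose A ** Y ** A)"
  for A X Y :: "real^'n^'n"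
  unfolding inner_mul_right[of "A ** X"] inner_mul_left[of A X] by (simp add: matrix_mul_assoc)

lemma cm_conj:
  assumes q: "q \<in> SO"
  shows "cm (transpose q ** P ** q) Y = transpose q ** cm P (q ** Y ** transpose q) ** q"
proof -
  have "transpose q ** P ** q ** Y = transpose q ** (P ** (q ** Y ** transpose q)) ** q"
    using SO_D(1)[OF q] by (simp add: matrix_mul_assoc SO_cancel[OF q])
  moreover have "Y ** (transpose q ** P ** q) = transpose q ** ((q ** Y ** transpose q) ** P) ** q"
    using SO_D(1)[OF q] by (simp add: matrix_mul_assoc SO_cancel[OF q])
  ultimately show ?thesis by (simp add: cm_def mm.diff_left mm.diff_right)
qed

definition right_int ::
  "('n::finite \<Rightarrow> real) \<Rightarrow> real \<times> real \<Rightarrow> (real^'n^'n) \<times> (real^'n^'n) \<Rightarrow> real" where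
  "right_int a z x = det (pencil a UNIV z (snd x ** transpose (fst x)))"

definition left_int ::
  "('n::finite \<Rightarrow> real) \<Rightarrow> real \<times> real \<Rightarrow> (real^'n^'n) \<times> (real^'n^'n) \<Rightarrow> real" where
  "left_int a z x = det (pencil a UNIV z (transpose (fst x) ** snd x))"

definition energy ::
  "'n \<Rightarrow> ('n::finite \<Rightarrow> real) \<Rightarrow> (real^'n^'n) \<times> (real^'n^'n) \<Rightarrow> real" where
  "energy f A x = 2 * (\<Sum>k\<in>UNIV - {f}. ((snd x ** transpose (fst x)) $ f $ k)\<^sup>2 / A k)"

lemma has_derivative_det_pencil:
  assumes "(N has_derivative N') (at x)"
  shows "((\<lambda>x. det (pencil a UNIV z (N x))) has_derivative
    (\<lambda>y. - snd z * ddet (pencil a UNIV z (N x)) (N' y))) (at x)"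
proof -
  have "((\<lambda>x. pencil a UNIV z (N x)) has_derivative (\<lambda>y. - snd z *\<^sub>R N' y)) (at x)"
    unfolding pencil_UNIV by (auto intro!: derivative_eq_intros assms)
  from has_derivative_compose[OF this has_derivative_det]
  have "((\<lambda>x. det (pencil a UNIV z (N x))) has_derivative
    (\<lambda>y. ddet (pencil a UNIV z (N x)) (- snd z *\<^sub>R N' y))) (at x)" .
  then show ?thesis by (simp only: linear_scale[OF linear_ddet] real_scaleR_def)
qed

lemma has_derivative_right_momentum:
  "((\<lambda>x. snd x ** transpose (fst x)) has_derivative
    (\<lambda>y. snd x ** transpose (fst y) + snd y ** transpose (fst x))) (at (x :: (real^'n^'n) \<times> (real^'n^'n)))"
  by (intro mm.FDERIV has_derivative_snd has_derivative_ident
      bounded_linear.has_derivative[OF bounded_linear_transpose] has_derivative_fst)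

lemma has_derivative_left_momentum:
  "((\<lambda>x. transpose (fst x) ** snd x) has_derivative
    (\<lambda>y. transpose (fst x) ** snd y + transpose (fst y) ** snd x)) (at (x :: (real^'n^'n) \<times> (real^'n^'n)))"
  by (intro mm.FDERIV has_derivative_snd has_derivative_ident
      bounded_linear.has_derivative[OF bounded_linear_transpose] has_derivative_fst)

lemma right_momentum_tangent:
  fixes P q R X :: "real^'n^'n"
  assumes q: "q \<in> SO" and X: "X \<in> skew"
  shows "(P ** q) ** transpose (X ** q) + (R ** q + P ** X ** q) ** transpose q = R"
proof -
  have "(P ** q) ** transpose (X ** q) = P ** transpose X"
    by (simp add: matrix_transpose_mul matrix_mul_assoc SO_cancel[OF q])
  also have "\<dots> = - (P ** X)" using X by (simp add: skew_def mm.minus_right)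
  finally have "(P ** q) ** transpose (X ** q) = - (P ** X)" .
  then show ?thesis by (simp add: mm.add_left SO_cancel[OF q])
qed

lemma left_momentum_tangent:
  fixes P q R X :: "real^'n^'n"
  assumes X: "X \<in> skew"
  shows "transpose q ** (R ** q + P ** X ** q) + transpose (X ** q) ** (P ** q) =
    transpose q ** (R + cm P X) ** q"
proof -
  have "transpose (X ** q) ** (P ** q) = - (transpose q ** X ** P ** q)"
    using X by (simp add: matrix_transpose_mul matrix_mul_assoc skew_def mm.minus_right mm.minus_left)
  then show ?thesis
    by (simp add: cm_def mm.add_left mm.add_right mm.diff_left mm.diff_right matrix_mul_assoc)
qed

lemma right_int_dual:
  fixes a :: "'n::finite \<Rightarrow> real" and P q :: "real^'n^'n"
  assumes q: "q \<in> SO" and P: "P \<in> skew"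
  shows "has_dual_differential (right_int a z) q P 0 (grad a z P)"
  unfolding has_dual_differential_def
proof (intro conjI exI ballI)
  show "(right_int a z has_derivative
    (\<lambda>y. - snd z * ddet (pencil a UNIV z P) ((P ** q) ** transpose (fst y) + snd y ** transpose q)))
    (at (q, P ** q) within TSO)"
    using has_derivative_at_withinI[OF has_derivative_det_pencil[OF has_derivative_right_momentum, of a z "(q, P ** q)"]]
    by (simp add: right_int_def[abs_def] SO_cancel[OF q])
next
  fix X R :: "real^'n^'n" assume "X \<in> skew" "R \<in> skew"
  then show "- snd z * ddet (pencil a UNIV z P) ((P ** q) ** transpose (fst (X ** q, R ** q + P ** X ** q)) +
    snd (X ** q, R ** q + P ** X ** q) ** transpose q) = 0 \<bullet> X + grad a z P \<bullet> R"
    unfolding fst_conv snd_conv right_momentum_tangent[OF q \<open>X \<in> skew\<close>] by (simp add: inner_grad)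
qed (auto simp: grad_skew subspace_0[OF subspace_skew])

text \<open>The left momentum moves by the conjugate of \<open>R + cm P X\<close>, which gives
  \<open>u = - cm P v\<close>. This is exactly the case in which the Hamiltonian vector field leaves
  \<open>P\<close> fixed; hence left integrals commute with every function of \<open>P\<close>, the
  energy included.\<close>

lemma left_int_dual:
  fixes a :: "'n::finite \<Rightarrow> real" and z :: "real \<times> real" and P q :: "real^'n^'n"
  assumes q: "q \<in> SO" and P: "P \<in> skew"
  defines "v \<equiv> q ** grad a z (transpose q ** P ** q) ** transpose q"
  shows "has_dual_differential (left_int a z) q P (- cm P v) v"
  unfolding has_dual_differential_def
proof (intro conjI exI ballI)
  show v: "v \<in> skew" unfolding v_def by (intro conj_skew' grad_skew)
  then show "- cm P v \<in> skew" by (intro subspace_neg[OF subspace_skew] cm_skew P)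
  show "(left_int a z has_derivative
    (\<lambda>y. - snd z * ddet (pencil a UNIV z (transpose q ** P ** q))
       (transpose q ** snd y + transpose (fst y) ** (P ** q)))) (at (q, P ** q) within TSO)"
    using has_derivative_at_withinI[OF has_derivative_det_pencil[OF has_derivative_left_momentum, of a z "(q, P ** q)"]]
    by (simp add: left_int_def[abs_def] matrix_mul_assoc)
  fix X R :: "real^'n^'n" assume XR: "X \<in> skew" "R \<in> skew"
  have sk: "transpose q ** (R + cm P X) ** q \<in> skew"
    by (intro conj_skew subspace_add[OF subspace_skew] XR cm_skew P)
  have "- snd z * ddet (pencil a UNIV z (transpose q ** P ** q)) (transpose q ** (R + cm P X) ** q) =
    v \<bullet> (R + cm P X)"
    unfolding v_def inner_conj inner_grad[OF sk] ..
  also have "\<dots> = - cm P v \<bullet> X + v \<bullet> R"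
    by (simp add: inner_add_right inner_cm_skew[OF P])
  finally show "- snd z * ddet (pencil a UNIV z (transpose q ** P ** q))
      (transpose q ** snd (X ** q, R ** q + P ** X ** q) +
       transpose (fst (X ** q, R ** q + P ** X ** q)) ** (P ** q)) = - cm P v \<bullet> X + v \<bullet> R"
    unfolding fst_conv snd_conv left_momentum_tangent[OF XR(1)] .
qed

text \<open>\<open>H\<close> need only agree with \<open>energy\<close> on the bundle: an arbitrary
  cometric is determined there and nowhere else.\<close>

lemma energy_dual:
  fixes A :: "'n::finite \<Rightarrow> real" and P q :: "real^'n^'n"
  assumes q: "q \<in> SO" and P: "P \<in> skew" and H: "\<And>x. x \<in> TSO \<Longrightarrow> H x = energy f A x"
  shows "has_dual_differential H q P 0 (energy_grad f A P)"
  unfolding has_dual_differential_def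
proof (intro conjI exI ballI)
  let ?M = "\<lambda>x :: (real^'n^'n) \<times> (real^'n^'n). snd x ** transpose (fst x)"
  let ?M' = "\<lambda>y. (P ** q) ** transpose (fst y) + snd y ** transpose q"
  have M: "((\<lambda>x. ?M x $ i $ j) has_derivative (\<lambda>y. ?M' y $ i $ j)) (at (q, P ** q))" for i j
    using bounded_linear.has_derivative[OF bounded_linear_compose[OF bounded_linear_vec_nth bounded_linear_vec_nth]
       has_derivative_right_momentum[of "(q, P ** q)"]] by simp
  have "(energy f A has_derivative
    (\<lambda>y. 4 * (\<Sum>k\<in>UNIV - {f}. P $ f $ k * ?M' y $ f $ k / A k))) (at (q, P ** q))"
    unfolding energy_def[abs_def] divide_inverse
    by (rule derivative_eq_intros M refl)+
      (simp add: SO_cancel[OF q] sum_distrib_left algebra_simps)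
  then show "(H has_derivative
    (\<lambda>y. 4 * (\<Sum>k\<in>UNIV - {f}. P $ f $ k * ?M' y $ f $ k / A k))) (at (q, P ** q) within TSO)"
    using q P by (intro has_derivative_transform[OF _ H has_derivative_at_withinI])
      (auto simp: cotangent_bundle_SO)
next
  fix X R :: "real^'n^'n" assume XR: "X \<in> skew" "R \<in> skew"
  show "4 * (\<Sum>k\<in>UNIV - {f}. P $ f $ k * ((P ** q) ** transpose (fst (X ** q, R ** q + P ** X ** q)) +
    snd (X ** q, R ** q + P ** X ** q) ** transpose q) $ f $ k / A k) = 0 \<bullet> X + energy_grad f A P \<bullet> R"
    unfolding fst_conv snd_conv right_momentum_tangent[OF q XR(1)] inner_energy_grad[OF P XR(2)] by simp
qed (auto simp: energy_grad_skew P subspace_0[OF subspace_skew])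

definition integrals :: "('n::finite \<Rightarrow> real) \<Rightarrow> ((real^'n^'n) \<times> (real^'n^'n) \<Rightarrow> real) set" where
  "integrals a = right_int a ` regular \<union> left_int a ` regular"

lemma integrals_commute:
  assumes "F \<in> integrals a" "F' \<in> integrals a" "x \<in> TSO"
  shows "poisson_bracket SO F F' x = 0"
proof -
  obtain q P where q: "q \<in> SO" and P: "P \<in> skew" and x: "x = (q, P ** q)"
    using assms(3) unfolding cotangent_bundle_SO by blast
  note R = right_int_dual[OF q P] and L = left_int_dual[OF q P]
  have sw: "v \<bullet> cm P w = - (cm P v \<bullet> w)" for v w using inner_cm_skew[OF P] by simp
  consider z z' where "z \<in> regular" "z' \<in> regular" "F = right_int a z" "F' = right_int a z'"
    | z z' where "z \<in> regular" "z' \<in> regular" "F = right_int a z" "F' = left_int a z'"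
    | z z' where "z \<in> regular" "z' \<in> regular" "F = left_int a z" "F' = right_int a z'"
    | z z' where "z \<in> regular" "z' \<in> regular" "F = left_int a z" "F' = left_int a z'"
    using assms(1,2) unfolding integrals_def by blast
  then show ?thesis
  proof cases
    case 1
    then show ?thesis unfolding x 1(3,4) poisson_bracket_dual[OF R R q P]
      by (simp add: sw grad_commute[OF P])
  next
    case 2
    then show ?thesis unfolding x 2(3,4) poisson_bracket_dual[OF R L q P] by simp
  next
    case 3
    then show ?thesis unfolding x 3(3,4) poisson_bracket_dual[OF L R q P]
      by (simp add: sw)
  next
    case 4
    let ?m = "transpose q ** P ** q"
    have m: "?m \<in> skew" by (rule conj_skew[OF P])
    \<comment> \<open>Conjugation by \<open>q\<close> carries the pairing at \<open>P\<close> to the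
      corresponding one at the left momentum, where \<open>grad_commute\<close> applies.\<close>
    have "cm P (q ** grad a z ?m ** transpose q) \<bullet> (q ** grad a z' ?m ** transpose q) =
      (q ** grad a z' ?m ** transpose q) \<bullet> cm P (q ** grad a z ?m ** transpose q)"
      by (rule inner_commute)
    also have "\<dots> = grad a z' ?m \<bullet> cm ?m (grad a z ?m)"
      unfolding inner_conj cm_conj[OF q] ..
    also have "\<dots> = 0" using grad_commute[OF m 4(1)] by (simp add: inner_commute)
    finally show ?thesis unfolding x 4(3,4) poisson_bracket_dual[OF L L q P] by simp
  qed
qed

lemma integrals_constant:
  assumes F: "F \<in> integrals (spectrum_shift f A)" and A: "\<And>k. k \<noteq> f \<Longrightarrow> A k \<noteq> 0"
    and H: "\<And>x. x \<in> TSO \<Longrightarrow> H x = energy f A x"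
  shows "constant_along_flow SO H F"
proof (rule constant_along_flowI)
  fix q P :: "real^'a^'a" assume q: "q \<in> SO" and P: "P \<in> skew"
  note E = energy_dual[OF q P H]
  have sw: "v \<bullet> cm P w = - (cm P v \<bullet> w)" for v w using inner_cm_skew[OF P] by simp
  let ?a = "spectrum_shift f A"
  consider z where "z \<in> regular" "F = right_int ?a z" | z where "z \<in> regular" "F = left_int ?a z"
    using F unfolding integrals_def by blast
  then show "\<exists>u v u' v'. has_dual_differential F q P u v \<and> has_dual_differential H q P u' v' \<and>
    u \<bullet> v' + v \<bullet> (- u' - cm P v') = 0"
  proof cases
    case 1
    have "0 \<bullet> energy_grad f A P + grad ?a z P \<bullet> (- 0 - cm P (energy_grad f A P)) = 0"
      by (simp add: sw grad_energy_commute[OF P A 1(1)])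
    then show ?thesis using right_int_dual[OF q P] E 1(2) by blast
  next
    case 2
    have "- cm P v \<bullet> energy_grad f A P + v \<bullet> (- 0 - cm P (energy_grad f A P)) = 0" for v
      by (simp add: sw)
    then show ?thesis using left_int_dual[OF q P] E 2(2) by blast
  qed
qed

lemma real_polynomial_function_det_pencil:
  assumes "\<And>i j. real_polynomial_function (\<lambda>x. N x $ i $ j)"
  shows "real_polynomial_function (\<lambda>x. det (pencil a S z (N x)))"
  by (rule real_polynomial_function_det)
    (auto simp: pencil_def intro!: real_polynomial_function_diff real_polynomial_function.intros(2)
      real_polynomial_function.intros(4) assms)

lemma real_polynomial_function_fst_snd_entry:
  "real_polynomial_function (\<lambda>x :: (real^'n^'n) \<times> (real^'n^'n). fst x $ i $ j)"
  "real_polynomial_function (\<lambda>x :: (real^'n^'n) \<times> (real^'n^'n). snd x $ i $ j)"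
  by (intro real_polynomial_function.intros(1)
      bounded_linear_compose[OF bounded_linear_compose[OF bounded_linear_vec_nth bounded_linear_vec_nth]]
      bounded_linear_fst bounded_linear_snd)+

lemma integrals_smooth:
  assumes "F \<in> integrals a"
  shows "smooth_function S F"
proof -
  have "real_polynomial_function (right_int a z)" "real_polynomial_function (left_int a z)" for z
    unfolding right_int_def[abs_def] left_int_def[abs_def]
    by (intro real_polynomial_function_det_pencil; simp add: matrix_matrix_mult_def transpose_def;
      intro real_polynomial_function_sum real_polynomial_function.intros(4)
        real_polynomial_function_fst_snd_entry finite)+
  then have "polynomial_function F"
    using assms unfolding integrals_def real_polynomial_function_eq by blast
  then show ?thesis by (rule smooth_function_polynomial)
qed

lemma sum_lessThan_add: "(\<Sum>i<m + n. f i) = (\<Sum>i<m. f i) + (\<Sum>i<n. f (m + i :: nat) :: real)"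
  by (induction n) (auto simp: add.assoc)

lemma differential_right_int:
  assumes "q \<in> SO" "P \<in> skew" "X \<in> skew" "R \<in> skew"
  shows "differential TSO (right_int a z) (q, P ** q) (X ** q, R ** q + P ** X ** q) =
    - snd z * ddet (pencil a UNIV z P) R"
  unfolding differential_dual[OF right_int_dual[OF assms(1,2)] assms] inner_grad[OF assms(4)] by simp

lemma differential_left_int:
  assumes "q \<in> SO" and P: "P \<in> skew" and "X \<in> skew" "R \<in> skew"
  shows "differential TSO (left_int a z) (q, P ** q) (X ** q, R ** q + P ** X ** q) =
    - snd z * ddet (pencil a UNIV z (transpose q ** P ** q)) (transpose q ** (R + cm P X) ** q)"
proof -
  have sk: "transpose q ** (R + cm P X) ** q \<in> skew"
    by (intro conj_skew subspace_add[OF subspace_skew] assms cm_skew P)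
  let ?v = "q ** grad a z (transpose q ** P ** q) ** transpose q"
  have "- cm P ?v \<bullet> X + ?v \<bullet> R = ?v \<bullet> (R + cm P X)"
    by (simp add: inner_add_right inner_cm_skew[OF P])
  also have "\<dots> = - snd z * ddet (pencil a UNIV z (transpose q ** P ** q)) (transpose q ** (R + cm P X) ** q)"
    unfolding inner_conj inner_grad[OF sk] ..
  finally show ?thesis
    unfolding differential_dual[OF left_int_dual[OF assms(1,2)] assms] .
qed

text \<open>The tangent vectors with \<open>R = 0\<close> are annihilated by the right integrals, and on them the
  differentials of the left integrals are evaluated in the directions \<open>cm Y m\<close> of the
  coadjoint orbit of \<open>m\<close>.\<close>

lemma integrals_independent_at:
  fixes a :: "'n::finite \<Rightarrow> real"
  assumes q: "q \<in> SO" and P: "P \<in> skew"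
    and h: "inj_on h {..<N}" "h ` {..<N} \<subseteq> regular"
    and h': "inj_on h' {..<N'}" "h' ` {..<N'} \<subseteq> regular"
    and ind: "indep_funs (h ` {..<N}) skew (\<lambda>z X. ddet (pencil a UNIV z P) X)"
    and ind': "indep_funs (h' ` {..<N'}) skew (\<lambda>z Y. ddet (pencil a UNIV z (transpose q ** P ** q))
      (cm Y (transpose q ** P ** q)))"
  shows "independent_at TSO (N + N') (\<lambda>i. if i < N then right_int a (h i) else left_int a (h' (i - N)))
    (q, P ** q)"
  unfolding independent_at_def
proof (intro allI impI)
  let ?m = "transpose q ** P ** q"
  fix c i
  assume c: "\<forall>v\<in>tangent_space TSO (q, P ** q). (\<Sum>i<N + N'. c i * differential TSO
    (if i < N then right_int a (h i) else left_int a (h' (i - N))) (q, P ** q) v) = 0" and i: "i < N + N'"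
  have sum: "(\<Sum>i<N. c i * (- snd (h i) * ddet (pencil a UNIV (h i) P) R)) +
    (\<Sum>j<N'. c (N + j) * (- snd (h' j) * ddet (pencil a UNIV (h' j) ?m) (transpose q ** (R + cm P X) ** q))) = 0"
    if XR: "X \<in> skew" "R \<in> skew" for X R
  proof -
    have "(X ** q, R ** q + P ** X ** q) \<in> tangent_space TSO (q, P ** q)"
      unfolding tangent_space_TSO[OF q P] using XR by blast
    from c[rule_format, OF this] show ?thesis
      unfolding sum_lessThan_add
      by (simp add: differential_right_int[OF q P XR] differential_left_int[OF q P XR])
  qed
  have left: "c (N + j) = 0" if j: "j < N'" for j
  proof -
    have "c (N + j) * - snd (h' j) = 0"
    proof (rule indep_funsD[where c = "\<lambda>j. c (N + j) * - snd (h' j)"])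
      show "indep_funs {..<N'} skew (\<lambda>j Y. ddet (pencil a UNIV (h' j) ?m) (cm Y ?m))"
        by (rule iffD1[OF indep_funs_image[OF h'(1)] ind'])
      fix Y :: "real^'n^'n" assume Y: "Y \<in> skew"
      \<comment> \<open>With \<open>R = 0\<close> the left momentum then moves in the direction
        \<open>cm Y ?m\<close>; the minus sign compensates the order of the commutator.\<close>
      define X where "X = - (q ** Y ** transpose q)"
      have X: "X \<in> skew" unfolding X_def using Y by (intro subspace_neg[OF subspace_skew] conj_skew')
      have "transpose q ** (0 + cm P X) ** q = - cm ?m Y"
        unfolding cm_conj[OF q] X_def by (simp add: cm.minus_right mm.minus_left mm.minus_right)
      also have "\<dots> = cm Y ?m" using cm_commute[of Y ?m] by simp
      finally have eq: "transpose q ** (0 + cm P X) ** q = cm Y ?m" .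
      show "(\<Sum>j<N'. c (N + j) * - snd (h' j) * ddet (pencil a UNIV (h' j) ?m) (cm Y ?m)) = 0"
        using sum[OF X subspace_0[OF subspace_skew]] unfolding eq linear_0[OF linear_ddet]
        by (simp add: mult.assoc)
    qed (use j in auto)
    moreover have "snd (h' j) \<noteq> 0" using h'(2) j by (auto simp: regular_def)
    ultimately show ?thesis by simp
  qed
  have right: "c i = 0" if i: "i < N" for i
  proof -
    have "c i * - snd (h i) = 0"
    proof (rule indep_funsD[where c = "\<lambda>i. c i * - snd (h i)"])
      show "indep_funs {..<N} skew (\<lambda>i X. ddet (pencil a UNIV (h i) P) X)"
        by (rule iffD1[OF indep_funs_image[OF h(1)] ind])
      fix R :: "real^'n^'n" assume R: "R \<in> skew"
      show "(\<Sum>i<N. c i * - snd (h i) * ddet (pencil a UNIV (h i) P) R) = 0"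
        using sum[OF subspace_0[OF subspace_skew] R] left by (simp add: mult.assoc)
    qed (use i in auto)
    moreover have "snd (h i) \<noteq> 0" using h(2) i by (auto simp: regular_def)
    ultimately show ?thesis by simp
  qed
  show "c i = 0"
  proof (cases "i < N")
    case False
    then show ?thesis using left[of "i - N"] i by simp
  qed (rule right)
qed

text \<open>It suffices to move \<open>P\<close> with \<open>q\<close> fixed. Conjugation by
  \<open>q\<close> maps the skew matrices onto themselves, so both conditions are nonvanishing of
  polynomials in \<open>P\<close> that have a nonzero value on that subspace.\<close>

lemma generic_set_dense:
  fixes D D' :: "real^'n^'n \<Rightarrow> real"
  assumes D: "real_polynomial_function D" "\<exists>M\<in>skew. D M \<noteq> 0"
    and D': "real_polynomial_function D'" "\<exists>M\<in>skew. D' M \<noteq> 0"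
  defines "U \<equiv> {x \<in> TSO. D (snd x ** transpose (fst x)) \<noteq> 0 \<and> D' (transpose (fst x) ** snd x) \<noteq> 0}"
  shows "openin (top_of_set TSO) U" "TSO \<subseteq> closure U"
proof -
  have cont: "continuous_on UNIV D" "continuous_on UNIV D'"
    using D(1) D'(1) by (auto intro!: continuous_on_polymonial_function simp: real_polynomial_function_eq)
  have m: "continuous_on UNIV (\<lambda>x :: (real^'n^'n) \<times> (real^'n^'n). snd x ** transpose (fst x))"
    "continuous_on UNIV (\<lambda>x :: (real^'n^'n) \<times> (real^'n^'n). transpose (fst x) ** snd x)"
    by (intro mm.continuous_on bounded_linear.continuous_on[OF bounded_linear_transpose]
        continuous_on_fst continuous_on_snd continuous_on_id)+
  have "continuous_on UNIV (\<lambda>x :: (real^'n^'n) \<times> (real^'n^'n). D (snd x ** transpose (fst x)))"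
    "continuous_on UNIV (\<lambda>x :: (real^'n^'n) \<times> (real^'n^'n). D' (transpose (fst x) ** snd x))"
    by (rule continuous_on_compose2[OF cont(1) m(1) subset_UNIV]
        continuous_on_compose2[OF cont(2) m(2) subset_UNIV])+
  then have "open {x :: (real^'n^'n) \<times> (real^'n^'n). D (snd x ** transpose (fst x)) \<noteq> 0}"
    "open {x :: (real^'n^'n) \<times> (real^'n^'n). D' (transpose (fst x) ** snd x) \<noteq> 0}"
    by (auto intro!: open_Collect_neq continuous_on_const)
  then have "open ({x :: (real^'n^'n) \<times> (real^'n^'n). D (snd x ** transpose (fst x)) \<noteq> 0} \<inter>
      {x. D' (transpose (fst x) ** snd x) \<noteq> 0})"
    by (rule open_Int)
  moreover have "U = TSO \<inter> ({x. D (snd x ** transpose (fst x)) \<noteq> 0} \<inter> {x. D' (transpose (fst x) ** snd x) \<noteq> 0})"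
    unfolding U_def by blast
  ultimately show "openin (top_of_set TSO) U" unfolding openin_open by blast
  show "TSO \<subseteq> closure U"
  proof
    fix x :: "(real^'n^'n) \<times> (real^'n^'n)" assume "x \<in> TSO"
    then obtain q P where q: "q \<in> SO" and P: "P \<in> skew" and x: "x = (q, P ** q)"
      unfolding cotangent_bundle_SO by blast
    obtain M M' where M: "M \<in> skew" "D M \<noteq> 0" "M' \<in> skew" "D' M' \<noteq> 0" using D(2) D'(2) by blast
    let ?g = "\<lambda>P. D' (transpose q ** P ** q)"
    have "polynomial_function (\<lambda>P. transpose q ** P ** q)"
      by (intro polynomial_function_bounded_linear bounded_linear_compose[OF mm.bounded_linear_left]
          mm.bounded_linear_right)
    from real_polynomial_function_compose[OF this D'(1)]
    have g: "real_polynomial_function ?g" by (simp add: o_def)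
    have "transpose q ** (q ** M' ** transpose q) ** q = M'"
      using SO_D(1)[OF q] by (simp add: matrix_mul_assoc SO_cancel[OF q])
    then have gM: "?g (q ** M' ** transpose q) \<noteq> 0" using M(4) by simp
    show "x \<in> closure U"
      unfolding closure_approachable
    proof (intro allI impI)
      fix e :: real assume e: "e > 0"
      obtain R where R: "R \<in> skew" "dist R P < e" "D R \<noteq> 0" "?g R \<noteq> 0"
        using real_polynomial_function_nonzero_near2[OF D(1) M(2,1) g gM conj_skew'[OF M(3)] subspace_skew P e]
        by blast
      have "norm ((R - P) ** q) = norm (R - P)"
        unfolding norm_eq_sqrt_inner inner_mul_SO[OF q] ..
      then have "dist (q, R ** q) x < e"
        using R(2) by (simp add: x dist_Pair_Pair dist_norm mm.diff_left)
      moreover have "(q, R ** q) \<in> U"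
        using R q by (auto simp: U_def cotangent_bundle_SO SO_cancel[OF q] matrix_mul_assoc)
      ultimately show "\<exists>y\<in>U. dist y x < e" by blast
    qed
  qed
qed

subsection \<open>Dimensions and the cometric\<close>

lemma inner_skew_elem:
  assumes "i \<noteq> j"
  shows "X \<bullet> skew_elem i j = X $ i $ j - X $ j $ i"
proof -
  have "X \<bullet> skew_elem i j = (\<Sum>(k, l)\<in>UNIV \<times> UNIV. X $ k $ l * skew_elem i j $ k $ l)"
    by (simp add: inner_matrix_sum sum.cartesian_product)
  also have "\<dots> = (\<Sum>(k, l)\<in>{(i, j), (j, i)}. X $ k $ l * skew_elem i j $ k $ l)"
    by (intro sum.mono_neutral_right) (auto simp: skew_elem_def split: if_splits)
  also have "\<dots> = X $ i $ j - X $ j $ i" using assms by (simp add: skew_elem_def)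
  finally show ?thesis .
qed

lemma dim_skew: "dim (skew :: (real^'n^'n) set) = CARD('n) * (CARD('n) - 1) div 2"
proof -
  \<comment> \<open>The index type carries no order; \<open>e\<close> supplies one, so that each
    unordered pair of distinct indices is taken exactly once.\<close>
  obtain e :: "'n \<Rightarrow> nat" where e: "inj e"
    using finite_imp_inj_to_nat_seg[of "UNIV :: 'n set"] by auto
  define I where "I = {(i, j). e i < e j}"
  define B where "B = (\<lambda>(i, j). skew_elem i j) ` I"
  have I: "i \<noteq> j" "(j, i) \<notin> I" if "(i, j) \<in> I" for i j using that by (auto simp: I_def)
  have in_skew: "B \<subseteq> skew" using I by (auto simp: B_def intro!: skew_elem_skew)
  have val: "skew_elem i j \<bullet> skew_elem k l = (if (k, l) = (i, j) then 2 else 0)"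
    if "(i, j) \<in> I" "(k, l) \<in> I" for i j k l
    unfolding inner_skew_elem[OF I(1)[OF that(2)]]
    using I[OF that(1)] I[OF that(2)] that by (auto simp: skew_elem_def)
  have inj: "inj_on (\<lambda>(i, j). skew_elem i j) I"
  proof (rule inj_onI; clarify)
    fix i j k l assume *: "(i, j) \<in> I" "(k, l) \<in> I" "skew_elem i j = skew_elem k l"
    then show "i = k \<and> j = l" using val[OF *(1,2)] val[OF *(1,1)] by (auto split: if_splits)
  qed
  have "independent B"
  proof (rule pairwise_orthogonal_independent)
    show "pairwise orthogonal B"
      unfolding pairwise_def orthogonal_def B_def using val by auto
    show "0 \<notin> B" using val by (force simp: B_def)
  qed
  moreover have "skew \<subseteq> span B"
  proof
    fix X :: "real^'n^'n" assume X: "X \<in> skew"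
    obtain y z where yz: "y \<in> span B" "\<And>w. w \<in> span B \<Longrightarrow> orthogonal z w" "X = y + z"
      using orthogonal_subspace_decomp_exists by metis
    have "y \<in> skew" using span_minimal[OF in_skew subspace_skew] yz(1) by blast
    then have z: "z \<in> skew" using subspace_diff[OF subspace_skew X, of y] yz(3) by simp
    have zij: "z $ i $ j = 0" if "(i, j) \<in> I" for i j
    proof -
      have "skew_elem i j \<in> span B" using that by (auto simp: B_def intro!: span_base)
      then have "z \<bullet> skew_elem i j = 0" using yz(2) by (simp add: orthogonal_def)
      then show ?thesis using skew_nth[OF z, of j i] I[OF that] by (simp add: inner_skew_elem)
    qed
    have "z $ i $ j = 0" for i j
    proof -
      consider "(i, j) \<in> I" | "(j, i) \<in> I" | "i = j"
        using e unfolding I_def inj_def by (metis case_prodI mem_Collect_eq nat_neq_iff)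
      then show ?thesis using zij skew_nth[OF z, of i j] skew_diag[OF z] by cases auto
    qed
    then have "z = 0" by (simp add: vec_eq_iff)
    then show "X \<in> span B" using yz by simp
  qed
  ultimately have "dim (skew :: (real^'n^'n) set) = card B"
    using in_skew by (intro dim_unique[of B]) auto
  also have "card B = card I" unfolding B_def by (rule card_image[OF inj])
  also have "card I = CARD('n) * (CARD('n) - 1) div 2"
  proof -
    have U: "UNIV = (I \<union> prod.swap ` I) \<union> (\<lambda>i. (i, i)) ` UNIV"
    proof -
      have "(i, j) \<in> (I \<union> prod.swap ` I) \<union> (\<lambda>i. (i, i)) ` UNIV" for i j
        using e by (cases "e i" "e j" rule: linorder_cases) (force simp: I_def inj_def)+
      then have "x \<in> (I \<union> prod.swap ` I) \<union> (\<lambda>i. (i, i)) ` UNIV" for x by (metis surj_pair)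
      then show ?thesis by blast
    qed
    have fin: "finite S" for S :: "('n \<times> 'n) set" by simp
    have "card (I \<union> prod.swap ` I) = card I + card (prod.swap ` I)"
      by (rule card_Un_disjoint[OF fin fin]) (auto simp: I_def)
    moreover have "card ((I \<union> prod.swap ` I) \<union> (\<lambda>i. (i, i)) ` (UNIV :: 'n set)) =
      card (I \<union> prod.swap ` I) + card ((\<lambda>i. (i, i)) ` (UNIV :: 'n set))"
      by (rule card_Un_disjoint[OF fin fin]) (auto simp: I_def)
    ultimately have "card (UNIV :: ('n \<times> 'n) set) = card I + card (prod.swap ` I) + card ((\<lambda>i. (i, i)) ` (UNIV :: 'n set))"
      using U by simp
    also have "\<dots> = 2 * card I + CARD('n)"
      using card_image[OF inj_on_subset[OF inj_swap subset_UNIV], of I] by (simp add: card_image inj_on_def)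
    finally have "2 * card I + CARD('n) = CARD('n) * CARD('n)" by simp
    then show ?thesis by (cases "CARD('n)") auto
  qed
  finally show ?thesis .
qed

lemma dim_mul_SO:
  fixes q :: "real^'n^'n" and V :: "(real^'n^'n) set"
  assumes "q \<in> SO"
  shows "dim ((\<lambda>X. X ** q) ` V) = dim V"
proof (rule dim_image_eq)
  show "linear (\<lambda>X :: real^'n^'n. X ** q)" by (rule bounded_linear.linear[OF mm.bounded_linear_left])
  show "inj_on (\<lambda>X. X ** q) (span V)"
    by (rule inj_on_inverseI[of _ "\<lambda>Y. Y ** transpose q"]) (simp add: SO_cancel[OF assms])
qed

lemma dim_tangent_space_SO:
  fixes q :: "real^'n^'n"
  assumes "q \<in> SO"
  shows "dim (tangent_space SO q) = CARD('n) * (CARD('n) - 1) div 2"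
proof -
  have "tangent_space SO q = (\<lambda>X. X ** q) ` skew" unfolding tangent_space_SO[OF assms] by blast
  then show ?thesis using dim_mul_SO[OF assms] dim_skew by metis
qed

section \<open>The cometric and its uniqueness\<close>

definition cometric ::
  "'n::finite \<Rightarrow> ('n \<Rightarrow> real) \<Rightarrow> real^'n^'n \<Rightarrow> real^'n^'n \<Rightarrow> real^'n^'n" where
  "cometric f A q p = energy_grad f A (p ** transpose q) ** q"

lemma energy_grad_linear:
  "energy_grad f A (a *\<^sub>R P + b *\<^sub>R R) = a *\<^sub>R energy_grad f A P + b *\<^sub>R energy_grad f A R"
  by (auto simp: energy_grad_def vec_eq_iff add_divide_distrib algebra_simps)

lemma polynomial_function_matrix:
  assumes "\<And>i j. real_polynomial_function (\<lambda>x. F x $ i $ j)"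
  shows "polynomial_function (F :: _ \<Rightarrow> real^'n^'m)"
  unfolding polynomial_function_iff_Basis_inner
  using assms by (auto simp: Basis_vec_def inner_axis)

lemma first_row_distribution_eq:
  fixes A :: "'n::finite \<Rightarrow> real"
  assumes A: "\<And>k. k \<noteq> f \<Longrightarrow> A k > 0"
  shows "first_row_distribution f q = (\<lambda>P. energy_grad f A P ** q) ` skew"
proof (intro equalityI subsetI)
  fix v assume "v \<in> first_row_distribution f q"
  then obtain W where W: "W \<in> skew" "\<And>k l. k \<noteq> f \<Longrightarrow> l \<noteq> f \<Longrightarrow> W $ k $ l = 0" "v = W ** q"
    unfolding first_row_distribution_def skew_def by blast
  \<comment> \<open>The inverse of \<open>energy_grad\<close> on first-row matrices. The factor 1/2
    reflects that the ambient inner product counts each entry of a skew matrix twice.\<close>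
  define P where "P = (\<chi> i j. if i = f \<and> j \<noteq> f then A j * W $ f $ j / 2
    else if j = f \<and> i \<noteq> f then A i * W $ i $ f / 2 else 0)"
  have "P $ i $ j = - P $ j $ i" for i j
    using skew_nth[OF W(1), of i f] skew_nth[OF W(1), of f j]
    by (cases "i = f"; cases "j = f") (simp_all add: P_def)
  then have P: "P \<in> skew" unfolding skew_iff by blast
  have "energy_grad f A P $ i $ j = W $ i $ j" for i j
    using A[of i] A[of j] W(2)[of i j] skew_diag[OF W(1), of f]
    by (cases "i = f"; cases "j = f") (simp_all add: P_def energy_grad_def)
  then have "energy_grad f A P = W" by (simp add: vec_eq_iff)
  then show "v \<in> (\<lambda>P. energy_grad f A P ** q) ` skew" using P W(3) by blast
next
  fix v assume "v \<in> (\<lambda>P. energy_grad f A P ** q) ` skew"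
  then obtain P where "P \<in> skew" "v = energy_grad f A P ** q" by blast
  moreover have "energy_grad f A P $ k $ l = 0" if "k \<noteq> f" "l \<noteq> f" for k l
    using that by (simp add: energy_grad_def)
  ultimately show "v \<in> first_row_distribution f q"
    unfolding first_row_distribution_def using energy_grad_skew[of P f A] skew_def by blast
qed

lemma length_inner_first_row:
  fixes A :: "'n::finite \<Rightarrow> real"
  assumes q: "q \<in> SO" and A: "\<And>k. k \<noteq> f \<Longrightarrow> A k > 0"
  shows "length_inner (first_row_length f A) q (V ** q) (W ** q) =
    (\<Sum>k\<in>UNIV - {f}. A k * (V $ f $ k * W $ f $ k))"
proof -
  have sq: "(first_row_length f A q (V ** q))\<^sup>2 = (\<Sum>k\<in>UNIV - {f}. A k * (V $ f $ k)\<^sup>2)" for V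
  proof -
    have "0 \<le> A k * (V $ f $ k)\<^sup>2" if "k \<in> UNIV - {f}" for k
      using A[of k] that by simp
    then have "0 \<le> (\<Sum>k\<in>UNIV - {f}. A k * (V $ f $ k)\<^sup>2)" by (rule sum_nonneg)
    then show ?thesis unfolding first_row_length_def SO_cancel[OF q] by simp
  qed
  show ?thesis
    unfolding length_inner_def mm.add_left[symmetric] sq
    by (simp add: sum_subtractf[symmetric] sum_divide_distrib power2_eq_square algebra_simps add_divide_distrib)
qed

lemma cometric_pairing:
  assumes q: "q \<in> SO" and P: "P \<in> skew" and R: "R \<in> skew"
  shows "(P ** q) \<bullet> cometric f A q (R ** q) = 4 * (\<Sum>k\<in>UNIV - {f}. R $ f $ k * P $ f $ k / A k)"
  unfolding cometric_def SO_cancel[OF q] inner_mul_SO[OF q] inner_commute[of P]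
  by (rule inner_energy_grad[OF R P])

lemma is_cometric_cometric:
  fixes A :: "'n::finite \<Rightarrow> real"
  assumes A: "\<And>k. k \<noteq> f \<Longrightarrow> A k > 0"
  shows "is_cometric SO (first_row_distribution f) (first_row_length f A) (cometric f A)"
  unfolding is_cometric_def
proof (intro conjI ballI allI)
  have m: "real_polynomial_function (\<lambda>x :: (real^'n^'n) \<times> (real^'n^'n). (snd x ** transpose (fst x)) $ i $ j)" for i j
    unfolding matrix_matrix_mult_def transpose_def vec_lambda_beta
    by (intro real_polynomial_function_sum real_polynomial_function.intros(4)
        real_polynomial_function_fst_snd_entry finite)
  have "real_polynomial_function (\<lambda>x :: (real^'n^'n) \<times> (real^'n^'n).
    energy_grad f A (snd x ** transpose (fst x)) $ i $ j)" for i j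
    unfolding energy_grad_def divide_inverse
    by (cases "i = f"; cases "j = f") (auto intro!: real_polynomial_function.intros(4) real_polynomial_function.intros(2) m)
  then have "polynomial_function (\<lambda>x. cometric f A (fst x) (snd x))"
    unfolding cometric_def
    by (intro polynomial_function_matrix; subst matrix_matrix_mult_def; simp only: vec_lambda_beta;
      intro real_polynomial_function_sum real_polynomial_function.intros(4)
        real_polynomial_function_fst_snd_entry finite)
  then show "smooth_function TSO (\<lambda>(q, p). cometric f A q p)"
    unfolding case_prod_beta by (rule smooth_function_polynomial)
  fix q :: "real^'n^'n" assume q: "q \<in> SO"
  note T = tangent_space_SO[OF q]
  show im: "cometric f A q ` tangent_space SO q = first_row_distribution f q"
  proof -
    have "cometric f A q ` tangent_space SO q = (\<lambda>P. cometric f A q (P ** q)) ` skew"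
      unfolding T by blast
    also have "\<dots> = first_row_distribution f q"
      by (subst first_row_distribution_eq[where A = A and f = f])
        (simp_all add: A cometric_def SO_cancel[OF q])
    finally show ?thesis .
  qed
  fix p1 p2 assume "p1 \<in> tangent_space SO q" "p2 \<in> tangent_space SO q"
  then obtain P R where P: "P \<in> skew" "p1 = P ** q" and R: "R \<in> skew" "p2 = R ** q"
    unfolding T by blast
  show "cometric f A q (a *\<^sub>R p1 + b *\<^sub>R p2) = a *\<^sub>R cometric f A q p1 + b *\<^sub>R cometric f A q p2" for a b
    unfolding cometric_def by (simp add: mm.add_left mm.scaleR_left energy_grad_linear)
  show "p1 \<bullet> cometric f A q p2 = p2 \<bullet> cometric f A q p1"
    unfolding P(2) R(2) cometric_pairing[OF q P(1) R(1)] cometric_pairing[OF q R(1) P(1)]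
    by (simp add: mult.commute)
  have "A k * (energy_grad f A P $ f $ k * energy_grad f A R $ f $ k) = 4 * (R $ f $ k * P $ f $ k / A k)"
    if "k \<in> UNIV - {f}" for k
    using A[of k] that by (simp add: energy_grad_def field_simps)
  then show "length_inner (first_row_length f A) q (cometric f A q p1) (cometric f A q p2) =
      p1 \<bullet> cometric f A q p2"
    unfolding P(2) R(2) cometric_pairing[OF q P(1) R(1)]
    unfolding cometric_def SO_cancel[OF q]
    by (subst length_inner_first_row[OF q]) (simp_all add: A sum_distrib_left)
next
  have eq: "cometric f A q ` tangent_space SO q = (\<lambda>X. X ** q) ` energy_grad f A ` skew" if q: "q \<in> SO" for q :: "real^'n^'n"
    unfolding tangent_space_SO[OF q] cometric_def by (force simp: SO_cancel[OF q])
  show "\<exists>r. \<forall>q\<in>SO. dim (cometric f A q ` tangent_space SO q) = r"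
    using dim_mul_SO by (metis eq)
qed

text \<open>Both maps have the image \<open>D q\<close>, so b' p = b p1 and b p = b' p2 for some p1
  and p2. The inner product of b' p and b p, evaluated through \<open>b\<close> and through
  \<open>b'\<close>, gives the two sides. Equality of the quadratic forms is enough to determine the
  Hamiltonian.\<close>

lemma cometric_unique:
  assumes b: "is_cometric Q D len b" and b': "is_cometric Q D len b'"
    and q: "q \<in> Q" and p: "p \<in> tangent_space Q q"
  shows "p \<bullet> b q p = p \<bullet> b' q p"
proof -
  have im: "b q ` tangent_space Q q = b' q ` tangent_space Q q"
    using b b' q unfolding is_cometric_def by metis
  have sym: "x \<bullet> c q y = y \<bullet> c q x" and len: "length_inner len q (c q x) (c q y) = x \<bullet> c q y"
    if "is_cometric Q D len c" "x \<in> tangent_space Q q" "y \<in> tangent_space Q q" for c x y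
    using that q by (simp_all add: is_cometric_def)
  obtain p1 where p1: "p1 \<in> tangent_space Q q" "b q p1 = b' q p" using im p by (metis imageE imageI)
  obtain p2 where p2: "p2 \<in> tangent_space Q q" "b' q p2 = b q p" using im p by (metis imageE imageI)
  have "p \<bullet> b' q p = length_inner len q (b q p1) (b q p)"
    using len[OF b p1(1) p] sym[OF b p1(1) p] p1(2) by simp
  also have "\<dots> = p \<bullet> b q p"
    using len[OF b' p p2(1)] sym[OF b' p p2(1)] p1(2) p2(2) sym[OF b' p2(1) p] by simp
  finally show ?thesis by simp
qed

lemma energy_eq:
  assumes "is_cometric SO (first_row_distribution f) (first_row_length f A) b"
    and A: "\<And>k. k \<noteq> f \<Longrightarrow> A k > 0" and x: "x \<in> TSO"
  shows "(case x of (q, p) \<Rightarrow> (p \<bullet> b q p) / 2) = energy f A x"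
proof -
  obtain q P where q: "q \<in> SO" and P: "P \<in> skew" and x: "x = (q, P ** q)"
    using x unfolding cotangent_bundle_SO by blast
  have "P ** q \<in> tangent_space SO q" unfolding tangent_space_SO[OF q] using P by blast
  moreover have "is_cometric SO (first_row_distribution f) (first_row_length f A) (cometric f A)"
    by (rule is_cometric_cometric) (rule A)
  ultimately have "(P ** q) \<bullet> b q (P ** q) = (P ** q) \<bullet> cometric f A q (P ** q)"
    using cometric_unique[OF assms(1) _ q] by blast
  then have "(P ** q) \<bullet> b q (P ** q) = 4 * (\<Sum>k\<in>UNIV - {f}. P $ f $ k * P $ f $ k / A k)"
    unfolding cometric_pairing[OF q P P] .
  then show ?thesis
    by (simp add: x energy_def SO_cancel[OF q] power2_eq_square)
qed

theorem theorem1: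
  fixes first :: "'n::finite" and A :: "'n \<Rightarrow> real"
  assumes "CARD('n) \<ge> 2"
    and "\<And>k. k \<noteq> first \<Longrightarrow> A k > 0"
    and "inj_on A (UNIV - {first})"
  shows "defines_integrable_system (SO :: (real^'n^'n) set) (CARD('n) * (CARD('n) - 1) div 2)
           (first_row_distribution first) (first_row_length first A)"
  unfolding defines_integrable_system_def
proof (intro conjI allI impI)
  show "\<exists>\<beta>. is_cometric (SO :: (real^'n^'n) set) (first_row_distribution first) (first_row_length first A) \<beta>"
    by (rule exI, rule is_cometric_cometric) (rule assms(2))
  fix \<beta> assume b: "is_cometric (SO :: (real^'n^'n) set) (first_row_distribution first) (first_row_length first A) \<beta>"
  let ?H = "\<lambda>(q, p). (p \<bullet> \<beta> q p) / 2"
  let ?d = "CARD('n) * (CARD('n) - 1) div 2"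
  define a where "a = spectrum_shift first A"
  have a: "inj a" "\<And>i. a i \<noteq> 0"
  proof -
    show "a i \<noteq> 0" for i
      using assms(2)[of i] by (cases "i = first") (simp_all add: a_def spectrum_shift_def)
    show "inj a"
    proof (rule injI)
      fix i j assume "a i = a j"
      then show "i = j"
        using assms(2)[of i] assms(2)[of j] inj_onD[OF assms(3), of i j]
        by (auto simp: a_def spectrum_shift_def split: if_splits)
    qed
  qed
  obtain P P' and D D' :: "real^'n^'n \<Rightarrow> real" where P: "finite P" "finite P'" "P \<subseteq> regular" "P' \<subseteq> regular"
    and card: "card P + card P' = ?d"
    and D: "real_polynomial_function D" "real_polynomial_function D'"
      "\<exists>M\<in>skew. D M \<noteq> 0" "\<exists>M\<in>skew. D' M \<noteq> 0"
      "\<And>M. D M \<noteq> 0 \<Longrightarrow> indep_funs P skew (\<lambda>z X. ddet (pencil a UNIV z M) X)"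
      "\<And>M. D' M \<noteq> 0 \<Longrightarrow> indep_funs P' skew (\<lambda>z Y. ddet (pencil a UNIV z M) (cm Y M))"
    by (fact generic_independence[OF a])
  obtain h h' where "bij_betw h {0..<card P} P" "bij_betw h' {0..<card P'} P'"
    using ex_bij_betw_nat_finite P(1,2) by blast
  then have h: "inj_on h {..<card P}" "h ` {..<card P} = P"
    and h': "inj_on h' {..<card P'}" "h' ` {..<card P'} = P'"
    by (auto simp: bij_betw_def atLeast0LessThan)
  define F where "F i = (if i < card P then right_int a (h i) else left_int a (h' (i - card P)))" for i
  have F: "F i \<in> integrals a" if "i < ?d" for i
  proof (cases "i < card P")
    case True
    then show ?thesis using h(2) P(3) by (auto simp: F_def integrals_def)
  next
    case False
    then have "i - card P < card P'" using that card by simp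
    then show ?thesis using h'(2) P(4) False by (auto simp: F_def integrals_def)
  qed
  have H: "?H x = energy first A x" if "x \<in> TSO" for x
    by (rule energy_eq[OF b _ that]) (rule assms(2))
  show "liouville_integrable SO ?d ?H"
    unfolding liouville_integrable_def
  proof (intro conjI exI[of _ F] allI impI ballI)
    show "dim (tangent_space SO q) = ?d" if "q \<in> SO" for q :: "real^'n^'n"
      using that by (rule dim_tangent_space_SO)
    show "smooth_function TSO (F i)" if "i < ?d" for i
      using F[OF that] by (rule integrals_smooth)
    show "constant_along_flow SO ?H (F i)" if "i < ?d" for i
      by (rule integrals_constant[OF F[OF that, unfolded a_def] _ H])
        (use assms(2) in fastforce)+
    show "poisson_bracket SO (F i) (F j) z = 0" if "i < ?d" "j < ?d" "z \<in> TSO" for i j z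
      using F[OF that(1)] F[OF that(2)] that(3) by (rule integrals_commute)
    \<comment> \<open>\<open>D\<close> tests the right momentum, where the right integrals must be
      independent on all skew matrices; \<open>D'\<close> tests the left momentum, where the left
      integrals must be independent along the coadjoint orbit.\<close>
    let ?U = "{x \<in> TSO. D (snd x ** transpose (fst x)) \<noteq> 0 \<and> D' (transpose (fst x) ** snd x) \<noteq> 0}"
    have "independent_at TSO ?d F x" if xU: "x \<in> ?U" for x
    proof -
      obtain q M where q: "q \<in> SO" and M: "M \<in> skew" and x: "x = (q, M ** q)"
        using xU unfolding cotangent_bundle_SO by blast
      have DM: "D M \<noteq> 0" "D' (transpose q ** M ** q) \<noteq> 0"
        using xU by (auto simp: x SO_cancel[OF q] matrix_mul_assoc)
      show ?thesis
        unfolding card[symmetric] x F_def[abs_def]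
        by (rule integrals_independent_at[OF q M h(1) _ h'(1)])
          (simp_all add: h(2) h'(2) P(3,4) D(5)[OF DM(1)] D(6)[OF DM(2)])
    qed
    then show "functionally_independent TSO ?d F"
      unfolding functionally_independent_def
      using generic_set_dense[OF D(1,3,2,4)] by blast
  qed
qed

end
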